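(* Fix $q,\delta\in(0,1)$. Then there exists a constant $c=c(q,\delta)>0$ such that, for integers $k\ge 1$, with $n=4k+3$, $x_n=(01)^k\,1\,(01)^{k+1}\in\{0,1\}^n$ and $y_n=(01)^{k+1}\,1\,(01)^k\in\{0,1\}^n$, at least $c\,n^{3/2}/\log^{7} n$ traces are required to distinguish between $x_n$ and $y_n$ with probability at least $1-\delta$, under trace reconstruction with deletion probability $q$.
   Context: $(01)^k$ denotes the string $0101\cdots01$ of length $2k$; juxtaposition is concatenation. $\{0,1\}^{\le n}$ is the set of binary strings of length at most $n$ (including the empty string). For $x\in\{0,1\}^n$, a trace of $x$ with deletion probability $q$ is the random string obtained by deleting each bit of $x$ independently with probability $q$ and concatenating the remaining bits in order. Its law is the probability measure $\mu_x$ on $\{0,1\}^{\le n}$ given by $\mu_x(w)=(1-q)^{|w|}q^{n-|w|}f(w;x)$, where $|w|$ is the length of $w$ and $f(w;x)$ is the number of strictly increasing tuples $(i_1,\dots,i_{|w|})$ with $x_{i_j}=w_j$ for $1\le j\le|w|$. To distinguish between $x_n$ and $y_n$ with probability at least $1-\delta$ from $T$ traces means that there is a function $g:(\{0,1\}^{\le n})^T\to\{x_n,y_n\}$ satisfying $\mathbb{P}_{\mu_{x}^{T}}[g(\widetilde U^1,\dots,\widetilde U^T)=x]\ge 1-\delta$ for both $x=x_n$ and $x=y_n$, where $\mathbb{P}_{\mu_x^T}$ denotes probability when $\widetilde U^1,\dots,\widetilde U^T$ are independent traces of $x$. $\log$ is the natural logarithm.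
   Formalization: δ is restricted to 0<δ<1/2: for δ≥1/2 the claim is false, since a single trace already suffices for large n (for δ>1/2, guess x_n or y_n by the parity of the trace length, which is right with probability tending to 1/2 for both strings). *)

theory Defs
  imports "HOL-Probability.Probability"
begin

text \<open>Bits are booleans (\<^const>\<open>False\<close> is 0, \<^const>\<open>True\<close> is 1) and binary strings are lists.\<close>

definition strings_upto :: "nat \<Rightarrow> bool list set" where
  "strings_upto n = {w. length w \<le> n}"

definition pow01 :: "nat \<Rightarrow> bool list" where
  "pow01 k = concat (replicate k [False, True])"

definition x_string :: "nat \<Rightarrow> bool list" where
  "x_string k = pow01 k @ [True] @ pow01 (k + 1)"

definition y_string :: "nat \<Rightarrow> bool list" where
  "y_string k = pow01 (k + 1) @ [True] @ pow01 k"

lemma length_pow01 [simp]: "length (pow01 k) = 2 * k"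
  by (induction k) (simp_all add: pow01_def)

lemma length_x_string: "length (x_string k) = 4 * k + 3"
  and length_y_string: "length (y_string k) = 4 * k + 3"
  by (simp_all add: x_string_def y_string_def)

text \<open>The random function decides for each position whether that bit is kept, which
  happens with probability \<open>1 - q\<close>.\<close>

definition trace_pmf :: "real \<Rightarrow> bool list \<Rightarrow> bool list pmf" where
  "trace_pmf q x =
     map_pmf (\<lambda>keep. nths x {i. keep i})
       (Pi_pmf {..<length x} False (\<lambda>_. bernoulli_pmf (1 - q)))"

definition num_embeddings :: "bool list \<Rightarrow> bool list \<Rightarrow> nat" where
  "num_embeddings w x =
     card {is. length is = length w \<and> sorted_wrt (<) is \<and> set is \<subseteq> {..<length x} \<and>
               (\<forall>j<length w. x ! (is ! j) = w ! j)}"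

text \<open>The test \<open>g\<close> matters only on the \<open>T\<close>-tuples of strings of length at most \<open>n\<close>,
  which carry all the mass when \<open>x\<close> and \<open>y\<close> have length \<open>n\<close>. Only \<open>\<delta> < 1/2\<close> makes
  distinguishing hard: for \<open>\<delta> > 1/2\<close> and \<open>0 < q < 1\<close> the parity of the length of a single
  trace already suffices for long strings.\<close>

definition distinguishable :: "real \<Rightarrow> real \<Rightarrow> nat \<Rightarrow> nat \<Rightarrow> bool list \<Rightarrow> bool list \<Rightarrow> bool" where
  "distinguishable q \<delta> n T x y \<longleftrightarrow>
     (\<exists>g \<in> {us. length us = T \<and> set us \<subseteq> strings_upto n} \<rightarrow> {x, y}.
        \<forall>z\<in>{x, y}.
          measure_pmf.prob (replicate_pmf T (trace_pmf q z)) {us. g us = z} \<ge> 1 - \<delta>)"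

lemma nths_conv_map_nth:
  "nths xs I = map ((!) xs) (sorted_list_of_set {i\<in>I. i < length xs})"
proof -
  have "nths xs I = nths (map ((!) xs) [0..<length xs]) I"
    by (simp add: map_nth)
  also have "\<dots> = map ((!) xs) (nths [0..<length xs] I)"
    by (simp add: nths_map)
  also have "nths [0..<length xs] I = sorted_list_of_set {i\<in>I. i < length xs}"
  proof (rule strict_sorted_equal)
    show "sorted_wrt (<) (nths [0..<length xs] I)"
      by (simp add: strict_sorted_iff sorted_nths)
    show "set (nths [0..<length xs] I) = set (sorted_list_of_set {i \<in> I. i < length xs})"
      by (force simp: set_nths)
  qed (rule strict_sorted_list_of_set)
  finally show ?thesis .
qed

lemma num_embeddings_conv_subsets:
  "num_embeddings w x = card {I. I \<subseteq> {..<length x} \<and> nths x I = w}"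
proof -
  let ?A = "{is. length is = length w \<and> sorted_wrt (<) is \<and> set is \<subseteq> {..<length x} \<and>
               (\<forall>j<length w. x ! (is ! j) = w ! j)}"
  let ?B = "{I. I \<subseteq> {..<length x} \<and> nths x I = w}"
  have A_eq: "?A = {is. sorted_wrt (<) is \<and> set is \<subseteq> {..<length x} \<and> map ((!) x) is = w}"
    by (auto simp: list_eq_iff_nth_eq)
  have nths_eq: "nths x I = map ((!) x) (sorted_list_of_set I)" if "I \<subseteq> {..<length x}" for I
  proof -
    have "{i\<in>I. i < length x} = I" using that by auto
    then show ?thesis by (simp add: nths_conv_map_nth)
  qed
  have "bij_betw sorted_list_of_set ?B ?A"
  proof (rule bij_betw_byWitness[where f' = set])
    show "\<forall>I\<in>?B. set (sorted_list_of_set I) = I"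
      by (auto intro!: set_sorted_list_of_set intro: finite_subset)
    show sorted_set: "\<forall>is\<in>?A. sorted_list_of_set (set is) = is"
      by (auto simp: strict_sorted_iff sorted_list_of_set.idem_if_sorted_distinct)
    show "sorted_list_of_set ` ?B \<subseteq> ?A"
      unfolding A_eq using finite_subset[of _ "{..<length x}"] by (auto simp: nths_eq)
    show "set ` ?A \<subseteq> ?B"
      unfolding A_eq by (auto simp: nths_eq strict_sorted_iff sorted_list_of_set.idem_if_sorted_distinct)
  qed
  then show ?thesis
    unfolding num_embeddings_def by (rule bij_betw_same_card[symmetric])
qed

lemma pmf_trace_pmf:
  assumes q: "0 \<le> q" "q \<le> 1"
  shows "pmf (trace_pmf q x) w =
    (1 - q) ^ length w * q ^ (length x - length w) * real (num_embeddings w x)"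
proof -
  let ?n = "length x"
  let ?P = "Pi_pmf {..<?n} False (\<lambda>_. bernoulli_pmf (1 - q))"
  let ?B = "{I. I \<subseteq> {..<?n} \<and> nths x I = w}"
  let ?F = "(\<lambda>I i. i \<in> I) ` ?B"
  have finB: "finite ?B" by (rule finite_subset[of _ "Pow {..<?n}"]) auto
  have inj: "inj_on (\<lambda>I i. i \<in> I) ?B" by (auto simp: inj_on_def fun_eq_iff)
  have "pmf (trace_pmf q x) w = measure_pmf.prob ?P ((\<lambda>keep. nths x {i. keep i}) -` {w})"
    by (simp add: trace_pmf_def pmf_map)
  also have "\<dots> = measure_pmf.prob ?P ?F"
  proof (rule measure_pmf.finite_measure_eq_AE)
    show "AE keep in measure_pmf ?P.
      (keep \<in> (\<lambda>keep. nths x {i. keep i}) -` {w}) = (keep \<in> ?F)"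
    proof (rule AE_pmfI)
      fix keep assume "keep \<in> set_pmf ?P"
      then have "\<forall>i. i \<notin> {..<?n} \<longrightarrow> keep i = False"
        using set_Pi_pmf_subset[of "{..<?n}" False] by blast
      then have sub: "{i. keep i} \<subseteq> {..<?n}" by auto
      show "(keep \<in> (\<lambda>keep. nths x {i. keep i}) -` {w}) = (keep \<in> ?F)"
      proof
        assume "keep \<in> (\<lambda>keep. nths x {i. keep i}) -` {w}"
        with sub show "keep \<in> ?F" by (intro image_eqI[of _ _ "{i. keep i}"]) auto
      qed auto
    qed
  qed auto
  also have "\<dots> = (\<Sum>f\<in>?F. pmf ?P f)"
    using finB by (intro measure_measure_pmf_finite) auto
  also have "\<dots> = (\<Sum>I\<in>?B. pmf ?P (\<lambda>i. i \<in> I))"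
    using inj by (simp add: sum.reindex)
  also have "\<dots> = (\<Sum>I\<in>?B. (1 - q) ^ length w * q ^ (?n - length w))"
  proof (rule sum.cong[OF refl])
    fix I assume "I \<in> ?B"
    then have I: "I \<subseteq> {..<?n}" "nths x I = w" by auto
    then have finI: "finite I" by (auto intro: finite_subset)
    have "{i. i < ?n \<and> i \<in> I} = I" using I by auto
    then have lw: "length w = card I" using I(2) by (metis length_nths)
    have "pmf ?P (\<lambda>i. i \<in> I) = (\<Prod>i<?n. pmf (bernoulli_pmf (1 - q)) (i \<in> I))"
      using I by (subst pmf_Pi') auto
    also have "\<dots> = (\<Prod>i<?n. if i \<in> I then 1 - q else q)"
      using q by (intro prod.cong) auto
    also have "\<dots> = (1 - q) ^ card I * q ^ card ({..<?n} - I)"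
      using I by (simp add: prod.If_cases Int_absorb1 Diff_eq)
    also have "card ({..<?n} - I) = ?n - card I"
      using I finI by (simp add: card_Diff_subset)
    finally show "pmf ?P (\<lambda>i. i \<in> I) = (1 - q) ^ length w * q ^ (?n - length w)"
      by (simp add: lw)
  qed
  also have "\<dots> = (1 - q) ^ length w * q ^ (?n - length w) * real (card ?B)"
    by simp
  finally show ?thesis by (simp add: num_embeddings_conv_subsets)
qed

end

theory Submission
  imports Defs "HOL-Real_Asymp.Real_Asymp"
begin

text \<open>The number of embeddings of a string \<open>w\<close> into \<open>(01)\<^sup>k\<close> is the binomial coefficient
  \<open>k + u choose |w|\<close>, where \<open>u\<close> is the number of blocks 01 in \<open>w\<close>. Cutting \<open>w\<close> at every position
  \<open>l\<close>, the first part being embedded before and the second part after the defect, writes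
  \<open>f(w;x) - f(w;y)\<close> as a sum of terms \<open>c\<^sub>l\<close>, modified by a nearly constant factor at those \<open>l\<close>
  where \<open>w\<close> reads 11. The product of \<open>(01)\<^sup>k\<close> and \<open>(01)\<^sup>k\<^sup>+\<^sup>1\<close> does not depend on the order of the
  factors, so the same \<open>c\<^sub>l\<close>, modified where \<open>w\<close> reads 01, sum to zero. For a typical \<open>w\<close> the
  patterns 01 and 11 have constant frequencies on windows of length \<open>n\<^sup>1\<^sup>/\<^sup>2\<close> up to a discrepancy
  \<open>n\<^sup>1\<^sup>/\<^sup>4\<close>, the sequence \<open>c\<^sub>l\<close> lives on such a window and has total variation \<open>1/n\<close> relative to
  \<open>f(w;x)\<close>, and summation by parts bounds the relative difference of the two laws by \<open>n\<^sup>-\<^sup>3\<^sup>/\<^sup>4\<close>, all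
  up to logarithms. Hence one minus the Hellinger affinity of the two traces is of order \<open>n\<^sup>-\<^sup>3\<^sup>/\<^sup>2\<close>, and
  the affinity is multiplicative over independent traces.\<close>

section \<open>Counting embeddings\<close>

text \<open>Bounding each \<open>c\<^sub>l\<close> by its size gives a relative difference of order
  \<open>n^(-1/2)\<close> up to logarithms, hence only about \<open>n\<close> traces. The rest must
  come from cancellation, and the obstacle is the plain sum of the \<open>c\<^sub>l\<close>: nothing
  in \<open>f(w;x) - f(w;y)\<close> itself says that it is small. The alternating string without
  defect supplies the missing linear equation. There the \<open>c\<^sub>l\<close> are multiplied by
  about \<open>q^2\<close> at the patterns 01; these have frequency at most 1/2, so after averaging
  the equation reads (plain sum) times (a factor at least 1/2) = (small error). In both strings the
  cut is placed just before the defect, so that the two products differ only in which side holds the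
  additional block 01. The binomial formula makes each of them explicit, and a move of the cut by
  one letter multiplies it by a rational function of the parameters; only the leading terms of these
  functions matter.\<close>

fun emb :: "bool list \<Rightarrow> bool list \<Rightarrow> nat" where
  "emb [] x = 1"
| "emb (c # w) [] = 0"
| "emb (c # w) (b # x) = emb (c # w) x + (if b = c then emb w x else 0)"

text \<open>The predicate sees a subset only through the membership of 0 and the rest shifted down,
  which is the form in which \<open>nths_Cons\<close> splits off the first letter.\<close>

lemma subsets_lessThan_Suc:
  "{I. I \<subseteq> {..<Suc n} \<and> Q (0 \<in> I) {j. Suc j \<in> I}} =
     (\<lambda>J. Suc ` J) ` {J. J \<subseteq> {..<n} \<and> Q False J} \<union>
     (\<lambda>J. insert 0 (Suc ` J)) ` {J. J \<subseteq> {..<n} \<and> Q True J}" (is "?L = ?A \<union> ?B")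
proof (intro equalityI subsetI)
  fix I assume I: "I \<in> ?L"
  define J where "J = {j. Suc j \<in> I}"
  have J: "J \<subseteq> {..<n}" "Q (0 \<in> I) J" using I by (auto simp: J_def)
  show "I \<in> ?A \<union> ?B"
  proof (cases "0 \<in> I")
    case True
    then have "I = insert 0 (Suc ` J)"
      by (auto simp: J_def image_iff) (metis not0_implies_Suc)
    then show ?thesis using J True by auto
  next
    case False
    then have "I = Suc ` J"
      by (auto simp: J_def image_iff) (metis not0_implies_Suc)
    then show ?thesis using J False by auto
  qed
next
  have [simp]: "{j. j \<in> J} = J" for J :: "nat set" by auto
  fix I assume "I \<in> ?A \<union> ?B"
  then show "I \<in> ?L" by (auto simp: image_iff)
qed

lemma num_embeddings_eq_emb: "num_embeddings w x = emb w x"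
proof -
  have "card {I. I \<subseteq> {..<length x} \<and> nths x I = w} = emb w x"
  proof (induction x arbitrary: w)
    case Nil
    show ?case by (cases w) auto
  next
    case (Cons b x)
    let ?S = "\<lambda>w. {J. J \<subseteq> {..<length x} \<and> nths x J = w}"
    have fin: "finite (?S w)" for w
      by (rule finite_subset[of _ "Pow {..<length x}"]) auto
    have eq: "{I. I \<subseteq> {..<length (b # x)} \<and> nths (b # x) I = w} =
        (\<lambda>J. Suc ` J) ` ?S w \<union> (\<lambda>J. insert 0 (Suc ` J)) ` {J. J \<subseteq> {..<length x} \<and> b # nths x J = w}"
      using subsets_lessThan_Suc[of "length x" "\<lambda>z J. (if z then [b] else []) @ nths x J = w"]
      by (simp add: nths_Cons)
    have inj1: "inj_on (\<lambda>J. Suc ` J) A" for A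
      by (intro inj_onI) (simp add: inj_image_eq_iff)
    have inj2: "inj_on (\<lambda>J. insert 0 (Suc ` J)) A" for A
      by (intro inj_onI) (metis (no_types, lifting) Diff_insert_absorb imageE inj_Suc inj_image_eq_iff
          insert_absorb insert_ident old.nat.distinct(2))
    have fin2: "finite {J. J \<subseteq> {..<length x} \<and> b # nths x J = w}"
      by (rule finite_subset[of _ "Pow {..<length x}"]) auto
    have "card {I. I \<subseteq> {..<length (b # x)} \<and> nths (b # x) I = w} =
        card (?S w) + card {J. J \<subseteq> {..<length x} \<and> b # nths x J = w}"
      unfolding eq
      by (subst card_Un_disjoint) (auto simp: fin fin2 card_image inj1 inj2)
    also have "card {J. J \<subseteq> {..<length x} \<and> b # nths x J = w} =
        (case w of [] \<Rightarrow> 0 | c # w' \<Rightarrow> if b = c then emb w' x else 0)"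
      by (cases w) (auto simp: Cons.IH)
    finally show ?case by (cases w) (auto simp: Cons.IH)
  qed
  then show ?thesis by (simp add: num_embeddings_conv_subsets)
qed

lemma emb_eq_0: "length x < length w \<Longrightarrow> emb w x = 0"
  by (induction w x rule: emb.induct) auto

text \<open>An embedding into a concatenation is classified by the number \<open>j\<close> of
  letters of \<open>w\<close> that go to the first factor.\<close>

lemma emb_append:
  "emb w (x @ y) = (\<Sum>j\<le>length w. emb (take j w) x * emb (drop j w) y)"
proof (induction x arbitrary: w)
  case Nil
  have "emb (take j w) [] = (if j = 0 then 1 else 0)" if "j \<le> length w" for j
    using that by (cases w; cases j) auto
  then have "(\<Sum>j\<le>length w. emb (take j w) [] * emb (drop j w) y) =
      (\<Sum>j\<le>length w. if j = 0 then emb (drop j w) y else 0)"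
    by (intro sum.cong) auto
  then show ?case by simp
next
  case (Cons b x)
  show ?case
  proof (cases w)
    case Nil
    then show ?thesis by simp
  next
    case w: (Cons c w')
    have split: "(\<Sum>j\<le>length w. f j) = f 0 + (\<Sum>i\<le>length w'. f (Suc i))" for f :: "nat \<Rightarrow> nat"
      by (simp add: w sum.atMost_Suc_shift del: sum.atMost_Suc)
    have "emb w ((b # x) @ y) = emb w (x @ y) + (if b = c then emb w' (x @ y) else 0)"
      by (simp add: w)
    also have "emb w (x @ y) = emb w y + (\<Sum>i\<le>length w'. emb (c # take i w') x * emb (drop i w') y)"
      by (subst Cons.IH, subst split) (simp add: w)
    also have "emb w' (x @ y) = (\<Sum>i\<le>length w'. emb (take i w') x * emb (drop i w') y)"
      by (rule Cons.IH)
    finally show ?thesis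
      by (subst split) (auto simp: w sum.distrib algebra_simps)
  qed
qed

lemma emb_Cons_ge: "emb w x \<le> emb w (b # x)"
  by (cases w) auto

lemma emb_append_mono:
  assumes "\<And>w. emb w y \<le> emb w y'"
  shows "emb w (x @ y) \<le> emb w (x @ y')"
  unfolding emb_append by (intro sum_mono mult_mono) (auto simp: assms)

text \<open>The boolean argument is the preceding bit. With \<open>True\<close> in front nothing is
  counted across the boundary, so exactly the blocks 01 inside the string are counted; with
  \<open>False\<close> a leading 1 counts as well.\<close>

fun cnt01 :: "bool \<Rightarrow> bool list \<Rightarrow> nat" where
  "cnt01 b [] = 0"
| "cnt01 b (c # w) = (if \<not> b \<and> c then 1 else 0) + cnt01 c w"

lemma pow01_0 [simp]: "pow01 0 = []"
  and pow01_Suc: "pow01 (Suc k) = False # True # pow01 k"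
  by (simp_all add: pow01_def)

lemma pow01_add: "pow01 (j + k) = pow01 j @ pow01 k"
  by (induction j) (auto simp: pow01_Suc)

lemma cnt01_True_le: "2 * cnt01 True w \<le> length w"
  and cnt01_False_le: "2 * cnt01 False w \<le> length w + 1"
proof (induction w)
  case (Cons a w)
  { case 1 show ?case using Cons by (cases a) auto }
  { case 2 show ?case using Cons by (cases a) auto }
qed auto

text \<open>Induction on \<open>k\<close> with Pascal's rule. At \<open>k = 0\<close> the
  coefficient vanishes for nonempty \<open>w\<close>, which has fewer blocks 01 than letters. In the
  step a leading 01 of \<open>w\<close> can use up the whole first block of the text; Pascal's rule
  is then applied twice, and removing these two letters lowers \<open>cnt01\<close> by one, which
  keeps the upper indices aligned.\<close>

lemma emb_pow01: "emb w (pow01 k) = (k + cnt01 True w) choose length w"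
proof (induction k arbitrary: w)
  case 0
  show ?case
  proof (cases w)
    case (Cons c w')
    then show ?thesis using cnt01_True_le[of w] by simp
  qed simp
next
  case (Suc k)
  show ?case
  proof (cases w)
    case w: (Cons c w')
    show ?thesis
    proof (cases c)
      case True
      then show ?thesis by (simp add: w pow01_Suc Suc.IH)
    next
      case False
      show ?thesis
      proof (cases w')
        case Nil
        then show ?thesis using False by (simp add: w pow01_Suc Suc.IH)
      next
        case w': (Cons d w'')
        then show ?thesis using False by (cases d) (simp_all add: w pow01_Suc Suc.IH)
      qed
    qed
  qed simp
qed

text \<open>The 1 in front can serve only a leading 1 of \<open>w\<close>; Pascal's rule then raises
  the upper index by one.\<close>

lemma emb_True_pow01:
  "emb w (True # pow01 k) =
     (k + (if w \<noteq> [] \<and> hd w then 1 else 0) + cnt01 True w) choose length w"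
  by (cases w) (auto simp: emb_pow01)

section \<open>Law and length of a trace\<close>

lemma pmf_trace_emb:
  assumes "0 \<le> q" "q \<le> 1"
  shows "pmf (trace_pmf q x) w = (1 - q) ^ length w * q ^ (length x - length w) * real (emb w x)"
  using pmf_trace_pmf[OF assms] by (simp add: num_embeddings_eq_emb)

lemma map_length_trace_pmf:
  assumes "0 \<le> q" "q \<le> 1"
  shows "map_pmf length (trace_pmf q x) = binomial_pmf (length x) (1 - q)"
proof -
  have "length (nths x {i. keep i}) = card {i \<in> {..<length x}. keep i}" for keep
    by (simp add: length_nths)
  then show ?thesis
    unfolding trace_pmf_def using assms
    by (subst binomial_pmf_altdef'[of "{..<length x}" _ _ False]) (auto simp: map_pmf_comp)
qed

lemma prob_length_trace_pmf:
  assumes "0 < q" "q < 1" "x \<noteq> []" "\<epsilon> \<ge> 0"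
  shows "measure_pmf.prob (trace_pmf q x) {w. \<bar>real (length w) - real (length x) * (1 - q)\<bar> \<ge> \<epsilon>}
           \<le> 2 * exp (-2 * \<epsilon>\<^sup>2 / real (length x))"
proof -
  interpret binomial_distribution "length x" "1 - q"
    by unfold_locales (use assms in auto)
  have "measure_pmf.prob (trace_pmf q x) {w. \<bar>real (length w) - real (length x) * (1 - q)\<bar> \<ge> \<epsilon>} =
      measure_pmf.prob (map_pmf length (trace_pmf q x)) {l. \<bar>real l - real (length x) * (1 - q)\<bar> \<ge> \<epsilon>}"
    by simp
  also have "\<dots> = measure_pmf.prob (binomial_pmf (length x) (1 - q)) {l. \<bar>real l - real (length x) * (1 - q)\<bar> \<ge> \<epsilon>}"
    using assms by (simp only: map_length_trace_pmf)
  also have "\<dots> \<le> 2 * exp (-2 * \<epsilon>\<^sup>2 / real (length x))"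
    using prob_abs_ge assms by simp
  finally show ?thesis .
qed

lemma set_trace_pmf: "set_pmf (trace_pmf q x) \<subseteq> strings_upto (length x)"
proof -
  have "card {i. i < n \<and> keep i} \<le> n" for keep and n :: nat
    using card_mono[of "{..<n}" "{i. i < n \<and> keep i}"] by auto
  then show ?thesis by (auto simp: trace_pmf_def strings_upto_def length_nths)
qed

section \<open>Typical traces\<close>

lemma bernoulli_mgf_le:
  fixes r t :: real
  assumes "0 \<le> r" "r \<le> 1"
  shows "r * exp (t * (1 - r)) + (1 - r) * exp (t * (0 - r)) \<le> exp (t\<^sup>2 / 8)"
proof -
  have main: "p * exp (h * (1 - p)) + (1 - p) * exp (h * (0 - p)) \<le> exp (h\<^sup>2 / 8)"
    if "h \<ge> 0" "0 \<le> p" "p \<le> 1" for h p :: real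
  proof -
    have pos: "1 + p * (exp h - 1) > 0"
      using that by (intro add_pos_nonneg mult_nonneg_nonneg) auto
    have "p * exp (h * (1 - p)) + (1 - p) * exp (h * (0 - p)) = exp (- h * p) * (1 + p * (exp h - 1))"
      by (simp add: algebra_simps exp_diff exp_minus field_simps)
    also have "\<dots> = exp (- h * p + ln (1 + p * (exp h - 1)))"
      by (simp only: exp_add exp_ln[OF pos])
    also have "\<dots> \<le> exp (h\<^sup>2 / 8)"
      using Hoeffdings_lemma_aux[of h p] that by simp
    finally show ?thesis .
  qed
  show ?thesis
  proof (cases "t \<ge> 0")
    case True
    then show ?thesis using main assms by blast
  next
    case False
    \<comment> \<open>Exchanging the two outcomes reverses the sign of \<open>t\<close>.\<close>
    then show ?thesis using main[of "-t" "1 - r"] assms by (simp add: algebra_simps)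
  qed
qed

text \<open>Probability that a chain of bits started at \<open>b\<close>, flipping with probability
  \<open>r\<close> at each step, produces the given string.\<close>

fun flip_weight :: "real \<Rightarrow> bool \<Rightarrow> bool list \<Rightarrow> real" where
  "flip_weight r b [] = 1"
| "flip_weight r b (c # w) = (if c = b then 1 - r else r) * flip_weight r c w"

text \<open>Value on the string of a martingale of this chain: centred flip indicators, with
  coefficients that may depend on the time and the current bit.\<close>

fun flip_sum :: "real \<Rightarrow> (nat \<Rightarrow> bool \<Rightarrow> real) \<Rightarrow> bool \<Rightarrow> bool list \<Rightarrow> real" where
  "flip_sum r G b [] = 0"
| "flip_sum r G b (c # w) = G 0 b * (of_bool (c \<noteq> b) - r) + flip_sum r (\<lambda>l. G (Suc l)) c w"

lemma finite_lists_length [simp]: "finite {w :: bool list. length w = m}"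
  using finite_lists_length_eq[of "UNIV :: bool set" m] by simp

lemma finite_strings_upto [simp]: "finite (strings_upto m)"
  using finite_lists_length_le[of "UNIV :: bool set" m] by (simp add: strings_upto_def)

lemma sum_lists_Suc:
  fixes f :: "bool list \<Rightarrow> real"
  shows "(\<Sum>w | length w = Suc m. f w) =
    (\<Sum>w | length w = m. f (True # w)) + (\<Sum>w | length w = m. f (False # w))"
proof -
  have "{w :: bool list. length w = Suc m} =
      (#) True ` {w. length w = m} \<union> (#) False ` {w. length w = m}"
    by (auto simp: length_Suc_conv image_iff)
  moreover have "(#) True ` {w. length w = m} \<inter> (#) False ` {w. length w = m} = {}"
    by auto
  ultimately show ?thesis
    by (simp add: sum.union_disjoint sum.reindex)
qed

lemma flip_weight_nonneg: "0 \<le> r \<Longrightarrow> r \<le> 1 \<Longrightarrow> 0 \<le> flip_weight r b w"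
  by (induction w arbitrary: b) auto

text \<open>The Azuma-Hoeffding argument: given the past, an increment is a centred Bernoulli
  variable times a number of size at most \<open>g l\<close>, and \<open>bernoulli_mgf_le\<close>
  bounds its exponential moment. Peeling off the first letter leaves a chain started at either bit
  with shifted coefficients, hence the induction over arbitrary \<open>b\<close>, \<open>G\<close>
  and \<open>g\<close>.\<close>

lemma flip_sum_mgf_le:
  assumes r: "0 \<le> r" "r \<le> 1" and G: "\<And>l b. \<bar>G l b\<bar> \<le> g l"
  shows "(\<Sum>w | length w = m. flip_weight r b w * exp (s * flip_sum r G b w))
    \<le> exp (s\<^sup>2 / 8 * (\<Sum>l<m. (g l)\<^sup>2))"
  using G
proof (induction m arbitrary: b G g)
  case 0
  have "{w :: bool list. length w = 0} = {[]}" by auto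
  then show ?case by simp
next
  case (Suc m)
  define t where "t = s * G 0 b"
  define E where "E = exp (s\<^sup>2 / 8 * (\<Sum>l<m. (g (Suc l))\<^sup>2))"
  define M where "M c = (\<Sum>w | length w = m. flip_weight r c w *
      exp (s * flip_sum r (\<lambda>l. G (Suc l)) c w))" for c
  have M: "M c \<le> E" for c
    unfolding M_def E_def by (rule Suc.IH) (rule Suc.prems)
  have step: "(\<Sum>w | length w = m. flip_weight r b (c # w) * exp (s * flip_sum r G b (c # w))) =
      (if c = b then 1 - r else r) * exp (t * (of_bool (c \<noteq> b) - r)) * M c" for c
    unfolding M_def sum_distrib_left
    by (rule sum.cong) (simp_all only: flip_sum.simps flip_weight.simps distrib_left exp_add t_def mult_ac)
  have "(\<Sum>w | length w = Suc m. flip_weight r b w * exp (s * flip_sum r G b w)) =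
      r * exp (t * (1 - r)) * M (\<not> b) + (1 - r) * exp (t * (0 - r)) * M b"
    unfolding sum_lists_Suc step by (cases b) simp_all
  also have "\<dots> \<le> r * exp (t * (1 - r)) * E + (1 - r) * exp (t * (0 - r)) * E"
    using r M by (intro add_mono mult_left_mono) auto
  also have "\<dots> = (r * exp (t * (1 - r)) + (1 - r) * exp (t * (0 - r))) * E"
    by (simp add: algebra_simps)
  also have "\<dots> \<le> exp (t\<^sup>2 / 8) * E"
    using bernoulli_mgf_le[OF r] by (intro mult_right_mono) (auto simp: E_def)
  also have "\<dots> \<le> exp (s\<^sup>2 * (g 0)\<^sup>2 / 8) * E"
  proof -
    have "(G 0 b)\<^sup>2 \<le> (g 0)\<^sup>2"
      using Suc.prems[of 0 b] by (metis abs_ge_zero power2_abs power_mono)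
    then have "t\<^sup>2 \<le> s\<^sup>2 * (g 0)\<^sup>2"
      by (simp add: t_def power_mult_distrib mult_left_mono)
    then show ?thesis by (auto simp: E_def intro!: mult_right_mono)
  qed
  also have "\<dots> = exp (s\<^sup>2 / 8 * (\<Sum>l<Suc m. (g l)\<^sup>2))"
    unfolding E_def exp_add[symmetric] sum.lessThan_Suc_shift by (simp add: algebra_simps)
  finally show ?case .
qed

lemma flip_sum_tail:
  assumes r: "0 \<le> r" "r \<le> 1" and G: "\<And>l b. \<bar>G l b\<bar> \<le> g l"
    and N: "(\<Sum>l<m. (g l)\<^sup>2) \<le> N" "N > 0" and t: "t \<ge> 0"
  shows "(\<Sum>w | length w = m \<and> flip_sum r G b w \<ge> t. flip_weight r b w) \<le> exp (- 2 * t\<^sup>2 / N)"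
proof -
  \<comment> \<open>Minimiser of the exponent \<open>s^2 N / 8 - s t\<close> in the Chernoff
    bound.\<close>
  define s where "s = 4 * t / N"
  have s: "s \<ge> 0" using N t by (simp add: s_def)
  have "(\<Sum>w | length w = m \<and> flip_sum r G b w \<ge> t. flip_weight r b w) \<le>
      (\<Sum>w | length w = m \<and> flip_sum r G b w \<ge> t. flip_weight r b w * exp (s * flip_sum r G b w) * exp (- s * t))"
  proof (rule sum_mono)
    fix w assume "w \<in> {w. length w = m \<and> flip_sum r G b w \<ge> t}"
    then have "1 \<le> exp (s * flip_sum r G b w - s * t)"
      using s by (simp add: mult_left_mono)
    then have "flip_weight r b w * 1 \<le> flip_weight r b w * exp (s * flip_sum r G b w - s * t)"
      using flip_weight_nonneg[OF r] by (intro mult_left_mono) auto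
    then show "flip_weight r b w \<le> flip_weight r b w * exp (s * flip_sum r G b w) * exp (- s * t)"
      by (simp add: exp_diff exp_minus field_simps)
  qed
  also have "\<dots> \<le> (\<Sum>w | length w = m. flip_weight r b w * exp (s * flip_sum r G b w) * exp (- s * t))"
    using flip_weight_nonneg[OF r] by (intro sum_mono2) auto
  also have "\<dots> = (\<Sum>w | length w = m. flip_weight r b w * exp (s * flip_sum r G b w)) * exp (- s * t)"
    by (simp add: sum_distrib_right)
  also have "\<dots> \<le> exp (s\<^sup>2 / 8 * (\<Sum>l<m. (g l)\<^sup>2)) * exp (- s * t)"
    using flip_sum_mgf_le[OF r G] by (intro mult_right_mono) auto
  also have "\<dots> \<le> exp (s\<^sup>2 / 8 * N) * exp (- s * t)"
    using N by (auto intro!: mult_right_mono mult_left_mono)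
  also have "\<dots> = exp (- 2 * t\<^sup>2 / N)"
    using N by (simp add: s_def flip: exp_add) (simp add: field_simps power2_eq_square)
  finally show ?thesis .
qed

lemma flip_sum_uminus: "flip_sum r (\<lambda>l b. - G l b) b w = - flip_sum r G b w"
proof (induction w arbitrary: G b)
  case (Cons c w)
  show ?case using Cons.IH[of "\<lambda>l. G (Suc l)" c] by simp
qed simp

lemma sum_Un_le:
  fixes f :: "'a \<Rightarrow> real"
  assumes "finite A" "finite B" "\<And>x. 0 \<le> f x"
  shows "sum f (A \<union> B) \<le> sum f A + sum f B"
  using assms sum_nonneg[of "A \<inter> B" f] by (simp add: sum_Un)

lemma sum_UN_le:
  fixes f :: "'a \<Rightarrow> real"
  assumes "finite I" "\<And>i. finite (A i)" "\<And>x. 0 \<le> f x"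
  shows "sum f (\<Union>i\<in>I. A i) \<le> (\<Sum>i\<in>I. sum f (A i))"
  using assms(1)
proof (induction I)
  case (insert i I)
  have "sum f (A i \<union> (\<Union>i\<in>I. A i)) \<le> sum f (A i) + sum f (\<Union>i\<in>I. A i)"
    using insert assms by (intro sum_Un_le) auto
  then show ?case using insert by simp
qed simp

lemma flip_sum_abs_tail:
  assumes r: "0 \<le> r" "r \<le> 1" and G: "\<And>l b. \<bar>G l b\<bar> \<le> g l"
    and N: "(\<Sum>l<m. (g l)\<^sup>2) \<le> N" "N > 0" and t: "t \<ge> 0"
  shows "(\<Sum>w | length w = m \<and> \<bar>flip_sum r G b w\<bar> \<ge> t. flip_weight r b w) \<le> 2 * exp (- 2 * t\<^sup>2 / N)"
proof -
  have fin: "finite {w :: bool list. length w = m \<and> Q w}" for Q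
    by (rule finite_subset[OF _ finite_lists_length[of m]]) auto
  have "(\<Sum>w | length w = m \<and> \<bar>flip_sum r G b w\<bar> \<ge> t. flip_weight r b w) \<le>
     (\<Sum>w \<in> {w. length w = m \<and> flip_sum r G b w \<ge> t} \<union>
        {w. length w = m \<and> flip_sum r (\<lambda>l b. - G l b) b w \<ge> t}. flip_weight r b w)"
    using fin flip_weight_nonneg[OF r] by (intro sum_mono2) (auto simp: flip_sum_uminus)
  also have "\<dots> \<le> (\<Sum>w | length w = m \<and> flip_sum r G b w \<ge> t. flip_weight r b w) +
      (\<Sum>w | length w = m \<and> flip_sum r (\<lambda>l b. - G l b) b w \<ge> t. flip_weight r b w)"
    using fin flip_weight_nonneg[OF r] by (intro sum_Un_le) auto
  also have "\<dots> \<le> exp (- 2 * t\<^sup>2 / N) + exp (- 2 * t\<^sup>2 / N)"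
    using assms by (intro add_mono flip_sum_tail[where g = g]) auto
  finally show ?thesis by simp
qed

text \<open>The bit before the first symbol counts as 1, the last bit of a block 01.\<close>

definition bit_at :: "bool list \<Rightarrow> nat \<Rightarrow> bool" where
  "bit_at w l = (True # w) ! l"

definition flip_at :: "bool list \<Rightarrow> nat \<Rightarrow> real" where
  "flip_at w l = of_bool (bit_at w (Suc l) \<noteq> bit_at w l)"

definition sign_at :: "bool list \<Rightarrow> nat \<Rightarrow> real" where
  "sign_at w l = (if bit_at w l then 1 else -1)"

definition rise_at :: "bool list \<Rightarrow> nat \<Rightarrow> bool" where
  "rise_at w l \<longleftrightarrow> \<not> bit_at w l \<and> bit_at w (Suc l)"

lemma flip_sum_eq_sum:
  "flip_sum r G b w = (\<Sum>l<length w. G l ((b # w) ! l) * (of_bool (w ! l \<noteq> (b # w) ! l) - r))"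
proof (induction w arbitrary: G b)
  case (Cons c w)
  show ?case
    unfolding flip_sum.simps Cons.IH length_Cons sum.lessThan_Suc_shift by simp
qed simp

text \<open>The sum with signs is needed for the pattern 11: the flips alone determine the rises up
  to a boundary term, but not the share of ones. All windows are controlled at once because
  summation by parts uses every initial segment of a window.\<close>

definition balanced :: "real \<Rightarrow> real \<Rightarrow> bool list \<Rightarrow> bool" where
  "balanced r L w \<longleftrightarrow> (\<forall>i j. i \<le> j \<and> j \<le> length w \<longrightarrow>
     \<bar>\<Sum>l=i..<j. flip_at w l - r\<bar> \<le> sqrt (real (j - i)) * L \<and>
     \<bar>\<Sum>l=i..<j. sign_at w l * (flip_at w l - r)\<bar> \<le> sqrt (real (j - i)) * L)"

lemma window_tail:
  assumes r: "0 \<le> r" "r \<le> 1" and L: "L \<ge> 0" and ij: "i \<le> j" "j \<le> m"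
    and G: "\<And>b. \<bar>G b\<bar> \<le> 1"
  shows "(\<Sum>w | length w = m \<and>
      \<bar>\<Sum>l=i..<j. G (bit_at w l) * (flip_at w l - r)\<bar> > sqrt (real (j - i)) * L. flip_weight r True w)
    \<le> 2 * exp (- 2 * L\<^sup>2)" (is "?S \<le> _")
proof (cases "i = j")
  case True
  then show ?thesis by simp
next
  case False
  \<comment> \<open>Coefficients set to zero outside the window turn the window sum into a
    \<open>flip_sum\<close> over the whole string with \<open>N = j - i\<close>.\<close>
  define H where "H l b = (if i \<le> l \<and> l < j then G b else 0)" for l b
  define g :: "nat \<Rightarrow> real" where "g l = of_bool (i \<le> l \<and> l < j)" for l
  have sum: "(\<Sum>l=i..<j. G (bit_at w l) * (flip_at w l - r)) = flip_sum r H True w" if "length w = m" for w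
  proof -
    have "flip_sum r H True w = (\<Sum>l<m. if l \<in> {i..<j} then G (bit_at w l) * (flip_at w l - r) else 0)"
      by (subst flip_sum_eq_sum, rule sum.cong)
        (auto simp: that H_def flip_at_def bit_at_def)
    also have "\<dots> = (\<Sum>l\<in>{..<m} \<inter> {i..<j}. G (bit_at w l) * (flip_at w l - r))"
      by (simp add: sum.inter_restrict)
    also have "{..<m} \<inter> {i..<j} = {i..<j}" using ij by auto
    finally show ?thesis by simp
  qed
  have "(\<Sum>l<m. (g l)\<^sup>2) = (\<Sum>l<m. if l \<in> {i..<j} then 1 else 0)"
    by (intro sum.cong) (auto simp: g_def)
  also have "\<dots> = real (card ({..<m} \<inter> {i..<j}))"
    by (subst sum.inter_restrict[symmetric]) auto
  also have "{..<m} \<inter> {i..<j} = {i..<j}" using ij by auto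
  finally have N: "(\<Sum>l<m. (g l)\<^sup>2) \<le> real (j - i)" by simp
  have "?S \<le> (\<Sum>w | length w = m \<and> \<bar>flip_sum r H True w\<bar> \<ge> sqrt (real (j - i)) * L. flip_weight r True w)"
  proof (rule sum_mono2)
    show "finite {w. length w = m \<and> \<bar>flip_sum r H True w\<bar> \<ge> sqrt (real (j - i)) * L}"
      by (rule finite_subset[OF _ finite_lists_length[of m]]) auto
  qed (auto simp: sum flip_weight_nonneg[OF r])
  also have "\<dots> \<le> 2 * exp (- 2 * (sqrt (real (j - i)) * L)\<^sup>2 / real (j - i))"
    using False ij L N G
    by (intro flip_sum_abs_tail[where g = g] r) (auto simp: H_def g_def)
  also have "\<dots> = 2 * exp (- 2 * L\<^sup>2)"
    using False ij by (simp add: power_mult_distrib)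
  finally show ?thesis .
qed

text \<open>Union bound over \<open>(m+1)^2\<close> pairs of endpoints and two sums, each with a
  two-sided tail.\<close>

lemma unbalanced_weight_le:
  assumes r: "0 \<le> r" "r \<le> 1" and L: "L \<ge> 0"
  shows "(\<Sum>w | length w = m \<and> \<not> balanced r L w. flip_weight r True w)
    \<le> 4 * real (m + 1) ^ 2 * exp (- 2 * L\<^sup>2)"
proof -
  define B where "B G p = {w. length w = m \<and> fst p \<le> snd p \<and>
     \<bar>\<Sum>l=fst p..<snd p. G (bit_at w l) * (flip_at w l - r)\<bar> > sqrt (real (snd p - fst p)) * L}"
    for G :: "bool \<Rightarrow> real" and p :: "nat \<times> nat"
  define I where "I = {..m} \<times> {..m}"
  let ?G1 = "\<lambda>b :: bool. 1 :: real" and ?G2 = "\<lambda>b. if b then 1 else -1 :: real"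
  have fin: "finite (B G p)" for G p
    by (rule finite_subset[OF _ finite_lists_length[of m]]) (auto simp: B_def)
  have bound: "(\<Sum>w\<in>B G p. flip_weight r True w) \<le> 2 * exp (- 2 * L\<^sup>2)"
    if "p \<in> I" "\<And>b. \<bar>G b\<bar> \<le> 1" for G p
  proof (cases "fst p \<le> snd p")
    case True
    then show ?thesis
      using window_tail[OF r L True, of m G] that by (simp add: B_def I_def mem_Times_iff)
  qed (simp add: B_def)
  have "(\<Sum>w | length w = m \<and> \<not> balanced r L w. flip_weight r True w) \<le>
      (\<Sum>w\<in>(\<Union>p\<in>I. B ?G1 p \<union> B ?G2 p). flip_weight r True w)"
  proof (rule sum_mono2)
    show "{w. length w = m \<and> \<not> balanced r L w} \<subseteq> (\<Union>p\<in>I. B ?G1 p \<union> B ?G2 p)"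
      by (force simp: balanced_def B_def I_def sign_at_def not_le)
  qed (auto simp: fin I_def flip_weight_nonneg[OF r])
  also have "\<dots> \<le> (\<Sum>p\<in>I. \<Sum>w\<in>B ?G1 p \<union> B ?G2 p. flip_weight r True w)"
    using fin flip_weight_nonneg[OF r] by (intro sum_UN_le) (auto simp: I_def)
  also have "\<dots> \<le> (\<Sum>p\<in>I. 4 * exp (- 2 * L\<^sup>2))"
  proof (rule sum_mono)
    fix p assume p: "p \<in> I"
    have "(\<Sum>w\<in>B ?G1 p \<union> B ?G2 p. flip_weight r True w) \<le>
        (\<Sum>w\<in>B ?G1 p. flip_weight r True w) + (\<Sum>w\<in>B ?G2 p. flip_weight r True w)"
      using fin flip_weight_nonneg[OF r] by (intro sum_Un_le) auto
    also have "\<dots> \<le> 2 * exp (- 2 * L\<^sup>2) + 2 * exp (- 2 * L\<^sup>2)"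
      using p by (intro add_mono bound) auto
    finally show "(\<Sum>w\<in>B ?G1 p \<union> B ?G2 p. flip_weight r True w) \<le> 4 * exp (- 2 * L\<^sup>2)" by simp
  qed
  also have "\<dots> = 4 * real (m + 1) ^ 2 * exp (- 2 * L\<^sup>2)"
    by (simp add: I_def card_cartesian_product power2_eq_square algebra_simps)
  finally show ?thesis .
qed

text \<open>For \<open>r = 1/(1+q)\<close> a stay weighs \<open>q/(1+q)\<close> and a flip
  \<open>1/(1+q)\<close>, so the right-hand side is \<open>q\<close> to the number of stays plus
  twice the number of rises. Rises and falls alternate: from \<open>True\<close> there are at least
  as many falls as rises, while from \<open>False\<close> there may be one more rise, which accounts
  for the additional factor \<open>q\<close>.\<close>

lemma flip_weight_ge:
  fixes q :: real
  assumes "0 < q" "q \<le> 1"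
  shows "q ^ length w \<le> (1 + q) ^ length w * flip_weight (1 / (1 + q)) True w * q ^ (2 * cnt01 True w)"
    and "q ^ (length w + 1) \<le> (1 + q) ^ length w * flip_weight (1 / (1 + q)) False w * q ^ (2 * cnt01 False w)"
proof (induction w)
  case (Cons c w)
  have [simp]: "1 - 1 / (1 + q) = q / (1 + q)" using assms by (simp add: field_simps)
  have pos: "1 + q > 0" using assms by simp
  have cancel: "(1 + q) ^ Suc l * (a / (1 + q) * x) * y = a * ((1 + q) ^ l * x * y)" for l a x y
    using pos by simp
  { case 1
    show ?case
    proof (cases c)
      case True
      have F: "flip_weight (1 / (1 + q)) True (c # w) = q / (1 + q) * flip_weight (1 / (1 + q)) True w"
        and C: "cnt01 True (c # w) = cnt01 True w"
        using True by simp_all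
      have "q * q ^ length w \<le> q * ((1 + q) ^ length w * flip_weight (1 / (1 + q)) True w * q ^ (2 * cnt01 True w))"
        using Cons.IH(1) assms by (intro mult_left_mono) auto
      then show ?thesis unfolding length_Cons F C cancel
        by simp
    next
      case False
      have F: "flip_weight (1 / (1 + q)) True (c # w) = 1 / (1 + q) * flip_weight (1 / (1 + q)) False w"
        and C: "cnt01 True (c # w) = cnt01 False w"
        using False by simp_all
      show ?thesis unfolding length_Cons F C cancel
        using Cons.IH(2) by simp
    qed }
  { case 2
    show ?case
    proof (cases c)
      case True
      have F: "flip_weight (1 / (1 + q)) False (c # w) = 1 / (1 + q) * flip_weight (1 / (1 + q)) True w"
        and C: "cnt01 False (c # w) = cnt01 True w + 1"
        using True by simp_all
      have "q\<^sup>2 * q ^ length w \<le> q\<^sup>2 * ((1 + q) ^ length w * flip_weight (1 / (1 + q)) True w * q ^ (2 * cnt01 True w))"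
        using Cons.IH(1) assms by (intro mult_left_mono) auto
      then show ?thesis unfolding length_Cons F C cancel
        by (simp add: power2_eq_square power_add mult_ac)
    next
      case False
      have F: "flip_weight (1 / (1 + q)) False (c # w) = q / (1 + q) * flip_weight (1 / (1 + q)) False w"
        and C: "cnt01 False (c # w) = cnt01 False w"
        using False by simp_all
      have "q * q ^ (length w + 1) \<le> q * ((1 + q) ^ length w * flip_weight (1 / (1 + q)) False w * q ^ (2 * cnt01 False w))"
        using Cons.IH(2) assms by (intro mult_left_mono) auto
      then show ?thesis unfolding length_Cons F C cancel
        by simp
    qed }
qed (use assms in auto)

text \<open>Reading an infinite alternating string, the retained bits flip independently with
  probability \<open>1/(1+q)\<close>, since a gap is odd with that probability; a finite trace is a prefix of
  the infinite one. Analytically this is the fact that binomial weights are at most 1.\<close>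

lemma pmf_trace_pow01_le:
  fixes q :: real
  assumes q: "0 < q" "q < 1"
  shows "pmf (trace_pmf q (pow01 k)) w \<le> flip_weight (1 / (1 + q)) True w"
proof -
  define m where "m = length w"
  define c where "c = cnt01 True w"
  have c: "2 * c \<le> m" using cnt01_True_le by (simp add: c_def m_def)
  have nonneg: "0 \<le> flip_weight (1 / (1 + q)) True w"
    using q by (intro flip_weight_nonneg) auto
  show ?thesis
  proof (cases "m \<le> k + c")
    case False
    then have "emb w (pow01 k) = 0" by (simp add: emb_pow01 m_def c_def)
    then show ?thesis using nonneg q by (simp add: pmf_trace_emb)
  next
    case True
    with c have mk: "m \<le> 2 * k" by linarith
    \<comment> \<open>The law at \<open>w\<close> times \<open>(1+q)^m q^(2c)\<close> is this
      binomial weight times \<open>q^m\<close>: \<open>(1-q)^m (1+q)^m\<close> gives the success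
      probability \<open>1 - q^2\<close>, and the remaining powers of \<open>q\<close> pair
      up.\<close>
    have "pmf (binomial_pmf (k + c) (1 - q\<^sup>2)) m \<le> 1" by (rule pmf_le_1)
    then have le1: "real (k + c choose m) * (1 - q\<^sup>2) ^ m * (q\<^sup>2) ^ (k + c - m) \<le> 1"
      using q by (simp add: power_le_one)
    have e: "2 * k - m + 2 * c = 2 * (k + c - m) + m" using True mk by simp
    have "(1 + q) ^ m * q ^ (2 * c) * ((1 - q) ^ m * q ^ (2 * k - m) * real (k + c choose m)) =
        ((1 + q) * (1 - q)) ^ m * q ^ (2 * k - m + 2 * c) * real (k + c choose m)"
      by (simp only: power_mult_distrib power_add mult_ac)
    also have "(1 + q) * (1 - q) = 1 - q\<^sup>2" by (simp add: algebra_simps power2_eq_square)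
    also have "(1 - q\<^sup>2) ^ m * q ^ (2 * k - m + 2 * c) * real (k + c choose m) =
        real (k + c choose m) * (1 - q\<^sup>2) ^ m * (q\<^sup>2) ^ (k + c - m) * q ^ m"
      unfolding e by (simp add: power_add power_mult)
    also have "\<dots> \<le> 1 * q ^ m"
      using le1 q by (intro mult_right_mono) auto
    also have "\<dots> \<le> (1 + q) ^ m * flip_weight (1 / (1 + q)) True w * q ^ (2 * c)"
      using flip_weight_ge(1)[of q w] q by (simp add: m_def c_def)
    finally have "(1 - q) ^ m * q ^ (2 * k - m) * real (k + c choose m) \<le> flip_weight (1 / (1 + q)) True w"
      using q by (simp add: mult.assoc mult.left_commute mult_le_cancel_left)
    then show ?thesis
      using q by (simp add: pmf_trace_emb emb_pow01 m_def c_def)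
  qed
qed

lemma prob_trace_eq_sum:
  assumes "length x \<le> n"
  shows "measure_pmf.prob (trace_pmf q x) S = (\<Sum>w | length w \<le> n \<and> w \<in> S. pmf (trace_pmf q x) w)"
proof -
  have "measure_pmf.prob (trace_pmf q x) S = measure_pmf.prob (trace_pmf q x) {w. length w \<le> n \<and> w \<in> S}"
    using set_trace_pmf[of q x] assms
    by (intro measure_pmf.finite_measure_eq_AE AE_pmfI) (auto simp: strings_upto_def)
  also have "\<dots> = (\<Sum>w | length w \<le> n \<and> w \<in> S. pmf (trace_pmf q x) w)"
    by (rule measure_measure_pmf_finite, rule finite_subset[OF _ finite_strings_upto[of n]])
      (auto simp: strings_upto_def)
  finally show ?thesis .
qed

lemma prob_unbalanced:
  fixes q :: real
  assumes q: "0 < q" "q < 1" and L: "L \<ge> 0"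
  shows "measure_pmf.prob (trace_pmf q (pow01 k)) {w. \<not> balanced (1 / (1 + q)) L w}
    \<le> 4 * real (2 * k + 1) ^ 3 * exp (- 2 * L\<^sup>2)"
proof -
  let ?r = "1 / (1 + q)"
  have r: "0 \<le> ?r" "?r \<le> 1" using q by auto
  have fin: "finite {w :: bool list. length w = m \<and> Q w}" for Q m
    by (rule finite_subset[OF _ finite_lists_length[of m]]) auto
  have "measure_pmf.prob (trace_pmf q (pow01 k)) {w. \<not> balanced ?r L w} =
      (\<Sum>w | length w \<le> 2 * k \<and> w \<in> {w. \<not> balanced ?r L w}. pmf (trace_pmf q (pow01 k)) w)"
    by (rule prob_trace_eq_sum) simp
  also have "\<dots> \<le> (\<Sum>w | length w \<le> 2 * k \<and> w \<in> {w. \<not> balanced ?r L w}. flip_weight ?r True w)"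
    by (intro sum_mono pmf_trace_pow01_le q)
  also have "{w. length w \<le> 2 * k \<and> w \<in> {w. \<not> balanced ?r L w}} =
      (\<Union>m\<in>{..2*k}. {w. length w = m \<and> \<not> balanced ?r L w})"
    by auto
  also have "(\<Sum>w\<in>\<dots>. flip_weight ?r True w) =
      (\<Sum>m\<le>2*k. \<Sum>w | length w = m \<and> \<not> balanced ?r L w. flip_weight ?r True w)"
    by (subst sum.UNION_disjoint) (auto simp: fin)
  also have "\<dots> \<le> (\<Sum>m\<le>2*k. 4 * real (2 * k + 1) ^ 2 * exp (- 2 * L\<^sup>2))"
  proof (rule sum_mono)
    fix m assume "m \<in> {..2*k}"
    then have "real (m + 1) ^ 2 \<le> real (2 * k + 1) ^ 2" by (intro power_mono) auto
    then have "4 * real (m + 1) ^ 2 * exp (- 2 * L\<^sup>2) \<le> 4 * real (2 * k + 1) ^ 2 * exp (- 2 * L\<^sup>2)"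
      by (intro mult_right_mono mult_left_mono) auto
    then show "(\<Sum>w | length w = m \<and> \<not> balanced ?r L w. flip_weight ?r True w)
        \<le> 4 * real (2 * k + 1) ^ 2 * exp (- 2 * L\<^sup>2)"
      using unbalanced_weight_le[OF r L, of m] by linarith
  qed
  also have "\<dots> = 4 * real (2 * k + 1) ^ 3 * exp (- 2 * L\<^sup>2)"
    by (simp add: power3_eq_cube power2_eq_square algebra_simps)
  finally show ?thesis .
qed

text \<open>Markov's inequality for the cut. Given the trace \<open>w\<close>, the share of
  embeddings that cut it at a position in \<open>B\<close> is the conditional probability that the
  first factor left a trace with length in \<open>B\<close>. The event says, for
  \<open>c > 0\<close> and \<open>w\<close> with an embedding, that this share is at least
  \<open>1/c\<close>, and the mean of the share is the probability on the right.\<close>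

lemma prob_split_tail:
  fixes q c :: real
  assumes q: "0 \<le> q" "q \<le> 1" and c: "0 \<le> c"
  shows "measure_pmf.prob (trace_pmf q (x @ y))
      {w. real (emb w (x @ y)) \<le> c * (\<Sum>j | j \<le> length w \<and> j \<in> B. real (emb (take j w) x * emb (drop j w) y))}
    \<le> c * measure_pmf.prob (trace_pmf q x) {u. length u \<in> B}" (is "measure_pmf.prob _ ?E \<le> _")
proof -
  define n where "n = length x + length y"
  let ?S = "{w :: bool list. length w \<le> n}"
  let ?S' = "{w :: bool list. length w \<le> n \<and> w \<in> ?E}"
  let ?t = "\<lambda>w j. pmf (trace_pmf q x) (take j w) * pmf (trace_pmf q y) (drop j w)"
  have finS: "finite ?S" using finite_strings_upto[of n] by (simp add: strings_upto_def)
  have finS': "finite ?S'" by (rule finite_subset[OF _ finS]) auto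
  \<comment> \<open>Truncated subtraction does no harm: a piece too long for its factor has no
    embedding.\<close>
  have t: "(1 - q) ^ length w * q ^ (n - length w) * real (emb (take j w) x * emb (drop j w) y) = ?t w j"
    if j: "j \<le> length w" for w j
  proof (cases "emb (take j w) x = 0 \<or> emb (drop j w) y = 0")
    case True
    then show ?thesis using q by (auto simp: pmf_trace_emb)
  next
    case False
    then have "length (take j w) \<le> length x" "length (drop j w) \<le> length y"
      using emb_eq_0[of x "take j w"] emb_eq_0[of y "drop j w"] by (metis not_le)+
    with j have l: "j \<le> length x" "length w - j \<le> length y" by auto
    have e1: "n - length w = (length x - j) + (length y - (length w - j))" using l j by (simp add: n_def)
    have e2: "length w = j + (length w - j)" using j by simp
    have "(1 - q) ^ length w * q ^ (n - length w) =
        ((1 - q) ^ j * (1 - q) ^ (length w - j)) * (q ^ (length x - j) * q ^ (length y - (length w - j)))"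
      unfolding e1 power_add[symmetric] using e2 by simp
    then show ?thesis using j q by (simp add: pmf_trace_emb)
  qed
  have "measure_pmf.prob (trace_pmf q (x @ y)) ?E = (\<Sum>w\<in>?S'. pmf (trace_pmf q (x @ y)) w)"
    by (rule prob_trace_eq_sum) (simp add: n_def)
  also have "\<dots> \<le> (\<Sum>w\<in>?S'. c * (\<Sum>j | j \<le> length w \<and> j \<in> B. ?t w j))"
  proof (rule sum_mono)
    fix w assume w: "w \<in> ?S'"
    have "pmf (trace_pmf q (x @ y)) w = (1 - q) ^ length w * q ^ (n - length w) * real (emb w (x @ y))"
      using q by (simp add: pmf_trace_emb n_def)
    also have "\<dots> \<le> (1 - q) ^ length w * q ^ (n - length w) *
        (c * (\<Sum>j | j \<le> length w \<and> j \<in> B. real (emb (take j w) x * emb (drop j w) y)))"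
      using w q by (intro mult_left_mono) auto
    also have "\<dots> = c * (\<Sum>j | j \<le> length w \<and> j \<in> B.
        (1 - q) ^ length w * q ^ (n - length w) * real (emb (take j w) x * emb (drop j w) y))"
      by (simp add: sum_distrib_left mult_ac)
    also have "\<dots> = c * (\<Sum>j | j \<le> length w \<and> j \<in> B. ?t w j)"
      using t by (intro arg_cong[of _ _ "(*) c"] sum.cong) auto
    finally show "pmf (trace_pmf q (x @ y)) w \<le> c * (\<Sum>j | j \<le> length w \<and> j \<in> B. ?t w j)" .
  qed
  also have "\<dots> \<le> (\<Sum>w\<in>?S. c * (\<Sum>j | j \<le> length w \<and> j \<in> B. ?t w j))"
    using c finS by (intro sum_mono2) (auto intro!: mult_nonneg_nonneg sum_nonneg)
  also have "\<dots> = c * (\<Sum>w\<in>?S. \<Sum>j | j \<le> length w \<and> j \<in> B. ?t w j)"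
    by (simp add: sum_distrib_left)
  also have "(\<Sum>w\<in>?S. \<Sum>j | j \<le> length w \<and> j \<in> B. ?t w j) =
      (\<Sum>(w, j)\<in>(SIGMA w:?S. {j. j \<le> length w \<and> j \<in> B}). ?t w j)"
    by (rule sum.Sigma) (use finS in auto)
  also have "\<dots> = (\<Sum>(u, v)\<in>(\<lambda>(w, j). (take j w, drop j w)) ` (SIGMA w:?S. {j. j \<le> length w \<and> j \<in> B}).
      pmf (trace_pmf q x) u * pmf (trace_pmf q y) v)"
  \<comment> \<open>A string with a marked cut is the same as a pair of strings; the double sum
    becomes one over independent traces of \<open>x\<close> and \<open>y\<close>.\<close>
  proof (subst sum.reindex)
    show "inj_on (\<lambda>(w, j). (take j w, drop j w)) (SIGMA w:?S. {j. j \<le> length w \<and> j \<in> B})"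
    proof (rule inj_onI, clarify)
      fix w j w' j' assume a: "take j w = take j' w'" "drop j w = drop j' w'"
        "j \<le> length w" "j' \<le> length w'"
      then have "w = w'" by (metis append_take_drop_id)
      moreover have "j = j'" using a by (metis length_take min.absorb2)
      ultimately show "w = w' \<and> j = j'" by simp
    qed
  qed (auto intro!: sum.cong)
  also have "\<dots> \<le> (\<Sum>(u, v)\<in>{u. length u \<le> n \<and> u \<in> {u. length u \<in> B}} \<times> ?S.
      pmf (trace_pmf q x) u * pmf (trace_pmf q y) v)"
  proof (rule sum_mono2)
    show "finite ({u :: bool list. length u \<le> n \<and> u \<in> {u. length u \<in> B}} \<times> ?S)"
      using finS by (auto intro: finite_subset)
  qed (auto simp: min_def)
  also have "\<dots> = (\<Sum>u | length u \<le> n \<and> u \<in> {u. length u \<in> B}. pmf (trace_pmf q x) u) *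
      (\<Sum>v\<in>?S. pmf (trace_pmf q y) v)"
    by (simp add: sum_product sum.cartesian_product)
  also have "(\<Sum>u | length u \<le> n \<and> u \<in> {u. length u \<in> B}. pmf (trace_pmf q x) u) =
      measure_pmf.prob (trace_pmf q x) {u. length u \<in> B}"
    by (rule prob_trace_eq_sum[symmetric]) (simp add: n_def)
  also have "(\<Sum>v\<in>?S. pmf (trace_pmf q y) v) = 1"
    using finS set_trace_pmf[of q y] by (intro sum_pmf_eq_1) (auto simp: strings_upto_def n_def)
  finally show ?thesis using c by (simp add: mult_left_mono)
qed

section \<open>Local estimates for products of binomial coefficients\<close>

text \<open>Kept for a general filter, so that a filter on parameter tuples can later turn such
  statements into inequalities with one uniform constant.\<close>

definition near :: "'t filter \<Rightarrow> ('t \<Rightarrow> real) \<Rightarrow> ('t \<Rightarrow> real) \<Rightarrow> real \<Rightarrow> bool" where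
  "near F \<eta> f x \<longleftrightarrow> (\<lambda>t. f t - x) \<in> O[F](\<eta>)"

locale small_scale =
  fixes F :: "'t filter" and \<eta> :: "'t \<Rightarrow> real"
  assumes lim: "(\<eta> \<longlongrightarrow> 0) F"
begin

lemma near_tendsto:
  assumes "near F \<eta> f x"
  shows "(f \<longlongrightarrow> x) F"
proof -
  obtain c where "\<forall>\<^sub>F t in F. norm (f t - x) \<le> c * norm (\<eta> t)"
    using assms unfolding near_def by (elim landau_o.bigE)
  moreover have "((\<lambda>t. c * norm (\<eta> t)) \<longlongrightarrow> 0) F"
    using tendsto_mult_right_zero[OF tendsto_norm_zero[OF lim]] .
  ultimately have "((\<lambda>t. f t - x) \<longlongrightarrow> 0) F"
    by (rule Lim_null_comparison)
  then show ?thesis by (simp add: LIM_zero_iff)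
qed

lemma tendsto_bounded: "(f \<longlongrightarrow> (x::real)) F \<Longrightarrow> f \<in> O[F](\<lambda>_. 1)"
  by (rule bigoI_tendsto[where c = x]) auto

lemma near_bounded: "near F \<eta> f x \<Longrightarrow> f \<in> O[F](\<lambda>_. 1)"
  by (intro tendsto_bounded near_tendsto)

lemma near_const: "near F \<eta> (\<lambda>_. x) x"
  by (simp add: near_def)

lemma near_add:
  assumes "near F \<eta> f x" "near F \<eta> g y"
  shows "near F \<eta> (\<lambda>t. f t + g t) (x + y)"
  using sum_in_bigo(1)[OF assms[unfolded near_def]] by (simp add: near_def algebra_simps)

lemma near_diff:
  assumes "near F \<eta> f x" "near F \<eta> g y"
  shows "near F \<eta> (\<lambda>t. f t - g t) (x - y)"
  using sum_in_bigo(2)[OF assms[unfolded near_def]] by (simp add: near_def algebra_simps)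

lemma near_mult:
  assumes "near F \<eta> f x" "near F \<eta> g y"
  shows "near F \<eta> (\<lambda>t. f t * g t) (x * y)"
proof -
  have "(\<lambda>t. (f t - x) * g t) \<in> O[F](\<lambda>t. \<eta> t * 1)"
    using assms near_bounded[OF assms(2)] unfolding near_def by (intro landau_o.big.mult)
  moreover have "(\<lambda>t. x * (g t - y)) \<in> O[F](\<eta>)"
    using assms(2) unfolding near_def by simp
  ultimately have "(\<lambda>t. (f t - x) * g t + x * (g t - y)) \<in> O[F](\<eta>)"
    by (intro sum_in_bigo) auto
  then show ?thesis by (simp add: near_def algebra_simps)
qed

lemma near_divide:
  assumes "near F \<eta> f x" "near F \<eta> g y" "y \<noteq> 0"
  shows "near F \<eta> (\<lambda>t. f t / g t) (x / y)"
proof -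
  have g: "(g \<longlongrightarrow> y) F" using assms(2) by (rule near_tendsto)
  have inv: "(\<lambda>t. inverse (g t)) \<in> O[F](\<lambda>_. 1)"
    using tendsto_inverse[OF g \<open>y \<noteq> 0\<close>] by (rule tendsto_bounded)
  have "(\<lambda>t. (g t - y) * (inverse (g t) * (- inverse y))) \<in> O[F](\<lambda>t. \<eta> t * 1)"
    using assms(2) inv unfolding near_def by (intro landau_o.big.mult) auto
  moreover have "\<forall>\<^sub>F t in F. g t \<noteq> 0"
    using tendsto_imp_eventually_ne[OF g \<open>y \<noteq> 0\<close>] .
  with \<open>y \<noteq> 0\<close> have "\<forall>\<^sub>F t in F. (g t - y) * (inverse (g t) * (- inverse y)) = inverse (g t) - inverse y"
    by (auto elim!: eventually_mono simp: field_simps)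
  ultimately have "(\<lambda>t. inverse (g t) - inverse y) \<in> O[F](\<eta>)"
    by (subst (asm) landau_o.big.in_cong) auto
  then have "near F \<eta> (\<lambda>t. inverse (g t)) (inverse y)" by (simp add: near_def)
  from near_mult[OF assms(1) this] show ?thesis by (simp add: divide_inverse)
qed

end

text \<open>Here \<open>\<kappa>\<close> stands for the number of blocks in one half,
  \<open>A\<close> and \<open>B\<close> for the lengths of the two parts of the trace,
  \<open>P\<close> and \<open>Q\<close> for the upper indices of their binomial coefficients. One
  half leaves about \<open>2 (1-q) \<kappa>\<close> letters, of which a share
  \<open>1/(2(1+q))\<close> are rises, and \<open>1 + (1-q)/(1+q) = 2/(1+q)\<close>. The condition
  on \<open>\<kappa>\<close> makes shifts by 1 a relative effect of order
  \<open>\<eta>^2\<close>.\<close>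

locale local_scale = small_scale F \<eta> for F :: "'t filter" and \<eta> :: "'t \<Rightarrow> real" +
  fixes q :: real and \<kappa> A B P Q :: "'t \<Rightarrow> real"
  assumes q: "0 < q" "q < 1"
    and \<kappa>: "\<forall>\<^sub>F t in F. 0 < \<kappa> t \<and> 1 \<le> \<kappa> t * (\<eta> t)\<^sup>2"
    and A: "near F \<eta> (\<lambda>t. A t / \<kappa> t) (2 * (1 - q))"
    and B: "near F \<eta> (\<lambda>t. B t / \<kappa> t) (2 * (1 - q))"
    and P: "near F \<eta> (\<lambda>t. P t / \<kappa> t) (2 / (1 + q))"
    and Q: "near F \<eta> (\<lambda>t. Q t / \<kappa> t) (2 / (1 + q))"
begin

definition "\<eta>2 t = (\<eta> t)\<^sup>2"

lemma eta2_le: "\<eta>2 \<in> O[F](\<eta>)"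
proof -
  have "(\<lambda>t. \<eta> t * \<eta> t) \<in> O[F](\<lambda>t. \<eta> t * 1)"
    using tendsto_bounded[OF lim] by (intro landau_o.big.mult) auto
  then show ?thesis by (simp add: \<eta>2_def[abs_def] power2_eq_square)
qed

lemma inv_kappa: "(\<lambda>t. 1 / \<kappa> t) \<in> O[F](\<eta>2)"
proof (rule landau_o.bigI[of 1])
  show "\<forall>\<^sub>F t in F. norm (1 / \<kappa> t) \<le> 1 * norm (\<eta>2 t)"
    using \<kappa> by eventually_elim (simp add: \<eta>2_def field_simps)
qed simp

lemma one: "near F \<eta> (\<lambda>t. 1 / \<kappa> t) 0"
  using landau_o.big.trans[OF inv_kappa eta2_le] by (simp add: near_def)

lemma ev_kappa: "\<forall>\<^sub>F t in F. \<kappa> t > 0"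
  using \<kappa> by eventually_elim auto

lemma near_cong:
  assumes "near F \<eta> f x" "\<forall>\<^sub>F t in F. f t = g t"
  shows "near F \<eta> g x"
  using assms unfolding near_def by (subst landau_o.big.in_cong[symmetric]) (auto elim: eventually_mono)

lemma near_quot:
  assumes "near F \<eta> (\<lambda>t. f t / \<kappa> t) x" "near F \<eta> (\<lambda>t. g t / \<kappa> t) y" "y \<noteq> 0"
  shows "near F \<eta> (\<lambda>t. f t / g t) (x / y)"
  by (rule near_cong[OF near_divide[OF assms]]) (use ev_kappa in eventually_elim, simp)

lemma near_plus1:
  assumes "near F \<eta> (\<lambda>t. f t / \<kappa> t) x"
  shows "near F \<eta> (\<lambda>t. (f t + 1) / \<kappa> t) x" "near F \<eta> (\<lambda>t. (f t - 1) / \<kappa> t) x"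
  using near_add[OF assms one] near_diff[OF assms one] by (simp_all add: add_divide_distrib diff_divide_distrib)

lemma near_minus:
  assumes "near F \<eta> (\<lambda>t. f t / \<kappa> t) x" "near F \<eta> (\<lambda>t. g t / \<kappa> t) y"
  shows "near F \<eta> (\<lambda>t. (f t - g t) / \<kappa> t) (x - y)"
  using near_diff[OF assms] by (simp add: diff_divide_distrib)

text \<open>The size of \<open>choose_diff\<close> relative to the product of binomial coefficients.
  The limits of the two quotients agree, so it is of first order in \<open>\<eta>\<close>.\<close>

definition "\<beta> t = B t / Q t - A t / P t"

lemma slack: "2 / (1 + q) - 2 * (1 - q) = 2 * q\<^sup>2 / (1 + q)"
  using q by (simp add: field_simps power2_eq_square)

lemma pos: "2 / (1 + q) > 0" "2 * (1 - q) > 0" "2 * q\<^sup>2 / (1 + q) > 0"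
  using q by auto

lemma PA: "near F \<eta> (\<lambda>t. (P t - A t) / \<kappa> t) (2 * q\<^sup>2 / (1 + q))"
  using near_minus[OF P A] by (simp only: slack)

lemma QB: "near F \<eta> (\<lambda>t. (Q t - B t) / \<kappa> t) (2 * q\<^sup>2 / (1 + q))"
  using near_minus[OF Q B] by (simp only: slack)

lemma beta: "\<beta> \<in> O[F](\<eta>)"
proof -
  have "near F \<eta> (\<lambda>t. B t / Q t - A t / P t) (2 * (1 - q) / (2 / (1 + q)) - 2 * (1 - q) / (2 / (1 + q)))"
    using pos by (intro near_diff near_quot A B P Q) auto
  then show ?thesis by (simp add: near_def \<beta>_def[abs_def])
qed

lemma inverse_small:
  assumes "near F \<eta> (\<lambda>t. f t / \<kappa> t) x" "x \<noteq> 0"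
  shows "(\<lambda>t. 1 / f t) \<in> O[F](\<eta>2)"
proof -
  have "near F \<eta> (\<lambda>t. \<kappa> t / f t) (1 / x)"
    using near_divide[OF near_const[of 1] assms] by (simp add: divide_simps)
  then have "(\<lambda>t. 1 / \<kappa> t * (\<kappa> t / f t)) \<in> O[F](\<lambda>t. \<eta>2 t * 1)"
    by (intro landau_o.big.mult inv_kappa near_bounded)
  moreover have "\<forall>\<^sub>F t in F. 1 / \<kappa> t * (\<kappa> t / f t) = 1 / f t"
    using ev_kappa by eventually_elim simp
  ultimately show ?thesis by (subst (asm) landau_o.big.in_cong) auto
qed

lemma quot_small:
  assumes "near F \<eta> (\<lambda>t. f t / \<kappa> t) x" "near F \<eta> (\<lambda>t. g t / \<kappa> t) y" "y \<noteq> 0"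
    "near F \<eta> (\<lambda>t. h t / \<kappa> t) z" "z \<noteq> 0"
  shows "(\<lambda>t. f t / (g t * h t)) \<in> O[F](\<eta>2)"
proof -
  have "(\<lambda>t. f t / g t * (1 / h t)) \<in> O[F](\<lambda>t. 1 * \<eta>2 t)"
    using near_bounded[OF near_quot[OF assms(1-3)]] inverse_small[OF assms(4,5)]
    by (intro landau_o.big.mult)
  then show ?thesis by simp
qed

text \<open>As \<open>\<beta>\<close> is itself of order \<open>\<eta>\<close>, an error of order
  \<open>\<eta>\<close> in the factor \<open>X\<close> costs only \<open>\<eta>^2\<close>. Hence it
  suffices to know the limits of the ratios of binomial coefficients.\<close>

lemma perturb:
  assumes X: "near F \<eta> X x" and e: "e \<in> O[F](\<eta>2)"
    and eq: "\<forall>\<^sub>F t in F. \<beta>' t = \<beta> t + e t"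
  shows "(\<lambda>t. X t * \<beta>' t - x * \<beta> t) \<in> O[F](\<eta>2)"
proof -
  have "(\<lambda>t. (X t - x) * \<beta> t) \<in> O[F](\<lambda>t. \<eta> t * \<eta> t)"
    using X beta unfolding near_def by (intro landau_o.big.mult)
  moreover have "(\<lambda>t. X t * e t) \<in> O[F](\<lambda>t. 1 * \<eta>2 t)"
    using near_bounded[OF X] e by (intro landau_o.big.mult)
  ultimately have "(\<lambda>t. (X t - x) * \<beta> t + X t * e t) \<in> O[F](\<eta>2)"
    by (intro sum_in_bigo) (auto simp: \<eta>2_def[abs_def] power2_eq_square)
  moreover have "\<forall>\<^sub>F t in F. (X t - x) * \<beta> t + X t * e t = X t * \<beta>' t - x * \<beta> t"
    using eq by eventually_elim (simp add: algebra_simps)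
  ultimately show ?thesis by (subst (asm) landau_o.big.in_cong) auto
qed

lemma ev_pos:
  assumes "near F \<eta> (\<lambda>t. f t / \<kappa> t) x" "x > 0"
  shows "\<forall>\<^sub>F t in F. f t > 0"
proof -
  have "\<forall>\<^sub>F t in F. f t / \<kappa> t > 0"
    using order_tendstoD(1)[OF near_tendsto[OF assms(1)] assms(2)] .
  then show ?thesis using ev_kappa by eventually_elim (simp add: zero_less_divide_iff)
qed

text \<open>The first factor is the ratio of \<open>Q + 1\<close> choose \<open>B\<close> to
  \<open>Q\<close> choose \<open>B\<close>; by \<open>slack\<close> it tends to
  \<open>1/q^2\<close>. Lowering \<open>Q\<close> gives the reciprocal limit in
  \<open>right_down\<close>.\<close>

lemma right_up:
  "(\<lambda>t. (Q t + 1) / (Q t + 1 - B t) * (B t / (Q t + 1) - A t / P t) - 1 / q\<^sup>2 * \<beta> t) \<in> O[F](\<eta>2)"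
proof (rule perturb)
  have "near F \<eta> (\<lambda>t. (Q t + 1) / (Q t - B t + 1)) (2 / (1 + q) / (2 * q\<^sup>2 / (1 + q)))"
    using pos by (intro near_quot near_plus1 Q QB) auto
  moreover have "2 / (1 + q) / (2 * q\<^sup>2 / (1 + q)) = 1 / q\<^sup>2"
    using q by (simp add: divide_simps)
  ultimately show "near F \<eta> (\<lambda>t. (Q t + 1) / (Q t + 1 - B t)) (1 / q\<^sup>2)"
    by (simp add: diff_add_eq)
  show "(\<lambda>t. - (B t / (Q t * (Q t + 1)))) \<in> O[F](\<eta>2)"
    using pos by (simp, intro quot_small[OF B Q _ near_plus1(1)[OF Q]]) auto
  show "\<forall>\<^sub>F t in F. B t / (Q t + 1) - A t / P t = \<beta> t + - (B t / (Q t * (Q t + 1)))"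
    using ev_pos[OF Q pos(1)]
  proof eventually_elim
    case (elim t)
    then have "B t / (Q t + 1) = B t / Q t - B t / (Q t * (Q t + 1))"
      by (simp add: divide_simps) algebra
    then show ?case by (simp add: \<beta>_def)
  qed
qed

lemma right_down:
  "(\<lambda>t. (Q t - B t) / Q t * (B t / (Q t - 1) - A t / P t) - q\<^sup>2 * \<beta> t) \<in> O[F](\<eta>2)"
proof (rule perturb)
  have "near F \<eta> (\<lambda>t. (Q t - B t) / Q t) (2 * q\<^sup>2 / (1 + q) / (2 / (1 + q)))"
    using pos by (intro near_quot Q QB) auto
  then show "near F \<eta> (\<lambda>t. (Q t - B t) / Q t) (q\<^sup>2)"
    using q by simp
  show "(\<lambda>t. B t / (Q t * (Q t - 1))) \<in> O[F](\<eta>2)"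
    using pos by (intro quot_small[OF B Q _ near_plus1(2)[OF Q]]) auto
  show "\<forall>\<^sub>F t in F. B t / (Q t - 1) - A t / P t = \<beta> t + B t / (Q t * (Q t - 1))"
    using ev_pos[OF Q pos(1)] ev_pos[OF near_plus1(2)[OF Q] pos(1)]
  proof eventually_elim
    case (elim t)
    then have "B t / (Q t - 1) = B t / Q t + B t / (Q t * (Q t - 1))"
      by (simp add: divide_simps) algebra
    then show ?case by (simp add: \<beta>_def)
  qed
qed

text \<open>One letter moves from the right part to the left one. The ratios of the two binomial
  coefficients have reciprocal limits, so \<open>\<beta>\<close> is reproduced with factor 1. In
  \<open>step_rise\<close> the letter also completes a block 01, which moves one unit from
  \<open>Q\<close> to \<open>P\<close>.\<close>

lemma step_flat:
  "(\<lambda>t. ((P t - A t) * B t) / ((A t + 1) * (Q t - B t + 1)) *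
     ((B t - 1) / Q t - (A t + 1) / P t) - 1 * \<beta> t) \<in> O[F](\<eta>2)"
proof (rule perturb)
  have "near F \<eta> (\<lambda>t. (P t - A t) / (Q t - B t + 1) * (B t / (A t + 1)))
    (2 * q\<^sup>2 / (1 + q) / (2 * q\<^sup>2 / (1 + q)) * (2 * (1 - q) / (2 * (1 - q))))"
    using pos by (intro near_mult near_quot near_plus1 PA QB A B) auto
  then show "near F \<eta> (\<lambda>t. ((P t - A t) * B t) / ((A t + 1) * (Q t - B t + 1))) 1"
    using q pos by (simp add: mult.commute)
  show "(\<lambda>t. - (1 / Q t) - 1 / P t) \<in> O[F](\<eta>2)"
    using pos inverse_small[OF Q] inverse_small[OF P] by (intro sum_in_bigo) auto
  show "\<forall>\<^sub>F t in F. (B t - 1) / Q t - (A t + 1) / P t = \<beta> t + (- (1 / Q t) - 1 / P t)"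
    by (intro always_eventually allI) (simp add: \<beta>_def add_divide_distrib diff_divide_distrib)
qed

lemma step_rise:
  "(\<lambda>t. ((P t + 1) * B t) / ((A t + 1) * Q t) *
     ((B t - 1) / (Q t - 1) - (A t + 1) / (P t + 1)) - 1 * \<beta> t) \<in> O[F](\<eta>2)"
proof (rule perturb)
  have "near F \<eta> (\<lambda>t. (P t + 1) / Q t * (B t / (A t + 1)))
    (2 / (1 + q) / (2 / (1 + q)) * (2 * (1 - q) / (2 * (1 - q))))"
    using pos by (intro near_mult near_quot near_plus1 P Q A B) auto
  then show "near F \<eta> (\<lambda>t. ((P t + 1) * B t) / ((A t + 1) * Q t)) 1"
    using q pos by (simp add: mult.commute)
  show "(\<lambda>t. - ((Q t - B t) / (Q t * (Q t - 1))) - (P t - A t) / (P t * (P t + 1))) \<in> O[F](\<eta>2)"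
    using pos quot_small[OF QB Q _ near_plus1(2)[OF Q]] quot_small[OF PA P _ near_plus1(1)[OF P]]
    by (intro sum_in_bigo) auto
  show "\<forall>\<^sub>F t in F. (B t - 1) / (Q t - 1) - (A t + 1) / (P t + 1) =
      \<beta> t + (- ((Q t - B t) / (Q t * (Q t - 1))) - (P t - A t) / (P t * (P t + 1)))"
    using ev_pos[OF Q pos(1)] ev_pos[OF near_plus1(2)[OF Q] pos(1)] ev_pos[OF P pos(1)]
  proof eventually_elim
    case (elim t)
    have 1: "(B t - 1) / (Q t - 1) = B t / Q t - (Q t - B t) / (Q t * (Q t - 1))"
      using elim by (simp add: divide_simps) algebra
    have 2: "(A t + 1) / (P t + 1) = A t / P t + (P t - A t) / (P t * (P t + 1))"
      using elim by (simp add: divide_simps) algebra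
    show ?case unfolding 1 2 by (simp add: \<beta>_def)
  qed
qed

lemma ratio_bounded: "(\<lambda>t. Q t / (Q t - B t)) \<in> O[F](\<lambda>_. 1)"
  "(\<lambda>t. P t / (P t - A t)) \<in> O[F](\<lambda>_. 1)"
  using pos q near_bounded[OF near_quot[OF Q QB]] near_bounded[OF near_quot[OF P PA]] by simp_all

end

text \<open>The admissible tuples carry a filter: \<open>\<eta>\<close> tends to 0 from the right
  inside the set \<open>S\<close>. An estimate along this filter holds with one constant for all
  tuples in \<open>S\<close> with small \<open>\<eta>\<close>. The tolerance 5 leaves room for the
  combined deviations of length, cut and number of rises in a typical trace.\<close>

lemma local_estimates:
  fixes q :: real
  assumes q: "0 < q" "q < 1"
  obtains C \<eta>0 where "C > 0" "\<eta>0 > 0"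
    "\<And>\<eta> \<kappa> A B P Q :: real. \<lbrakk>0 < \<eta>; \<eta> < \<eta>0; 0 < \<kappa>; 1 \<le> \<kappa> * \<eta>\<^sup>2;
        \<bar>A - 2 * (1 - q) * \<kappa>\<bar> \<le> 5 * \<eta> * \<kappa>; \<bar>B - 2 * (1 - q) * \<kappa>\<bar> \<le> 5 * \<eta> * \<kappa>;
        \<bar>P - 2 / (1 + q) * \<kappa>\<bar> \<le> 5 * \<eta> * \<kappa>; \<bar>Q - 2 / (1 + q) * \<kappa>\<bar> \<le> 5 * \<eta> * \<kappa>\<rbrakk>
      \<Longrightarrow> 0 < A \<and> 0 < B \<and> 0 < P \<and> 1 < Q \<and> A < P \<and> B < Q \<and>
        Q \<le> C * (Q - B) \<and> P \<le> C * (P - A) \<and> \<bar>B / Q - A / P\<bar> \<le> C * \<eta> \<and>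
        \<bar>(Q + 1) / (Q + 1 - B) * (B / (Q + 1) - A / P) - 1 / q\<^sup>2 * (B / Q - A / P)\<bar> \<le> C * \<eta>\<^sup>2 \<and>
        \<bar>(Q - B) / Q * (B / (Q - 1) - A / P) - q\<^sup>2 * (B / Q - A / P)\<bar> \<le> C * \<eta>\<^sup>2 \<and>
        \<bar>((P - A) * B) / ((A + 1) * (Q - B + 1)) * ((B - 1) / Q - (A + 1) / P) - (B / Q - A / P)\<bar> \<le> C * \<eta>\<^sup>2 \<and>
        \<bar>((P + 1) * B) / ((A + 1) * Q) * ((B - 1) / (Q - 1) - (A + 1) / (P + 1)) - (B / Q - A / P)\<bar> \<le> C * \<eta>\<^sup>2"
proof -
  define S :: "(real \<times> real \<times> real \<times> real \<times> real \<times> real) set" where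
    "S = {(\<eta>, \<kappa>, A, B, P, Q). 0 < \<kappa> \<and> 1 \<le> \<kappa> * \<eta>\<^sup>2 \<and>
        \<bar>A - 2 * (1 - q) * \<kappa>\<bar> \<le> 5 * \<eta> * \<kappa> \<and> \<bar>B - 2 * (1 - q) * \<kappa>\<bar> \<le> 5 * \<eta> * \<kappa> \<and>
        \<bar>P - 2 / (1 + q) * \<kappa>\<bar> \<le> 5 * \<eta> * \<kappa> \<and> \<bar>Q - 2 / (1 + q) * \<kappa>\<bar> \<le> 5 * \<eta> * \<kappa>}"
  define F where "F = inf (filtercomap fst (at_right 0)) (principal S)"
  define \<eta> \<kappa> A B P Q where defs:
    "\<eta> = (\<lambda>t :: real \<times> real \<times> real \<times> real \<times> real \<times> real. fst t)"
    "\<kappa> = (\<lambda>t :: real \<times> real \<times> real \<times> real \<times> real \<times> real. fst (snd (t)))"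
    "A = (\<lambda>t :: real \<times> real \<times> real \<times> real \<times> real \<times> real. fst (snd (snd (t))))"
    "B = (\<lambda>t :: real \<times> real \<times> real \<times> real \<times> real \<times> real. fst (snd (snd (snd (t)))))"
    "P = (\<lambda>t :: real \<times> real \<times> real \<times> real \<times> real \<times> real. fst (snd (snd (snd (snd (t))))))"
    "Q = (\<lambda>t :: real \<times> real \<times> real \<times> real \<times> real \<times> real. snd (snd (snd (snd (snd t)))))"
  have ev: "\<forall>\<^sub>F t in F. R t" if "\<And>t. t \<in> S \<Longrightarrow> R t" for R
    using that by (simp add: F_def eventually_inf_principal)
  have fst: "(\<lambda>t. fst t) = \<eta>" by (simp add: defs)
  have lim: "(\<eta> \<longlongrightarrow> 0) F"
  proof -
    have "filterlim \<eta> (at_right 0) (filtercomap \<eta> (at_right 0))"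
      by (rule filterlim_filtercomap)
    then have "filterlim \<eta> (nhds 0) (filtercomap fst (at_right 0))"
      unfolding fst by (rule filterlim_mono) (auto simp: at_within_def)
    then show ?thesis unfolding F_def by (rule filterlim_mono) auto
  qed
  have near: "near F \<eta> (\<lambda>t. X t / \<kappa> t) x"
    if "\<And>t. t \<in> S \<Longrightarrow> \<bar>X t - x * \<kappa> t\<bar> \<le> 5 * \<eta> t * \<kappa> t" for X x
    unfolding near_def
  proof (rule landau_o.bigI[of 5], simp, rule ev)
    fix t assume t: "t \<in> S"
    then have \<kappa>: "\<kappa> t > 0" by (auto simp: S_def defs)
    have "\<bar>X t / \<kappa> t - x\<bar> = \<bar>X t - x * \<kappa> t\<bar> / \<kappa> t"
      using \<kappa> by (simp add: field_simps abs_divide flip: abs_of_pos)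
    also have "\<dots> \<le> 5 * \<eta> t"
      using that[OF t] \<kappa> by (simp add: divide_le_eq)
    finally show "norm (X t / \<kappa> t - x) \<le> 5 * norm (\<eta> t)" by simp
  qed
  interpret local_scale F \<eta> q \<kappa> A B P Q
  proof
    show "\<forall>\<^sub>F t in F. 0 < \<kappa> t \<and> 1 \<le> \<kappa> t * (\<eta> t)\<^sup>2"
      by (rule ev) (auto simp: S_def defs)
    show "near F \<eta> (\<lambda>t. A t / \<kappa> t) (2 * (1 - q))" by (rule near) (auto simp: S_def defs)
    show "near F \<eta> (\<lambda>t. B t / \<kappa> t) (2 * (1 - q))" by (rule near) (auto simp: S_def defs)
    show "near F \<eta> (\<lambda>t. P t / \<kappa> t) (2 / (1 + q))" by (rule near) (auto simp: S_def defs)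
    show "near F \<eta> (\<lambda>t. Q t / \<kappa> t) (2 / (1 + q))" by (rule near) (auto simp: S_def defs)
  qed (use q lim in auto)
  obtain C1 where C1: "C1 > 0" "\<forall>\<^sub>F t in F. norm (Q t / (Q t - B t)) \<le> C1 * norm (1::real)"
    using ratio_bounded(1) by (elim landau_o.bigE)
  obtain C2 where C2: "C2 > 0" "\<forall>\<^sub>F t in F. norm (P t / (P t - A t)) \<le> C2 * norm (1::real)"
    using ratio_bounded(2) by (elim landau_o.bigE)
  obtain C3 where C3: "C3 > 0" "\<forall>\<^sub>F t in F. norm (\<beta> t) \<le> C3 * norm (\<eta> t)"
    using beta by (elim landau_o.bigE)
  obtain C4 where C4: "C4 > 0" "\<forall>\<^sub>F t in F. norm ((Q t + 1) / (Q t + 1 - B t) * (B t / (Q t + 1) - A t / P t) - 1 / q\<^sup>2 * \<beta> t) \<le> C4 * norm (\<eta>2 t)"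
    using right_up by (elim landau_o.bigE)
  obtain C5 where C5: "C5 > 0" "\<forall>\<^sub>F t in F. norm ((Q t - B t) / Q t * (B t / (Q t - 1) - A t / P t) - q\<^sup>2 * \<beta> t) \<le> C5 * norm (\<eta>2 t)"
    using right_down by (elim landau_o.bigE)
  obtain C6 where C6: "C6 > 0" "\<forall>\<^sub>F t in F. norm (((P t - A t) * B t) / ((A t + 1) * (Q t - B t + 1)) *
     ((B t - 1) / Q t - (A t + 1) / P t) - 1 * \<beta> t) \<le> C6 * norm (\<eta>2 t)"
    using step_flat by (elim landau_o.bigE)
  obtain C7 where C7: "C7 > 0" "\<forall>\<^sub>F t in F. norm (((P t + 1) * B t) / ((A t + 1) * Q t) *
     ((B t - 1) / (Q t - 1) - (A t + 1) / (P t + 1)) - 1 * \<beta> t) \<le> C7 * norm (\<eta>2 t)"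
    using step_rise by (elim landau_o.bigE)
  define C where "C = C1 + C2 + C3 + C4 + C5 + C6 + C7"
  have C: "C1 \<le> C" "C2 \<le> C" "C3 \<le> C" "C4 \<le> C" "C5 \<le> C" "C6 \<le> C" "C7 \<le> C"
    using C1(1) C2(1) C3(1) C4(1) C5(1) C6(1) C7(1) by (simp_all add: C_def)
  let ?R = "\<lambda>\<eta> A B P Q. 0 < A \<and> 0 < B \<and> 0 < P \<and> 1 < Q \<and> A < P \<and> B < Q \<and>
        Q \<le> C * (Q - B) \<and> P \<le> C * (P - A) \<and> \<bar>B / Q - A / P\<bar> \<le> C * \<eta> \<and>
        \<bar>(Q + 1) / (Q + 1 - B) * (B / (Q + 1) - A / P) - 1 / q\<^sup>2 * (B / Q - A / P)\<bar> \<le> C * \<eta>\<^sup>2 \<and>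
        \<bar>(Q - B) / Q * (B / (Q - 1) - A / P) - q\<^sup>2 * (B / Q - A / P)\<bar> \<le> C * \<eta>\<^sup>2 \<and>
        \<bar>((P - A) * B) / ((A + 1) * (Q - B + 1)) * ((B - 1) / Q - (A + 1) / P) - (B / Q - A / P)\<bar> \<le> C * \<eta>\<^sup>2 \<and>
        \<bar>((P + 1) * B) / ((A + 1) * Q) * ((B - 1) / (Q - 1) - (A + 1) / (P + 1)) - (B / Q - A / P)\<bar> \<le> C * \<eta>\<^sup>2"
  have "\<forall>\<^sub>F t in F. 0 < \<eta> t \<longrightarrow> ?R (\<eta> t) (A t) (B t) (P t) (Q t)"
    using C1(2) C2(2) C3(2) C4(2) C5(2) C6(2) C7(2)
      ev_pos[OF A pos(2)] ev_pos[OF B pos(2)] ev_pos[OF P pos(1)]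
      ev_pos[OF near_plus1(2)[OF Q] pos(1)] ev_pos[OF PA pos(3)] ev_pos[OF QB pos(3)]
  proof eventually_elim
    case (elim t)
    have le: "x \<le> C * (\<eta> t)\<^sup>2" if "x \<le> c * norm (\<eta>2 t)" "c \<le> C" for x c
    proof -
      have "c * norm (\<eta>2 t) \<le> C * (\<eta> t)\<^sup>2"
        using that(2) by (simp add: \<eta>2_def mult_right_mono)
      then show ?thesis using that(1) by linarith
    qed
    have r: "x \<le> C * y" if "norm (x / y) \<le> c * norm (1::real)" "c \<le> C" "y > 0" for x y c :: real
    proof -
      have "x / y \<le> norm (x / y)" by (simp only: real_norm_def abs_ge_self)
      then have "x / y \<le> C" using that(1,2) by simp
      then show ?thesis using \<open>y > 0\<close> by (simp add: divide_le_eq)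
    qed
    have b: "\<bar>\<beta> t\<bar> \<le> C * \<eta> t" if "0 < \<eta> t"
    proof -
      have "C3 * norm (\<eta> t) \<le> C * \<eta> t" using that C(3) by (simp add: mult_right_mono)
      then show ?thesis using elim(3) by simp
    qed
    show ?case
      using elim(8-13) r[OF elim(1) C(1)] r[OF elim(2) C(2)] b
        le[OF elim(4) C(4)] le[OF elim(5) C(5)] le[OF elim(6) C(6)] le[OF elim(7) C(7)]
      by (simp add: \<beta>_def)
  qed
  then obtain \<eta>0 where "\<eta>0 > 0" and R: "\<And>t. 0 < fst t \<Longrightarrow> fst t < \<eta>0 \<Longrightarrow> t \<in> S \<Longrightarrow> 0 < \<eta> t \<Longrightarrow> ?R (\<eta> t) (A t) (B t) (P t) (Q t)"
    unfolding F_def eventually_inf_principal eventually_filtercomap eventually_at_right_field by force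
  show ?thesis
  proof (rule that[OF _ \<open>\<eta>0 > 0\<close>])
    show "C > 0" using C1(1) C(1) by linarith
    fix \<eta>' \<kappa>' A' B' P' Q' :: real
    assume "0 < \<eta>'" "\<eta>' < \<eta>0" "0 < \<kappa>'" "1 \<le> \<kappa>' * \<eta>'\<^sup>2"
        "\<bar>A' - 2 * (1 - q) * \<kappa>'\<bar> \<le> 5 * \<eta>' * \<kappa>'" "\<bar>B' - 2 * (1 - q) * \<kappa>'\<bar> \<le> 5 * \<eta>' * \<kappa>'"
        "\<bar>P' - 2 / (1 + q) * \<kappa>'\<bar> \<le> 5 * \<eta>' * \<kappa>'" "\<bar>Q' - 2 / (1 + q) * \<kappa>'\<bar> \<le> 5 * \<eta>' * \<kappa>'"
    then show "?R \<eta>' A' B' P' Q'"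
      using R[of "(\<eta>', \<kappa>', A', B', P', Q')"] by (simp add: S_def defs)
  qed
qed

text \<open>The effect of giving the additional block 01 to the right part instead of the left one:
  \<open>P - 1\<close> and \<open>Q - 1\<close> belong to halves with \<open>k\<close> blocks,
  \<open>P\<close> and \<open>Q\<close> to halves with \<open>k + 1\<close>.\<close>

definition choose_diff :: "nat \<Rightarrow> nat \<Rightarrow> nat \<Rightarrow> nat \<Rightarrow> real" where
  "choose_diff a b P Q = real ((P - 1) choose a) * real (Q choose b) - real (P choose a) * real ((Q - 1) choose b)"

lemma choose_pred:
  assumes "1 \<le> P"
  shows "real ((P - 1) choose a) = real (P choose a) * (1 - real a / real P)"
proof (cases "a \<le> P")
  case True
  have "real (P - a) * real (P choose a) = real P * real ((P - 1) choose a)"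
    using binomial_absorb_comp[of P a] by (metis of_nat_mult)
  then show ?thesis using True assms by (simp add: of_nat_diff field_simps)
next
  case False
  then have "P choose a = 0" "(P - 1) choose a = 0" by (auto intro!: binomial_eq_0)
  then show ?thesis by (simp only: of_nat_0 mult_zero_left)
qed

text \<open>By absorption, lowering the upper index multiplies the coefficient by
  \<open>1 - a/P\<close> or \<open>1 - b/Q\<close>; the products of full size cancel and only the
  difference of the two quotients is left.\<close>

lemma choose_diff_eq:
  assumes "1 \<le> P" "1 \<le> Q"
  shows "choose_diff a b P Q = real (P choose a) * real (Q choose b) * (real b / real Q - real a / real P)"
  unfolding choose_diff_def choose_pred[OF assms(1)] choose_pred[OF assms(2)] by (simp add: algebra_simps)

lemma choose_Suc_top:
  assumes "b \<le> Q"
  shows "real ((Q + 1) choose b) = real (Q choose b) * ((real Q + 1) / (real Q + 1 - real b))"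
proof -
  have "real (Q choose b) = real ((Q + 1) choose b) * (1 - real b / (real Q + 1))"
    using choose_pred[of "Q + 1" b] by (simp add: add.commute)
  moreover have "1 - real b / (real Q + 1) = (real Q + 1 - real b) / (real Q + 1)"
    by (simp add: diff_divide_distrib)
  ultimately show ?thesis using assms by simp
qed

lemma choose_Suc_Suc:
  "real ((P + 1) choose (a + 1)) = real (P choose a) * ((real P + 1) / (real a + 1))"
proof -
  have "real (Suc a) * real (Suc P choose Suc a) = real (Suc P) * real (P choose a)"
    using Suc_times_binomial[of a P] by (metis of_nat_mult)
  then show ?thesis by (simp add: field_simps del: binomial_Suc_Suc)
qed

lemma choose_Suc_bottom:
  assumes "a \<le> P"
  shows "real (P choose (a + 1)) = real (P choose a) * ((real P - real a) / (real a + 1))"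
proof -
  have "real (Suc a) * real (P choose Suc a) = real P * real ((P - 1) choose a)"
    using binomial_absorption[of a P] by (metis of_nat_mult)
  also have "\<dots> = real (P - a) * real (P choose a)"
    using binomial_absorb_comp[of P a] by (metis of_nat_mult)
  finally show ?thesis using assms by (simp add: of_nat_diff field_simps)
qed

lemma choose_pred_bottom:
  assumes "1 \<le> b" "b \<le> Q"
  shows "real (Q choose (b - 1)) = real (Q choose b) * (real b / (real Q - real b + 1))"
proof -
  have "real (Q choose b) = real (Q choose (b - 1)) * ((real Q - real b + 1) / real b)"
    using choose_Suc_bottom[of "b - 1" Q] assms by (simp add: of_nat_diff algebra_simps)
  moreover have "real Q - real b + 1 > 0" using assms by linarith
  ultimately show ?thesis using assms by simp
qed

lemma choose_pred_pred:
  assumes "1 \<le> b" "1 \<le> Q"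
  shows "real ((Q - 1) choose (b - 1)) = real (Q choose b) * (real b / real Q)"
proof -
  have "real (Q choose b) = real ((Q - 1) choose (b - 1)) * (real Q / real b)"
    using choose_Suc_Suc[of "Q - 1" "b - 1"] assms by (simp add: of_nat_diff)
  then show ?thesis using assms by simp
qed

text \<open>The last two bounds say that one block fewer costs a constant factor; they are what
  compares \<open>g\<close> with actual numbers of embeddings.\<close>

lemma local_choose_estimates:
  fixes q :: real
  assumes q: "0 < q" "q < 1"
  obtains C \<eta>0 where "C > 0" "\<eta>0 > 0"
    "\<And>\<eta> \<kappa> a b P Q. \<lbrakk>0 < \<eta>; \<eta> < \<eta>0; 0 < \<kappa>; 1 \<le> \<kappa> * \<eta>\<^sup>2;
        \<bar>real a - 2 * (1 - q) * \<kappa>\<bar> \<le> 5 * \<eta> * \<kappa>; \<bar>real b - 2 * (1 - q) * \<kappa>\<bar> \<le> 5 * \<eta> * \<kappa>;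
        \<bar>real P - 2 / (1 + q) * \<kappa>\<bar> \<le> 5 * \<eta> * \<kappa>; \<bar>real Q - 2 / (1 + q) * \<kappa>\<bar> \<le> 5 * \<eta> * \<kappa>\<rbrakk>
      \<Longrightarrow> let g = real (P choose a) * real (Q choose b) in
        \<bar>choose_diff a b P Q\<bar> \<le> C * \<eta> * g \<and>
        \<bar>choose_diff a b P (Q + 1) - 1 / q\<^sup>2 * choose_diff a b P Q\<bar> \<le> C * \<eta>\<^sup>2 * g \<and>
        \<bar>choose_diff a b P (Q - 1) - q\<^sup>2 * choose_diff a b P Q\<bar> \<le> C * \<eta>\<^sup>2 * g \<and>
        \<bar>choose_diff (a + 1) (b - 1) P Q - choose_diff a b P Q\<bar> \<le> C * \<eta>\<^sup>2 * g \<and>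
        \<bar>choose_diff (a + 1) (b - 1) (P + 1) (Q - 1) - choose_diff a b P Q\<bar> \<le> C * \<eta>\<^sup>2 * g \<and>
        real (Q choose b) \<le> C * real ((Q - 1) choose b) \<and>
        real (P choose a) \<le> C * real ((P - 1) choose a)"
proof -
  obtain C \<eta>0 where C: "C > 0" "\<eta>0 > 0" and est:
    "\<And>\<eta> \<kappa> A B P Q :: real. \<lbrakk>0 < \<eta>; \<eta> < \<eta>0; 0 < \<kappa>; 1 \<le> \<kappa> * \<eta>\<^sup>2;
        \<bar>A - 2 * (1 - q) * \<kappa>\<bar> \<le> 5 * \<eta> * \<kappa>; \<bar>B - 2 * (1 - q) * \<kappa>\<bar> \<le> 5 * \<eta> * \<kappa>;
        \<bar>P - 2 / (1 + q) * \<kappa>\<bar> \<le> 5 * \<eta> * \<kappa>; \<bar>Q - 2 / (1 + q) * \<kappa>\<bar> \<le> 5 * \<eta> * \<kappa>\<rbrakk>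
      \<Longrightarrow> 0 < A \<and> 0 < B \<and> 0 < P \<and> 1 < Q \<and> A < P \<and> B < Q \<and>
        Q \<le> C * (Q - B) \<and> P \<le> C * (P - A) \<and> \<bar>B / Q - A / P\<bar> \<le> C * \<eta> \<and>
        \<bar>(Q + 1) / (Q + 1 - B) * (B / (Q + 1) - A / P) - 1 / q\<^sup>2 * (B / Q - A / P)\<bar> \<le> C * \<eta>\<^sup>2 \<and>
        \<bar>(Q - B) / Q * (B / (Q - 1) - A / P) - q\<^sup>2 * (B / Q - A / P)\<bar> \<le> C * \<eta>\<^sup>2 \<and>
        \<bar>((P - A) * B) / ((A + 1) * (Q - B + 1)) * ((B - 1) / Q - (A + 1) / P) - (B / Q - A / P)\<bar> \<le> C * \<eta>\<^sup>2 \<and>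
        \<bar>((P + 1) * B) / ((A + 1) * Q) * ((B - 1) / (Q - 1) - (A + 1) / (P + 1)) - (B / Q - A / P)\<bar> \<le> C * \<eta>\<^sup>2"
    using local_estimates[OF q] by blast
  show ?thesis
  proof (rule that[OF C])
    fix \<eta> \<kappa> :: real and a b P Q :: nat
    assume hyp: "0 < \<eta>" "\<eta> < \<eta>0" "0 < \<kappa>" "1 \<le> \<kappa> * \<eta>\<^sup>2"
        "\<bar>real a - 2 * (1 - q) * \<kappa>\<bar> \<le> 5 * \<eta> * \<kappa>" "\<bar>real b - 2 * (1 - q) * \<kappa>\<bar> \<le> 5 * \<eta> * \<kappa>"
        "\<bar>real P - 2 / (1 + q) * \<kappa>\<bar> \<le> 5 * \<eta> * \<kappa>" "\<bar>real Q - 2 / (1 + q) * \<kappa>\<bar> \<le> 5 * \<eta> * \<kappa>"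
    note E = est[OF hyp]
    have nat: "1 \<le> a" "1 \<le> b" "1 \<le> P" "2 \<le> Q" "a < P" "b < Q"
      using E by auto
    define g where "g = real (P choose a) * real (Q choose b)"
    have g: "g \<ge> 0" by (simp add: g_def)
    have scale: "\<bar>y\<bar> \<le> C * z * g" if "y = g * x" "\<bar>x\<bar> \<le> C * z" for x y z
      using mult_left_mono[OF that(2) g] that(1) g by (simp add: abs_mult mult_ac)
    have scale2: "\<bar>y - r * c\<bar> \<le> C * z * g"
      if "y = g * x" "c = g * x'" "\<bar>x - r * x'\<bar> \<le> C * z" for y c r x x' z
      by (rule scale[where x = "x - r * x'"]) (use that in \<open>simp_all add: algebra_simps\<close>)
    have scale1: "\<bar>y - c\<bar> \<le> C * z * g"
      if "y = g * x" "c = g * x'" "\<bar>x - x'\<bar> \<le> C * z" for y c x x' z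
      using scale2[of y x c x' 1 z] that by simp
    have c: "choose_diff a b P Q = g * (real b / real Q - real a / real P)"
      using nat by (simp add: choose_diff_eq g_def)
    have c1: "choose_diff a b P (Q + 1) =
        g * ((real Q + 1) / (real Q + 1 - real b) * (real b / (real Q + 1) - real a / real P))"
      using choose_diff_eq[OF nat(3), of "Q + 1" a b] choose_Suc_top[of b Q] nat(6)
      by (simp only: g_def mult_ac of_nat_add of_nat_1 le_add2 less_imp_le)
    have c2: "choose_diff a b P (Q - 1) =
        g * ((real Q - real b) / real Q * (real b / (real Q - 1) - real a / real P))"
    proof -
      have "1 - real b / real Q = (real Q - real b) / real Q"
        using nat by (simp add: diff_divide_distrib)
      moreover have "real (Q - 1) = real Q - 1" using nat by (simp add: of_nat_diff)
      moreover have "1 \<le> Q" "1 \<le> Q - 1" using nat by auto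
      ultimately show ?thesis
        using choose_diff_eq[OF nat(3) \<open>1 \<le> Q - 1\<close>, of a b] choose_pred[OF \<open>1 \<le> Q\<close>, of b] by (simp only: g_def mult_ac)
    qed
    have c3: "choose_diff (a + 1) (b - 1) P Q =
        g * (((real P - real a) * real b) / ((real a + 1) * (real Q - real b + 1)) *
          ((real b - 1) / real Q - (real a + 1) / real P))"
    proof -
      have e: "real (b - 1) = real b - 1" using nat by (simp add: of_nat_diff)
      have le: "1 \<le> Q" "a \<le> P" "b \<le> Q" using nat by auto
      show ?thesis
        unfolding choose_diff_eq[OF nat(3) le(1)] choose_Suc_bottom[OF le(2)] choose_pred_bottom[OF nat(2) le(3)] e
        by (simp add: g_def mult_ac)
    qed
    have c4: "choose_diff (a + 1) (b - 1) (P + 1) (Q - 1) =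
        g * (((real P + 1) * real b) / ((real a + 1) * real Q) *
          ((real b - 1) / (real Q - 1) - (real a + 1) / (real P + 1)))"
    proof -
      have e: "real (b - 1) = real b - 1" "real (Q - 1) = real Q - 1" using nat by (simp_all add: of_nat_diff)
      have "1 \<le> Q" using nat by simp
      have "choose_diff (a + 1) (b - 1) (P + 1) (Q - 1) = real ((P + 1) choose (a + 1)) * real ((Q - 1) choose (b - 1)) *
          (real (b - 1) / real (Q - 1) - real (a + 1) / real (P + 1))"
        using nat by (intro choose_diff_eq) auto
      also have "\<dots> = real (P choose a) * ((real P + 1) / (real a + 1)) * (real (Q choose b) * (real b / real Q)) *
          ((real b - 1) / (real Q - 1) - (real a + 1) / (real P + 1))"
        unfolding choose_Suc_Suc choose_pred_pred[OF nat(2) \<open>1 \<le> Q\<close>] e by (simp add: add.commute)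
      finally show ?thesis by (simp add: g_def mult_ac)
    qed
    have QB: "real (Q choose b) \<le> C * real ((Q - 1) choose b)"
    proof -
      have "real Q * real (Q choose b) \<le> C * (real Q - real b) * real (Q choose b)"
        using E by (intro mult_right_mono) auto
      also have "\<dots> = real Q * (C * real ((Q - 1) choose b))"
        using nat by (subst choose_pred) (simp_all add: field_simps)
      finally show ?thesis using nat by (simp add: mult_le_cancel_left)
    qed
    have PA: "real (P choose a) \<le> C * real ((P - 1) choose a)"
    proof -
      have "real P * real (P choose a) \<le> C * (real P - real a) * real (P choose a)"
        using E by (intro mult_right_mono) auto
      also have "\<dots> = real P * (C * real ((P - 1) choose a))"
        using nat by (subst choose_pred) (simp_all add: field_simps)
      finally show ?thesis using nat by (simp add: mult_le_cancel_left)
    qed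
    show "let g = real (P choose a) * real (Q choose b) in
        \<bar>choose_diff a b P Q\<bar> \<le> C * \<eta> * g \<and>
        \<bar>choose_diff a b P (Q + 1) - 1 / q\<^sup>2 * choose_diff a b P Q\<bar> \<le> C * \<eta>\<^sup>2 * g \<and>
        \<bar>choose_diff a b P (Q - 1) - q\<^sup>2 * choose_diff a b P Q\<bar> \<le> C * \<eta>\<^sup>2 * g \<and>
        \<bar>choose_diff (a + 1) (b - 1) P Q - choose_diff a b P Q\<bar> \<le> C * \<eta>\<^sup>2 * g \<and>
        \<bar>choose_diff (a + 1) (b - 1) (P + 1) (Q - 1) - choose_diff a b P Q\<bar> \<le> C * \<eta>\<^sup>2 * g \<and>
        real (Q choose b) \<le> C * real ((Q - 1) choose b) \<and>
        real (P choose a) \<le> C * real ((P - 1) choose a)"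
      unfolding Let_def g_def[symmetric]
    proof (intro conjI QB PA)
      show "\<bar>choose_diff a b P Q\<bar> \<le> C * \<eta> * g"
        by (rule scale[OF c]) (use E in blast)
      show "\<bar>choose_diff a b P (Q + 1) - 1 / q\<^sup>2 * choose_diff a b P Q\<bar> \<le> C * \<eta>\<^sup>2 * g"
        by (rule scale2[OF c1 c]) (use E in blast)
      show "\<bar>choose_diff a b P (Q - 1) - q\<^sup>2 * choose_diff a b P Q\<bar> \<le> C * \<eta>\<^sup>2 * g"
        by (rule scale2[OF c2 c]) (use E in blast)
      show "\<bar>choose_diff (a + 1) (b - 1) P Q - choose_diff a b P Q\<bar> \<le> C * \<eta>\<^sup>2 * g"
        by (rule scale1[OF c3 c]) (use E in blast)
      show "\<bar>choose_diff (a + 1) (b - 1) (P + 1) (Q - 1) - choose_diff a b P Q\<bar> \<le> C * \<eta>\<^sup>2 * g"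
        by (rule scale1[OF c4 c]) (use E in blast)
    qed
  qed
qed

section \<open>Summation by parts and cancellation on a window\<close>

lemma summation_by_parts_le:
  fixes x c :: "nat \<Rightarrow> real"
  assumes "a \<le> b" and S: "\<And>j. a \<le> j \<Longrightarrow> j \<le> b \<Longrightarrow> \<bar>\<Sum>l=a..<j. x l\<bar> \<le> V"
  shows "\<bar>\<Sum>l=a..<b. x l * c l\<bar> \<le> V * (\<bar>c b\<bar> + (\<Sum>l=a..<b. \<bar>c (Suc l) - c l\<bar>))"
proof -
  define S where "S j = (\<Sum>l=a..<j. x l)" for j
  have "(\<Sum>l=a..<b. x l * c l) = S b * c b - (\<Sum>l=a..<b. S (Suc l) * (c (Suc l) - c l))"
    using \<open>a \<le> b\<close>
  proof (induction b rule: dec_induct)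
    case (step n)
    then have "S (Suc n) = S n + x n" by (simp add: S_def)
    then show ?case using step by (simp add: algebra_simps)
  qed (simp add: S_def)
  also have "\<bar>\<dots>\<bar> \<le> \<bar>S b * c b\<bar> + (\<Sum>l=a..<b. \<bar>S (Suc l) * (c (Suc l) - c l)\<bar>)"
    using sum_abs[of "\<lambda>l. S (Suc l) * (c (Suc l) - c l)" "{a..<b}"] by linarith
  also have "\<dots> \<le> V * \<bar>c b\<bar> + (\<Sum>l=a..<b. V * \<bar>c (Suc l) - c l\<bar>)"
    using assms unfolding S_def abs_mult
    by (intro add_mono sum_mono mult_right_mono S abs_ge_zero) auto
  finally show ?thesis by (simp add: sum_distrib_left distrib_left)
qed

text \<open>Assumption \<open>F\<close> forces the plain sum of the \<open>c\<close> to be small, because \<open>1 + (q\<^sup>2 - 1) * \<pi>1 \<ge> 1/2\<close>.\<close>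

lemma window_cancellation:
  fixes c X Y u1 u2 :: "nat \<Rightarrow> real"
  assumes q: "0 < q" "q < 1" and ab: "a \<le> b" and V: "V \<ge> 1" and E: "E \<ge> 0"
    and \<pi>: "0 \<le> \<pi>1" "\<pi>1 \<le> 1/2" "0 \<le> \<pi>2" "\<pi>2 \<le> 1"
    and u: "\<And>l. 0 \<le> u1 l \<and> u1 l \<le> 1 \<and> 0 \<le> u2 l \<and> u2 l \<le> 1"
    and S1: "\<And>j. a \<le> j \<Longrightarrow> j \<le> b \<Longrightarrow> \<bar>\<Sum>l=a..<j. u1 l - \<pi>1\<bar> \<le> V"
    and S2: "\<And>j. a \<le> j \<Longrightarrow> j \<le> b \<Longrightarrow> \<bar>\<Sum>l=a..<j. u2 l - \<pi>2\<bar> \<le> V"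
    and cb: "\<bar>c b\<bar> \<le> E" and dc: "(\<Sum>l=a..<b. \<bar>c (Suc l) - c l\<bar>) \<le> E"
    and X: "(\<Sum>l=a..<b. \<bar>X l - (1 / q\<^sup>2 - 1) * c l\<bar>) \<le> E"
    and Y: "(\<Sum>l=a..<b. \<bar>Y l - (q\<^sup>2 - 1) * c l\<bar>) \<le> E"
    and F: "\<bar>\<Sum>l=a..<b. c l + u1 l * Y l\<bar> \<le> E"
  shows "\<bar>\<Sum>l=a..<b. c l + u2 l * X l\<bar> \<le> 20 / q\<^sup>2 * V * E"
proof -
  define s where "s = (\<Sum>l=a..<b. c l)"
  define s1 where "s1 = (\<Sum>l=a..<b. u1 l * c l)"
  define s2 where "s2 = (\<Sum>l=a..<b. u2 l * c l)"
  have VE: "E \<le> V * E" using V E mult_right_mono[of 1 V E] by simp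
  \<comment> \<open>Replacing an indicator by its mean frequency costs the discrepancy
    \<open>V\<close> times the final value plus variation of \<open>c\<close>, each at most
    \<open>E\<close>.\<close>
  have fluct: "\<bar>(\<Sum>l=a..<b. u l * c l) - p * s\<bar> \<le> 2 * (V * E)"
    if "\<And>j. a \<le> j \<Longrightarrow> j \<le> b \<Longrightarrow> \<bar>\<Sum>l=a..<j. u l - p\<bar> \<le> V" for u p
  proof -
    have "\<bar>\<Sum>l=a..<b. (u l - p) * c l\<bar> \<le> V * (\<bar>c b\<bar> + (\<Sum>l=a..<b. \<bar>c (Suc l) - c l\<bar>))"
      by (rule summation_by_parts_le[OF ab that])
    also have "\<dots> \<le> V * (E + E)"
      using cb dc V by (intro mult_left_mono add_mono) auto
    finally show ?thesis
      by (simp add: s_def left_diff_distrib sum_subtractf sum_distrib_left)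
  qed
  have f1: "\<bar>s1 - \<pi>1 * s\<bar> \<le> 2 * (V * E)" and f2: "\<bar>s2 - \<pi>2 * s\<bar> \<le> 2 * (V * E)"
    unfolding s1_def s2_def using fluct S1 S2 by blast+
  have lin: "\<bar>(\<Sum>l=a..<b. c l + u l * Z l) - (s + r * (\<Sum>l=a..<b. u l * c l))\<bar> \<le> E"
    if "(\<Sum>l=a..<b. \<bar>Z l - r * c l\<bar>) \<le> E" "\<And>l. 0 \<le> u l \<and> u l \<le> 1" for Z u :: "nat \<Rightarrow> real" and r
  proof -
    have "(\<Sum>l=a..<b. c l + u l * Z l) - (s + r * (\<Sum>l=a..<b. u l * c l)) =
        (\<Sum>l=a..<b. u l * (Z l - r * c l))"
      by (simp add: s_def sum.distrib sum_distrib_left sum_subtractf right_diff_distrib mult_ac)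
    also have "\<bar>\<dots>\<bar> \<le> (\<Sum>l=a..<b. \<bar>u l * (Z l - r * c l)\<bar>)" by (rule sum_abs)
    also have "\<dots> \<le> (\<Sum>l=a..<b. \<bar>Z l - r * c l\<bar>)"
      using that(2) by (intro sum_mono) (auto simp: abs_mult intro!: mult_left_le_one_le)
    finally show ?thesis using that(1) by linarith
  qed
  have lF: "\<bar>(\<Sum>l=a..<b. c l + u1 l * Y l) - (s + (q\<^sup>2 - 1) * s1)\<bar> \<le> E"
    unfolding s1_def using Y u by (intro lin) auto
  have lD: "\<bar>(\<Sum>l=a..<b. c l + u2 l * X l) - (s + (1 / q\<^sup>2 - 1) * s2)\<bar> \<le> E"
    unfolding s2_def using X u by (intro lin) auto
  have q2: "0 < q\<^sup>2" "q\<^sup>2 < 1" using q by (auto simp: power_less_one_iff)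
  define lam where "lam = 1 / q\<^sup>2"
  have lam: "lam \<ge> 1" using q2 by (simp add: lam_def)
  have s_small: "\<bar>s\<bar> \<le> 8 * (V * E)"
  proof -
    have a1: "\<bar>(q\<^sup>2 - 1) * (s1 - \<pi>1 * s)\<bar> \<le> 1 * (2 * (V * E))"
      unfolding abs_mult using f1 q2 by (intro mult_mono) auto
    have "s * (1 + (q\<^sup>2 - 1) * \<pi>1) = (s + (q\<^sup>2 - 1) * s1) - (q\<^sup>2 - 1) * (s1 - \<pi>1 * s)"
      by (simp add: algebra_simps)
    then have le: "\<bar>s * (1 + (q\<^sup>2 - 1) * \<pi>1)\<bar> \<le> 4 * (V * E)"
      using a1 lF F VE by linarith
    have "(1 - q\<^sup>2) * \<pi>1 \<le> 1 * (1/2)" using q2 \<pi> by (intro mult_mono) auto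
    then have half: "1 + (q\<^sup>2 - 1) * \<pi>1 \<ge> 1/2" by (simp add: algebra_simps)
    have "\<bar>s\<bar> * (1/2) \<le> \<bar>s\<bar> * (1 + (q\<^sup>2 - 1) * \<pi>1)"
      by (intro mult_left_mono half) auto
    also have "\<dots> = \<bar>s * (1 + (q\<^sup>2 - 1) * \<pi>1)\<bar>" using half by (simp add: abs_mult)
    finally show ?thesis using le by linarith
  qed
  have s2_small: "\<bar>s2\<bar> \<le> 10 * (V * E)"
  proof -
    have "\<bar>\<pi>2 * s\<bar> \<le> 1 * (8 * (V * E))"
      unfolding abs_mult using s_small \<pi> by (intro mult_mono) auto
    then show ?thesis using f2 by linarith
  qed
  have "\<bar>(lam - 1) * s2\<bar> \<le> (lam - 1) * (10 * (V * E))"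
    unfolding abs_mult using s2_small lam by (intro mult_mono) auto
  then have "\<bar>\<Sum>l=a..<b. c l + u2 l * X l\<bar> \<le> 9 * (V * E) + (lam - 1) * (10 * (V * E))"
    using lD s_small VE unfolding lam_def[symmetric] by linarith
  also have "\<dots> \<le> 20 * lam * (V * E)"
  proof -
    have "lam * (V * E) \<ge> 0" using lam V E by simp
    then show ?thesis using VE E by (simp add: algebra_simps)
  qed
  finally show ?thesis by (simp add: lam_def mult.assoc)
qed

section \<open>The ratio of the two laws at a typical string\<close>

lemma cnt01_append: "cnt01 b (xs @ ys) = cnt01 b xs + cnt01 (last (b # xs)) ys"
  by (induction xs arbitrary: b) auto

lemma cnt01_eq_True: "cnt01 b ys = cnt01 True ys + of_bool (\<not> b \<and> ys \<noteq> [] \<and> hd ys)"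
  by (cases ys) auto

lemma bit_at_Suc: "bit_at w (Suc l) = w ! l"
  by (simp add: bit_at_def)

lemma last_take_eq_bit_at: "l \<le> length w \<Longrightarrow> last (True # take l w) = bit_at w l"
  by (cases l) (auto simp: bit_at_def last_conv_nth)

text \<open>Counting the second part afresh, with a virtual 1 before it, loses exactly a rise that
  straddles the cut.\<close>

lemma cnt01_take_drop:
  assumes "l < length w"
  shows "cnt01 True w = cnt01 True (take l w) + of_bool (rise_at w l) + cnt01 True (drop l w)"
proof -
  have "cnt01 True w = cnt01 True (take l w) + cnt01 (bit_at w l) (drop l w)"
    using cnt01_append[of True "take l w" "drop l w"] assms by (simp add: last_take_eq_bit_at[symmetric])
  also have "cnt01 (bit_at w l) (drop l w) = of_bool (rise_at w l) + cnt01 True (drop l w)"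
    using assms by (subst cnt01_eq_True) (auto simp: rise_at_def bit_at_Suc hd_drop_conv_nth)
  finally show ?thesis by simp
qed

lemma cnt01_take_Suc:
  assumes "l < length w"
  shows "cnt01 True (take (Suc l) w) = cnt01 True (take l w) + of_bool (rise_at w l)"
proof -
  have "cnt01 True (take (Suc l) w) = cnt01 True (take l w) + cnt01 (bit_at w l) [w ! l]"
    using assms by (simp only: take_Suc_conv_app_nth cnt01_append last_take_eq_bit_at less_imp_le)
  then show ?thesis by (simp add: rise_at_def bit_at_Suc)
qed

lemma cnt01_take_eq_sum:
  "l \<le> length w \<Longrightarrow> real (cnt01 True (take l w)) = (\<Sum>i=0..<l. of_bool (rise_at w i))"
  by (induction l) (simp_all add: cnt01_take_Suc)

definition both_at :: "bool list \<Rightarrow> nat \<Rightarrow> bool" where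
  "both_at w l \<longleftrightarrow> bit_at w l \<and> bit_at w (Suc l)"

text \<open>Two corrections meet at the cut: a leading 1 of the second part may use the defect,
  which adds one to the upper index, and a rise across the cut is lost, which subtracts one. They
  cancel at 01, so only 11 leaves a trace.\<close>

lemma cut_diff_x:
  assumes l: "l < length w"
  shows "real (emb (take l w) (pow01 k) * emb (drop l w) (True # pow01 (Suc k))) -
      real (emb (take l w) (pow01 (Suc k)) * emb (drop l w) (True # pow01 k)) =
    choose_diff l (length w - l) (Suc k + cnt01 True (take l w))
      (Suc k + cnt01 True w - cnt01 True (take l w) + of_bool (both_at w l))"
proof -
  have hd: "(drop l w \<noteq> [] \<and> hd (drop l w)) = bit_at w (Suc l)"
    using l by (simp add: bit_at_Suc hd_drop_conv_nth)
  have 1: "Suc k + cnt01 True w - cnt01 True (take l w) + of_bool (both_at w l) =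
      Suc k + (if bit_at w (Suc l) then 1 else 0) + cnt01 True (drop l w)"
    using cnt01_take_drop[OF l] by (auto simp: both_at_def rise_at_def)
  show ?thesis
    unfolding choose_diff_def 1 emb_pow01 emb_True_pow01 hd using l by (simp add: min_def)
qed

lemma cut_diff_even:
  assumes l: "l < length w"
  shows "real (emb (take l w) (pow01 k) * emb (drop l w) (pow01 (Suc k))) -
      real (emb (take l w) (pow01 (Suc k)) * emb (drop l w) (pow01 k)) =
    choose_diff l (length w - l) (Suc k + cnt01 True (take l w))
      (Suc k + cnt01 True w - cnt01 True (take l w) - of_bool (rise_at w l))"
proof -
  have 1: "Suc k + cnt01 True w - cnt01 True (take l w) - of_bool (rise_at w l) =
      Suc k + cnt01 True (drop l w)"
    using cnt01_take_drop[OF l] by auto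
  show ?thesis
    unfolding choose_diff_def 1 emb_pow01 using l by (simp add: min_def)
qed

lemma emb_pow01_Suc_ge: "emb w (pow01 k) \<le> emb w (pow01 (Suc k))"
  unfolding pow01_Suc by (meson emb_Cons_ge order_trans)

text \<open>The new 1 of the pattern is matched with the final 1 of the additional block.\<close>

lemma emb_snoc_True_ge: "emb u (pow01 k) \<le> emb (u @ [True]) (pow01 (Suc k))"
proof -
  have "pow01 (Suc k) = pow01 k @ [False, True]"
    using pow01_add[of k 1] by (simp add: pow01_Suc)
  then have "emb (u @ [True]) (pow01 (Suc k)) =
      (\<Sum>j\<le>length (u @ [True]). emb (take j (u @ [True])) (pow01 k) * emb (drop j (u @ [True])) [False, True])"
    by (simp only: emb_append)
  also have "\<dots> \<ge> emb (take (length u) (u @ [True])) (pow01 k) * emb (drop (length u) (u @ [True])) [False, True]"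
    by (rule member_le_sum) auto
  finally show ?thesis by simp
qed

text \<open>Crude bound for cuts outside the window. If the first letter of the second part uses the
  defect, it can be handed over to the first part, where the additional block 01 accommodates it;
  this produces the weight at \<open>Suc l\<close>.\<close>

lemma cut_diff_x_le:
  fixes w :: "bool list" and k :: nat
  defines "h \<equiv> \<lambda>l. real (emb (take l w) (pow01 (Suc k)) * emb (drop l w) (pow01 (Suc k)))"
  assumes l: "l \<le> length w"
  shows "\<bar>real (emb (take l w) (pow01 k) * emb (drop l w) (True # pow01 (Suc k))) -
      real (emb (take l w) (pow01 (Suc k)) * emb (drop l w) (True # pow01 k))\<bar>
    \<le> h l + (if l < length w then h (Suc l) else 0)"
proof -
  have "emb (take l w) (pow01 k) * emb (drop l w) (True # pow01 (Suc k)) \<le>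
      emb (take l w) (pow01 (Suc k)) * emb (drop l w) (pow01 (Suc k)) +
      (if l < length w then emb (take (Suc l) w) (pow01 (Suc k)) * emb (drop (Suc l) w) (pow01 (Suc k)) else 0)"
  proof (cases "l < length w \<and> w ! l")
    case True
    then have d: "drop l w = True # drop (Suc l) w"
      by (metis Cons_nth_drop_Suc)
    have t: "take (Suc l) w = take l w @ [True]"
      using True by (simp add: take_Suc_conv_app_nth)
    have "emb (take l w) (pow01 k) * emb (drop l w) (True # pow01 (Suc k)) =
        emb (take l w) (pow01 k) * emb (drop l w) (pow01 (Suc k)) +
        emb (take l w) (pow01 k) * emb (drop (Suc l) w) (pow01 (Suc k))"
      unfolding d by (simp add: distrib_left)
    also have "\<dots> \<le> emb (take l w) (pow01 (Suc k)) * emb (drop l w) (pow01 (Suc k)) +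
        emb (take (Suc l) w) (pow01 (Suc k)) * emb (drop (Suc l) w) (pow01 (Suc k))"
      unfolding t by (intro add_mono mult_right_mono emb_pow01_Suc_ge emb_snoc_True_ge) auto
    finally show ?thesis using True by simp
  next
    case False
    then have "emb (drop l w) (True # pow01 (Suc k)) = emb (drop l w) (pow01 (Suc k))"
      by (cases "l < length w") (auto simp: Cons_nth_drop_Suc[symmetric])
    then show ?thesis
      by (simp add: trans_le_add1 emb_pow01_Suc_ge)
  qed
  then have 1: "real (emb (take l w) (pow01 k) * emb (drop l w) (True # pow01 (Suc k))) \<le>
      h l + (if l < length w then h (Suc l) else 0)"
    by (subst (asm) of_nat_le_iff[where 'a = real, symmetric])
      (simp add: h_def split: if_splits del: of_nat_le_iff)
  have "emb (take l w) (pow01 (Suc k)) * emb (drop l w) (True # pow01 k) \<le>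
      emb (take l w) (pow01 (Suc k)) * emb (drop l w) (pow01 (Suc k))"
    unfolding pow01_Suc by (intro mult_left_mono emb_Cons_ge) auto
  then have 2: "real (emb (take l w) (pow01 (Suc k)) * emb (drop l w) (True # pow01 k)) \<le> h l"
    unfolding h_def by (simp only: of_nat_le_iff)
  have "h j \<ge> 0" for j by (simp add: h_def)
  then have "(if l < length w then h (Suc l) else 0) \<ge> 0" by simp
  with 1 2 \<open>\<And>j. h j \<ge> 0\<close>[of l] show ?thesis by (smt (verit) of_nat_0_le_iff)
qed

lemma cut_diff_even_le:
  "\<bar>real (emb (take l w) (pow01 k) * emb (drop l w) (pow01 (Suc k))) -
      real (emb (take l w) (pow01 (Suc k)) * emb (drop l w) (pow01 k))\<bar>
    \<le> real (emb (take l w) (pow01 (Suc k)) * emb (drop l w) (pow01 (Suc k)))"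
proof -
  have "emb (take l w) (pow01 k) * emb (drop l w) (pow01 (Suc k)) \<le>
      emb (take l w) (pow01 (Suc k)) * emb (drop l w) (pow01 (Suc k))"
    by (intro mult_right_mono emb_pow01_Suc_ge) auto
  moreover have "emb (take l w) (pow01 (Suc k)) * emb (drop l w) (pow01 k) \<le>
      emb (take l w) (pow01 (Suc k)) * emb (drop l w) (pow01 (Suc k))"
    by (intro mult_left_mono emb_pow01_Suc_ge) auto
  ultimately show ?thesis
    by (smt (verit) of_nat_0_le_iff of_nat_le_iff)
qed

lemma sum_cut_diff_even:
  "(\<Sum>l\<le>length w. real (emb (take l w) (pow01 k) * emb (drop l w) (pow01 (Suc k))) -
      real (emb (take l w) (pow01 (Suc k)) * emb (drop l w) (pow01 k))) = 0"
proof -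
  have "pow01 k @ pow01 (Suc k) = pow01 (Suc k) @ pow01 k"
    by (simp only: pow01_add[symmetric] add.commute)
  then have "emb w (pow01 k @ pow01 (Suc k)) = emb w (pow01 (Suc k) @ pow01 k)" by simp
  then show ?thesis
    unfolding emb_append sum_subtractf of_nat_sum[symmetric] by simp
qed

section \<open>Frequencies of the patterns 01 and 11\<close>

lemma balanced_rise:
  assumes "balanced r L w" "i \<le> j" "j \<le> length w"
  shows "\<bar>\<Sum>l=i..<j. of_bool (rise_at w l) - r / 2\<bar> \<le> sqrt (real (j - i)) * L / 2 + 1 / 2"
proof -
  define o1 :: "nat \<Rightarrow> real" where "o1 l = of_bool (bit_at w l)" for l
  \<comment> \<open>Rises and falls alternate, so a rise is half a flip up to a telescoping
    term.\<close>
  have pt: "of_bool (rise_at w l) - r / 2 = (flip_at w l - r) / 2 + (o1 (Suc l) - o1 l) / 2" for l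
    by (auto simp: rise_at_def flip_at_def o1_def field_simps)
  have "(\<Sum>l=i..<j. of_bool (rise_at w l) - r / 2) =
      (\<Sum>l=i..<j. flip_at w l - r) / 2 + (\<Sum>l=i..<j. o1 (Suc l) - o1 l) / 2"
    unfolding pt by (simp only: sum.distrib sum_divide_distrib)
  also have "(\<Sum>l=i..<j. o1 (Suc l) - o1 l) = o1 j - o1 i"
    using assms by (intro sum_Suc_diff') auto
  finally have eq: "(\<Sum>l=i..<j. of_bool (rise_at w l) - r / 2) =
      (\<Sum>l=i..<j. flip_at w l - r) / 2 + (o1 j - o1 i) / 2" .
  have "\<bar>\<Sum>l=i..<j. flip_at w l - r\<bar> \<le> sqrt (real (j - i)) * L"
    using assms by (auto simp: balanced_def)
  moreover have "\<bar>o1 j - o1 i\<bar> \<le> 1" by (simp add: o1_def)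
  ultimately show ?thesis unfolding eq by (simp only: abs_le_iff) argo
qed

text \<open>The share of ones is extracted from the sum with signs: sign times flip indicator
  telescopes, so that sum equals \<open>- r\<close> times the sum of the signs up to a boundary
  term. Dividing by \<open>r\<close> costs at most a factor 2 because
  \<open>r \<ge> 1/2\<close>.\<close>

lemma balanced_both:
  assumes "balanced r L w" "i \<le> j" "j \<le> length w" "r \<ge> 1 / 2"
  shows "\<bar>\<Sum>l=i..<j. of_bool (both_at w l) - (1 - r) / 2\<bar> \<le> 3 / 2 * (sqrt (real (j - i)) * L) + 3 / 2"
proof -
  define o1 :: "nat \<Rightarrow> real" where "o1 l = of_bool (bit_at w l)" for l
  define s where "s = (\<Sum>l=i..<j. sign_at w l)"
  define Z where "Z = sqrt (real (j - i)) * L"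
  have Z1: "\<bar>\<Sum>l=i..<j. flip_at w l - r\<bar> \<le> Z"
    and Z2: "\<bar>\<Sum>l=i..<j. sign_at w l * (flip_at w l - r)\<bar> \<le> Z"
    using assms by (auto simp: balanced_def Z_def)
  have pt: "sign_at w l * (flip_at w l - r) = - (o1 (Suc l) - o1 l) - r * sign_at w l" for l
    by (auto simp: sign_at_def flip_at_def o1_def algebra_simps)
  have tele: "(\<Sum>l=i..<j. o1 (Suc l) - o1 l) = o1 j - o1 i"
    using assms by (intro sum_Suc_diff') auto
  have o1: "\<bar>o1 j - o1 i\<bar> \<le> 1" by (simp add: o1_def)
  have "(\<Sum>l=i..<j. sign_at w l * (flip_at w l - r)) = - (o1 j - o1 i) - r * s"
    unfolding pt sum_subtractf[of "\<lambda>l. - (o1 (Suc l) - o1 l)"] sum_negf tele s_def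
    by (simp add: sum_distrib_left)
  then have rs: "\<bar>r * s\<bar> \<le> Z + 1" using Z2 o1 by linarith
  have "1 / 2 * \<bar>s\<bar> \<le> \<bar>r * s\<bar>"
    using assms(4) unfolding abs_mult by (intro mult_right_mono) auto
  then have s: "\<bar>s\<bar> \<le> 2 * Z + 2" using rs by linarith
  have pt2: "of_bool (both_at w l) - (1 - r) / 2 =
      sign_at w l / 2 - (flip_at w l - r) / 2 + (o1 (Suc l) - o1 l) / 2" for l
    by (auto simp: sign_at_def flip_at_def o1_def both_at_def field_simps)
  have "(\<Sum>l=i..<j. of_bool (both_at w l) - (1 - r) / 2) =
      s / 2 - (\<Sum>l=i..<j. flip_at w l - r) / 2 + (o1 j - o1 i) / 2"
    unfolding pt2 s_def tele[symmetric] sum_divide_distrib by (simp only: sum.distrib sum_subtractf)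
  moreover have "\<bar>x\<bar> \<le> 3 / 2 * Z + 3 / 2"
    if "x = s / 2 - y / 2 + z / 2" "\<bar>y\<bar> \<le> Z" "\<bar>z\<bar> \<le> 1" for x y z
    using that s by linarith
  ultimately show ?thesis using Z1 o1 unfolding Z_def[symmetric] by blast
qed

text \<open>Cuts of the symmetric reference string \<open>(01)^K (01)^K\<close>; for
  \<open>K = k + 1\<close> both \<open>x_string k\<close> and \<open>y_string k\<close> arise from
  it by deleting one 0.\<close>

definition cut_weight :: "nat \<Rightarrow> bool list \<Rightarrow> nat \<Rightarrow> real" where
  "cut_weight K w l = real (emb (take l w) (pow01 K) * emb (drop l w) (pow01 K))"

text \<open>The second condition allows at most a share \<open>1/K\<close> of the embeddings into
  the reference string to cut \<open>w\<close> far from its centre. Since \<open>1/K\<close> is at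
  most \<open>(L / sqrt K)^2\<close> for \<open>L \<ge> 1\<close>, such cuts stay within the final
  error.\<close>

definition typical :: "real \<Rightarrow> nat \<Rightarrow> real \<Rightarrow> bool list \<Rightarrow> bool" where
  "typical q K L w \<longleftrightarrow>
     \<bar>real (length w) - 4 * (1 - q) * real K\<bar> \<le> 2 * (sqrt (real K) * L) \<and>
     real K * (\<Sum>l | l \<le> length w \<and> \<bar>real l - 2 * (1 - q) * real K\<bar> \<ge> sqrt (real K) * L. cut_weight K w l)
       \<le> (\<Sum>l\<le>length w. cut_weight K w l) \<and>
     balanced (1 / (1 + q)) L w"

lemma typical_trace_ratio:
  fixes q :: real
  assumes q: "0 < q" "q < 1"
  obtains C \<eta>0 where "C > 0" "\<eta>0 > 0"
    "\<And>k L w. \<lbrakk>2 \<le> L; L / sqrt (real (Suc k)) < \<eta>0; typical q (Suc k) L w\<rbrakk> \<Longrightarrow>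
      \<bar>real (emb w (x_string k)) - real (emb w (y_string k))\<bar> \<le>
        C * (sqrt (sqrt (real (Suc k)) * L) * L) * (L / sqrt (real (Suc k)))\<^sup>2 * real (emb w (x_string k))"
proof -
  obtain C0 \<eta>1 where C0: "C0 > 0" and \<eta>1: "\<eta>1 > 0" and est0:
    "\<And>\<eta> \<kappa> a b P Q. \<lbrakk>0 < \<eta>; \<eta> < \<eta>1; 0 < \<kappa>; 1 \<le> \<kappa> * \<eta>\<^sup>2;
        \<bar>real a - 2 * (1 - q) * \<kappa>\<bar> \<le> 5 * \<eta> * \<kappa>; \<bar>real b - 2 * (1 - q) * \<kappa>\<bar> \<le> 5 * \<eta> * \<kappa>;
        \<bar>real P - 2 / (1 + q) * \<kappa>\<bar> \<le> 5 * \<eta> * \<kappa>; \<bar>real Q - 2 / (1 + q) * \<kappa>\<bar> \<le> 5 * \<eta> * \<kappa>\<rbrakk>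
      \<Longrightarrow> let g = real (P choose a) * real (Q choose b) in
        \<bar>choose_diff a b P Q\<bar> \<le> C0 * \<eta> * g \<and>
        \<bar>choose_diff a b P (Q + 1) - 1 / q\<^sup>2 * choose_diff a b P Q\<bar> \<le> C0 * \<eta>\<^sup>2 * g \<and>
        \<bar>choose_diff a b P (Q - 1) - q\<^sup>2 * choose_diff a b P Q\<bar> \<le> C0 * \<eta>\<^sup>2 * g \<and>
        \<bar>choose_diff (a + 1) (b - 1) P Q - choose_diff a b P Q\<bar> \<le> C0 * \<eta>\<^sup>2 * g \<and>
        \<bar>choose_diff (a + 1) (b - 1) (P + 1) (Q - 1) - choose_diff a b P Q\<bar> \<le> C0 * \<eta>\<^sup>2 * g \<and>
        real (Q choose b) \<le> C0 * real ((Q - 1) choose b) \<and>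
        real (P choose a) \<le> C0 * real ((P - 1) choose a)"
    using local_choose_estimates[OF q] by blast
  \<comment> \<open>The entry \<open>2 q\<close> ensures that \<open>w\<close> has at most
    \<open>4 K\<close> letters, and \<open>2 (1-q) / 5\<close> that the window of cuts lies inside
    \<open>w\<close>.\<close>
  define \<eta>0 where "\<eta>0 = min (min \<eta>1 1) (min (2 * q) (2 * (1 - q) / 5))"
  \<comment> \<open>\<open>C1\<close> bounds \<open>g\<close> by \<open>h\<close> at cuts with and
    without a rise; \<open>C2\<close> lets the error \<open>E\<close> absorb both the local errors
    and the tail.\<close>
  define C1 where "C1 = C0 + 1"
  define C2 where "C2 = C0 * C1 + 1"
  define C where "C = (100 / q\<^sup>2 * C2 + 2) * (2 * C0)"
  have pos: "C1 > 0" "C2 > 0" "C1 \<ge> 1" using C0 by (auto simp: C1_def C2_def intro!: add_pos_pos)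
  show ?thesis
  proof (rule that)
    show "C > 0" unfolding C_def using C0 pos q by (intro mult_pos_pos add_pos_pos) auto
    show "\<eta>0 > 0" using \<eta>1 q by (simp add: \<eta>0_def)
    fix k :: nat and L :: real and w :: "bool list"
    assume L: "2 \<le> L" and small: "L / sqrt (real (Suc k)) < \<eta>0" and typc: "typical q (Suc k) L w"
    define K where "K = Suc k"
    define m where "m = length w"
    define W where "W = sqrt (real K) * L"
    define \<eta> where "\<eta> = L / sqrt (real K)"
    define V where "V = sqrt W * L"
    define \<alpha> where "\<alpha> = 2 * (1 - q)"
    define \<rho> where "\<rho> = 1 / (1 + q)"
    define u where "u l = cnt01 True (take l w)" for l
    define U where "U = cnt01 True w"
    define P where "P l = K + u l" for l
    define Q where "Q l = K + U - u l" for l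
    define g where "g l = real (P l choose l) * real (Q l choose (m - l))" for l
    define c where "c l = choose_diff l (m - l) (P l) (Q l)" for l
    define h where "h = cut_weight K w"
    define f where "f = (\<Sum>l\<le>m. h l)"
    define T where "T = {l. l \<le> m \<and> \<bar>real l - \<alpha> * real K\<bar> \<ge> W}"
    have K: "K \<ge> 1" by (simp add: K_def)
    then have sK: "sqrt (real K) \<ge> 1" by simp
    have sq: "sqrt (real K) * sqrt (real K) = real K" by simp
    have \<eta>: "0 < \<eta>" "\<eta> < \<eta>1" "\<eta> < 1" "\<eta> < 2 * q" "\<eta> < \<alpha> / 5"
      using small L K by (auto simp: \<eta>_def K_def \<eta>0_def \<alpha>_def)
    have W_eq: "W = \<eta> * real K"
      using sK unfolding W_def \<eta>_def by (simp add: field_simps)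
    have L2: "real K * \<eta>\<^sup>2 = L\<^sup>2"
      using K by (simp add: \<eta>_def power_divide)
    have "1 \<le> L\<^sup>2" using L by (simp add: one_le_power)
    then have K\<eta>: "1 \<le> real K * \<eta>\<^sup>2" by (simp only: L2)
    have W2: "W \<ge> 2"
      unfolding W_def using mult_mono[OF sK L] L by simp
    have "sqrt W \<ge> 1" using W2 by simp
    then have V1: "V \<ge> 2" unfolding V_def using mult_mono[of 1 "sqrt W" 2 L] L by simp
    have m_near: "\<bar>real m - 2 * (\<alpha> * real K)\<bar> \<le> 2 * W"
    proof -
      have "2 * (\<alpha> * real K) = 4 * (1 - q) * real K" by (simp add: \<alpha>_def)
      then show ?thesis using typc unfolding typical_def m_def W_def K_def by (simp only:)
    qed
    have bal: "balanced \<rho> L w" using typc by (simp add: typical_def \<rho>_def)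
    have tail: "real K * (\<Sum>l\<in>T. h l) \<le> f"
      using typc by (simp add: typical_def T_def h_def f_def m_def K_def W_def \<alpha>_def)
    have h0: "h l \<ge> 0" for l by (simp add: h_def cut_weight_def)
    have f0: "f \<ge> 0" unfolding f_def using h0 by (intro sum_nonneg) auto
    have fin: "finite T" by (rule finite_subset[of _ "{..m}"]) (auto simp: T_def)
    have tail': "(\<Sum>l\<in>T. h l) \<le> \<eta>\<^sup>2 * f"
    proof -
      have "(\<Sum>l\<in>T. h l) * 1 \<le> (\<Sum>l\<in>T. h l) * (real K * \<eta>\<^sup>2)"
        using h0 by (intro mult_left_mono K\<eta> sum_nonneg)
      also have "\<dots> = \<eta>\<^sup>2 * (real K * (\<Sum>l\<in>T. h l))" by simp
      also have "\<dots> \<le> \<eta>\<^sup>2 * f" by (intro mult_left_mono tail) auto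
      finally show ?thesis by simp
    qed
    have \<alpha>K: "\<alpha> * real K \<ge> 5 * W"
    proof -
      have "5 * \<eta> * real K \<le> \<alpha> * real K" using \<eta>(5) by (intro mult_right_mono) auto
      then show ?thesis by (simp add: W_eq)
    qed
    have W2q: "W \<le> 2 * q * real K"
      unfolding W_eq using \<eta>(4) by (intro mult_right_mono) auto
    have m4: "real m \<le> 4 * real K"
    proof -
      have "2 * (\<alpha> * real K) + 2 * (2 * q * real K) = 4 * real K" by (simp add: \<alpha>_def algebra_simps)
      then show ?thesis using m_near W2q by linarith
    qed
    have \<rho>: "1 / 2 \<le> \<rho>" "\<rho> \<le> 1" using q by (auto simp: \<rho>_def field_simps)

    \<comment> \<open>The window has half-width \<open>2 W\<close>, while cuts at distance
      \<open>W\<close> already count as tail. So the endpoints, and the cuts \<open>Suc l\<close>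
      for \<open>l\<close> outside the window, still lie in \<open>T\<close>.\<close>
    define a where "a = nat \<lceil>\<alpha> * real K - 2 * W\<rceil>"
    define b where "b = nat \<lfloor>\<alpha> * real K + 2 * W\<rfloor>"
    have a: "\<alpha> * real K - 2 * W \<le> real a" "real a \<le> \<alpha> * real K - 2 * W + 1"
      using \<alpha>K W2 unfolding a_def by linarith+
    have b: "real b \<le> \<alpha> * real K + 2 * W" "\<alpha> * real K + 2 * W - 1 \<le> real b"
      using \<alpha>K W2 unfolding b_def by linarith+
    have ab: "a \<le> b" using a b W2 by linarith
    have bm: "b < m" using b m_near \<alpha>K W2 by linarith
    have T_low: "l \<in> T" if "l \<le> a" for l
    proof -
      have "real l \<le> real a" using that by simp
      then have "\<alpha> * real K - real l \<ge> W" using a W2 by linarith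
      moreover have "l \<le> m" using that ab bm by linarith
      ultimately show ?thesis by (simp add: T_def)
    qed
    have T_high: "l \<in> T" if "b \<le> l" "l \<le> m" for l
    proof -
      have "real l \<ge> real b" using that by simp
      then have "real l - \<alpha> * real K \<ge> W" using b W2 by linarith
      then show ?thesis using that by (simp add: T_def)
    qed

    have u_sum: "real (u l) = (\<Sum>i=0..<l. of_bool (rise_at w i))" if "l \<le> m" for l
      using that cnt01_take_eq_sum by (simp add: u_def m_def)
    have u_near: "\<bar>real (u l) - \<rho> / 2 * real l\<bar> \<le> 3 / 2 * W" if "l \<le> m" for l
    proof -
      have "(\<Sum>i=0..<l. of_bool (rise_at w i) - \<rho> / 2) = real (u l) - \<rho> / 2 * real l"
        by (simp add: u_sum[OF that] sum_subtractf)
      then have "\<bar>real (u l) - \<rho> / 2 * real l\<bar> \<le> sqrt (real l) * L / 2 + 1 / 2"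
        using balanced_rise[OF bal, of 0 l] that by (simp add: m_def)
      moreover have "sqrt (real l) * L \<le> 2 * W"
      proof -
        have "sqrt (real l) \<le> sqrt (4 * real K)" using that m4 by (intro real_sqrt_le_mono) linarith
        then have "sqrt (real l) * L \<le> (2 * sqrt (real K)) * L"
          using L by (intro mult_right_mono) (auto simp: real_sqrt_mult)
        then show ?thesis by (simp add: W_def)
      qed
      ultimately show ?thesis using W2 by linarith
    qed
    have uU: "u l \<le> U" for l
      unfolding u_def U_def using cnt01_append[of True "take l w" "drop l w"] by simp
    have U_eq: "U = u m" by (simp add: U_def u_def m_def)
    \<comment> \<open>Upper index at the centre: \<open>K\<close> blocks, plus rises with frequency
      \<open>\<rho>/2\<close> among \<open>\<alpha> K\<close> letters.\<close>
    have centre: "real K + \<rho> * (\<alpha> * real K) / 2 = 2 / (1 + q) * real K"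
      using q by (simp add: \<rho>_def \<alpha>_def field_simps)
    have lin: "\<bar>\<rho> / 2 * x - \<rho> / 2 * y\<bar> \<le> z / 2" if "\<bar>x - y\<bar> \<le> z" for x y z
    proof -
      have "\<bar>\<rho> / 2 * x - \<rho> / 2 * y\<bar> = \<rho> / 2 * \<bar>x - y\<bar>"
        unfolding right_diff_distrib[symmetric] abs_mult using \<rho> by simp
      also have "\<dots> \<le> 1 / 2 * z" using that \<rho> by (intro mult_mono) auto
      finally show ?thesis by simp
    qed
    have near: "\<bar>real l - 2 * (1 - q) * real K\<bar> \<le> 5 * \<eta> * real K"
      "\<bar>real (m - l) - 2 * (1 - q) * real K\<bar> \<le> 5 * \<eta> * real K"
      "\<bar>real (P l) - 2 / (1 + q) * real K\<bar> \<le> 5 * \<eta> * real K"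
      "\<bar>real (Q l) - 2 / (1 + q) * real K\<bar> \<le> 5 * \<eta> * real K" if "a \<le> l" "l \<le> b" for l
    proof -
      have "real a \<le> real l" "real l \<le> real b" using that by auto
      then have l1: "\<bar>real l - \<alpha> * real K\<bar> \<le> 2 * W" using a b by linarith
      have lm: "l \<le> m" using that bm by linarith
      have l2: "\<bar>real (m - l) - \<alpha> * real K\<bar> \<le> 4 * W"
        using l1 m_near lm by (simp add: of_nat_diff)
      have ul: "\<bar>real (u l) - \<rho> / 2 * (\<alpha> * real K)\<bar> \<le> 5 / 2 * W"
        using u_near[OF lm] lin[OF l1] by linarith
      have Ul: "\<bar>real U - \<rho> / 2 * (2 * (\<alpha> * real K))\<bar> \<le> 5 / 2 * W"
        using u_near[OF order_refl] lin[OF m_near] unfolding U_eq by linarith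
      have "real (Q l) = real K + real U - real (u l)"
        unfolding Q_def using uU[of l] by (simp add: of_nat_diff)
      then have Ql: "\<bar>real (Q l) - 2 / (1 + q) * real K\<bar> \<le> 5 * W"
        using ul Ul centre by linarith
      have "real (P l) = real K + real (u l)" by (simp add: P_def)
      then have Pl: "\<bar>real (P l) - 2 / (1 + q) * real K\<bar> \<le> 5 / 2 * W"
        using ul centre by linarith
      have e: "5 * \<eta> * real K = 5 * W" by (simp add: W_eq)
      show "\<bar>real l - 2 * (1 - q) * real K\<bar> \<le> 5 * \<eta> * real K"
        using l1 W2 unfolding e \<alpha>_def by linarith
      show "\<bar>real (m - l) - 2 * (1 - q) * real K\<bar> \<le> 5 * \<eta> * real K"
        using l2 W2 unfolding e \<alpha>_def by linarith
      show "\<bar>real (P l) - 2 / (1 + q) * real K\<bar> \<le> 5 * \<eta> * real K"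
        using Pl W2 unfolding e by linarith
      show "\<bar>real (Q l) - 2 / (1 + q) * real K\<bar> \<le> 5 * \<eta> * real K"
        using Ql W2 unfolding e by linarith
    qed
    have "0 < real K" using K by simp
    note est' = est0[OF \<eta>(1,2) this K\<eta>]
    have est: "\<bar>c l\<bar> \<le> C0 * \<eta> * g l \<and>
        \<bar>choose_diff l (m - l) (P l) (Q l + 1) - 1 / q\<^sup>2 * c l\<bar> \<le> C0 * \<eta>\<^sup>2 * g l \<and>
        \<bar>choose_diff l (m - l) (P l) (Q l - 1) - q\<^sup>2 * c l\<bar> \<le> C0 * \<eta>\<^sup>2 * g l \<and>
        \<bar>choose_diff (l + 1) (m - l - 1) (P l) (Q l) - c l\<bar> \<le> C0 * \<eta>\<^sup>2 * g l \<and>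
        \<bar>choose_diff (l + 1) (m - l - 1) (P l + 1) (Q l - 1) - c l\<bar> \<le> C0 * \<eta>\<^sup>2 * g l \<and>
        real (Q l choose (m - l)) \<le> C0 * real ((Q l - 1) choose (m - l)) \<and>
        real (P l choose l) \<le> C0 * real ((P l - 1) choose l)" if "a \<le> l" "l \<le> b" for l
      using est'[OF near[OF that]] unfolding Let_def g_def c_def .

    have P_Suc: "P (Suc l) = P l + of_bool (rise_at w l)" "Q (Suc l) = Q l - of_bool (rise_at w l)"
      "m - Suc l = m - l - 1" if "l < m" for l
      using that cnt01_take_Suc[of l w] unfolding P_def Q_def u_def m_def by auto
    have h_eq: "h l = real (P l choose l) * real ((Q l - of_bool (rise_at w l)) choose (m - l))" if "l < m" for l
    proof -
      have "Q l - of_bool (rise_at w l) = K + cnt01 True (drop l w)"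
        unfolding Q_def U_def u_def using cnt01_take_drop[of l w] that by (auto simp: m_def)
      then show ?thesis
        using that unfolding h_def cut_weight_def emb_pow01 P_def u_def m_def by simp
    qed
    \<comment> \<open>\<open>g\<close> ignores the rise at the cut, which \<open>h\<close> subtracts
      from the upper index; this one step costs the factor \<open>C0\<close>.\<close>
    have g_le: "g l \<le> C1 * h l" if "a \<le> l" "l \<le> b" for l
    proof -
      have lm: "l < m" using that bm by linarith
      have "real (Q l choose (m - l)) \<le> C1 * real ((Q l - of_bool (rise_at w l)) choose (m - l))"
      proof (cases "rise_at w l")
        case True
        have "real (Q l choose (m - l)) \<le> C0 * real ((Q l - 1) choose (m - l))" using est[OF that] by blast
        also have "\<dots> \<le> C1 * real ((Q l - 1) choose (m - l))" by (intro mult_right_mono) (auto simp: C1_def)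
        finally show ?thesis using True by simp
      next
        case False
        then show ?thesis using pos(3) mult_right_mono[of 1 C1 "real (Q l choose (m - l))"] by simp
      qed
      then have "real (P l choose l) * real (Q l choose (m - l)) \<le>
          real (P l choose l) * (C1 * real ((Q l - of_bool (rise_at w l)) choose (m - l)))"
        by (intro mult_left_mono) auto
      then show ?thesis unfolding g_def h_eq[OF lm] by (simp only: mult_ac)
    qed
    have sum_h: "(\<Sum>l=a..<b. h l) \<le> f"
      unfolding f_def using h0 bm by (intro sum_mono2) auto
    have sum_g: "(\<Sum>l=a..<b. g l) \<le> C1 * f"
    proof -
      have "(\<Sum>l=a..<b. g l) \<le> (\<Sum>l=a..<b. C1 * h l)" by (intro sum_mono g_le) auto
      also have "\<dots> \<le> C1 * f" using sum_h pos by (simp add: sum_distrib_left[symmetric] mult_left_mono)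
      finally show ?thesis .
    qed
    define E where "E = C2 * \<eta>\<^sup>2 * f"
    have E0: "E \<ge> 0" unfolding E_def using pos f0 by simp
    have \<eta>f: "\<eta>\<^sup>2 * f \<le> E"
      unfolding E_def using C0 pos f0 mult_right_mono[of 1 C2 "\<eta>\<^sup>2 * f"] by (simp add: C2_def mult_ac)
    have E_ge: "C0 * \<eta>\<^sup>2 * (C1 * f) \<le> E"
      unfolding E_def C2_def using f0 by (simp add: algebra_simps)
    have sum_E: "(\<Sum>l=a..<b. \<bar>y l\<bar>) \<le> E" if "\<And>l. a \<le> l \<Longrightarrow> l \<le> b \<Longrightarrow> \<bar>y l\<bar> \<le> C0 * \<eta>\<^sup>2 * g l" for y
    proof -
      have "(\<Sum>l=a..<b. \<bar>y l\<bar>) \<le> (\<Sum>l=a..<b. C0 * \<eta>\<^sup>2 * g l)" by (intro sum_mono that) auto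
      also have "\<dots> = C0 * \<eta>\<^sup>2 * (\<Sum>l=a..<b. g l)" by (simp add: sum_distrib_left)
      also have "\<dots> \<le> C0 * \<eta>\<^sup>2 * (C1 * f)" using C0 by (intro mult_left_mono sum_g) auto
      finally show ?thesis using E_ge by linarith
    qed
    define X where "X l = choose_diff l (m - l) (P l) (Q l + 1) - c l" for l
    define Y where "Y l = choose_diff l (m - l) (P l) (Q l - 1) - c l" for l
    define D where "D l = real (emb (take l w) (pow01 k) * emb (drop l w) (True # pow01 (Suc k))) -
      real (emb (take l w) (pow01 (Suc k)) * emb (drop l w) (True # pow01 k))" for l
    define F where "F l = real (emb (take l w) (pow01 k) * emb (drop l w) (pow01 (Suc k))) -
      real (emb (take l w) (pow01 (Suc k)) * emb (drop l w) (pow01 k))" for l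
    have D_eq: "D l = c l + of_bool (both_at w l) * X l" if "l < m" for l
      using cut_diff_x[of l w k] that
      by (auto simp: D_def c_def X_def P_def Q_def u_def U_def m_def K_def)
    have F_eq: "F l = c l + of_bool (rise_at w l) * Y l" if "l < m" for l
      using cut_diff_even[of l w k] that
      by (auto simp: F_def c_def Y_def P_def Q_def u_def U_def m_def K_def)

    have out: "{..m} - {a..<b} \<subseteq> T"
      using T_low T_high by (auto simp: not_le not_less)
    have split: "(\<Sum>l\<le>m. y l) = (\<Sum>l=a..<b. y l) + (\<Sum>l\<in>{..m} - {a..<b}. y l)" for y :: "nat \<Rightarrow> real"
      using bm by (subst add.commute, intro sum.subset_diff) auto
    \<comment> \<open>The sum over all cuts vanishes, so the window sum is minus the sum outside,
      which is tail.\<close>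
    have F_win: "\<bar>\<Sum>l=a..<b. c l + of_bool (rise_at w l) * Y l\<bar> \<le> E"
    proof -
      have "(\<Sum>l\<le>m. F l) = 0" using sum_cut_diff_even[of w k] by (simp add: F_def m_def)
      then have "\<bar>\<Sum>l=a..<b. F l\<bar> = \<bar>\<Sum>l\<in>{..m} - {a..<b}. F l\<bar>"
        unfolding split[of F] by linarith
      also have "\<dots> \<le> (\<Sum>l\<in>{..m} - {a..<b}. \<bar>F l\<bar>)" by (rule sum_abs)
      also have "\<dots> \<le> (\<Sum>l\<in>{..m} - {a..<b}. h l)"
        unfolding F_def h_def cut_weight_def K_def by (intro sum_mono cut_diff_even_le)
      also have "\<dots> \<le> (\<Sum>l\<in>T. h l)" using fin out h0 by (intro sum_mono2) auto
      finally have "\<bar>\<Sum>l=a..<b. F l\<bar> \<le> E" using tail' \<eta>f by linarith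
      moreover have "(\<Sum>l=a..<b. F l) = (\<Sum>l=a..<b. c l + of_bool (rise_at w l) * Y l)"
        using bm by (intro sum.cong F_eq) auto
      ultimately show ?thesis by simp
    qed
    have D_out: "\<bar>\<Sum>l\<in>{..m} - {a..<b}. D l\<bar> \<le> 2 * (\<eta>\<^sup>2 * f)"
    proof -
      let ?O = "{..m} - {a..<b}"
      have "\<bar>\<Sum>l\<in>?O. D l\<bar> \<le> (\<Sum>l\<in>?O. \<bar>D l\<bar>)" by (rule sum_abs)
      also have "\<dots> \<le> (\<Sum>l\<in>?O. h l + (if l < m then h (Suc l) else 0))"
        unfolding D_def h_def cut_weight_def K_def m_def by (intro sum_mono cut_diff_x_le) auto
      also have "\<dots> = (\<Sum>l\<in>?O. h l) + (\<Sum>l\<in>{l\<in>?O. l < m}. h (Suc l))"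
        by (subst sum.inter_filter) (simp_all add: sum.distrib)
      also have "(\<Sum>l\<in>{l\<in>?O. l < m}. h (Suc l)) = (\<Sum>l\<in>Suc ` {l\<in>?O. l < m}. h l)"
        by (simp add: sum.reindex)
      also have "(\<Sum>l\<in>?O. h l) + \<dots> \<le> (\<Sum>l\<in>T. h l) + (\<Sum>l\<in>T. h l)"
      proof (intro add_mono sum_mono2 fin out h0)
        show "Suc ` {l\<in>?O. l < m} \<subseteq> T"
        proof (intro image_subsetI)
          fix l assume l: "l \<in> {l\<in>?O. l < m}"
          then consider "l < a" | "b \<le> l" by force
          then show "Suc l \<in> T"
          proof cases
            case 1
            then show ?thesis by (intro T_low) auto
          next
            case 2
            then show ?thesis using l by (intro T_high) auto
          qed
        qed
      qed
      finally show ?thesis using tail' by linarith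
    qed
    have win_V: "sqrt (real (j - a)) * L \<le> 2 * V" if "a \<le> j" "j \<le> b" for j
    proof -
      have "real j \<le> real b" using that by simp
      then have "real (j - a) \<le> 4 * W" using that a b by (simp add: of_nat_diff)
      then have "sqrt (real (j - a)) \<le> sqrt (4 * W)" by (rule real_sqrt_le_mono)
      then have "sqrt (real (j - a)) * L \<le> (2 * sqrt W) * L"
        using L by (intro mult_right_mono) (auto simp: real_sqrt_mult)
      then show ?thesis by (simp add: V_def)
    qed
    have D_win: "\<bar>\<Sum>l=a..<b. c l + of_bool (both_at w l) * X l\<bar> \<le> 20 / q\<^sup>2 * (5 * V) * E"
    \<comment> \<open>The rises enter through the vanishing sum and the pattern 11 through the
      wanted one. The discrepancies are at most \<open>3 V + 3/2\<close>, below \<open>5 V\<close>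
      as \<open>V \<ge> 2\<close>.\<close>
    proof (rule window_cancellation[where ?u1.0 = "\<lambda>l. of_bool (rise_at w l)" and Y = Y and ?\<pi>1.0 = "\<rho> / 2" and ?\<pi>2.0 = "(1 - \<rho>) / 2"])
      fix j assume j: "a \<le> j" "j \<le> b"
      then have jm: "j \<le> length w" using bm by (simp add: m_def)
      show "\<bar>\<Sum>l=a..<j. of_bool (rise_at w l) - \<rho> / 2\<bar> \<le> 5 * V"
        using balanced_rise[OF bal j(1) jm] win_V[OF j] V1 by linarith
      show "\<bar>\<Sum>l=a..<j. of_bool (both_at w l) - (1 - \<rho>) / 2\<bar> \<le> 5 * V"
        using balanced_both[OF bal j(1) jm \<rho>(1)] win_V[OF j] V1 by linarith
    next
      \<comment> \<open>Locally \<open>c b\<close> is only of first order relative to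
        \<open>g b\<close>; second order is reached because the endpoint \<open>b\<close> lies in
        the tail, where \<open>h b \<le> \<eta>^2 f\<close>.\<close>
      show "\<bar>c b\<bar> \<le> E"
      proof -
        have "\<bar>c b\<bar> \<le> C0 * \<eta> * g b" using est[OF ab order_refl] by blast
        also have "\<dots> \<le> C0 * \<eta> * (C1 * h b)"
          using C0 \<eta>(1) g_le[OF ab order_refl] by (intro mult_left_mono) auto
        also have "\<dots> \<le> C0 * 1 * (C1 * (\<eta>\<^sup>2 * f))"
        proof -
          have "h b \<le> (\<Sum>l\<in>T. h l)"
            using T_high[OF order_refl] bm h0 fin by (intro member_le_sum) auto
          then have "h b \<le> \<eta>\<^sup>2 * f" using tail' by linarith
          then show ?thesis using C0 \<eta> pos h0 by (intro mult_mono mult_nonneg_nonneg) auto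
        qed
        also have "\<dots> = C0 * \<eta>\<^sup>2 * (C1 * f)" by simp
        finally show ?thesis using E_ge by linarith
      qed
      show "(\<Sum>l=a..<b. \<bar>c (Suc l) - c l\<bar>) \<le> E"
      proof -
        have "\<bar>c (Suc l) - c l\<bar> \<le> C0 * \<eta>\<^sup>2 * g l" if "a \<le> l" "l \<le> b" for l
        proof -
          have lm: "l < m" using that bm by linarith
          have "c (Suc l) = choose_diff (l + 1) (m - l - 1) (P l + of_bool (rise_at w l)) (Q l - of_bool (rise_at w l))"
            unfolding c_def P_Suc[OF lm] by simp
          then show ?thesis using est[OF that] by (cases "rise_at w l") auto
        qed
        then show ?thesis by (rule sum_E)
      qed
      show "(\<Sum>l=a..<b. \<bar>X l - (1 / q\<^sup>2 - 1) * c l\<bar>) \<le> E"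
      proof (rule sum_E)
        fix l assume "a \<le> l" "l \<le> b"
        then have "\<bar>choose_diff l (m - l) (P l) (Q l + 1) - 1 / q\<^sup>2 * c l\<bar> \<le> C0 * \<eta>\<^sup>2 * g l" using est by blast
        moreover have "X l - (1 / q\<^sup>2 - 1) * c l = choose_diff l (m - l) (P l) (Q l + 1) - 1 / q\<^sup>2 * c l"
          by (simp add: X_def left_diff_distrib)
        ultimately show "\<bar>X l - (1 / q\<^sup>2 - 1) * c l\<bar> \<le> C0 * \<eta>\<^sup>2 * g l" by simp
      qed
      show "(\<Sum>l=a..<b. \<bar>Y l - (q\<^sup>2 - 1) * c l\<bar>) \<le> E"
      proof (rule sum_E)
        fix l assume "a \<le> l" "l \<le> b"
        then have "\<bar>choose_diff l (m - l) (P l) (Q l - 1) - q\<^sup>2 * c l\<bar> \<le> C0 * \<eta>\<^sup>2 * g l" using est by blast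
        moreover have "Y l - (q\<^sup>2 - 1) * c l = choose_diff l (m - l) (P l) (Q l - 1) - q\<^sup>2 * c l"
          by (simp add: Y_def left_diff_distrib)
        ultimately show "\<bar>Y l - (q\<^sup>2 - 1) * c l\<bar> \<le> C0 * \<eta>\<^sup>2 * g l" by simp
      qed
    qed (use q ab V1 E0 \<rho> F_win in auto)

    have x_split: "emb w (x_string k) = (\<Sum>l\<le>m. emb (take l w) (pow01 k) * emb (drop l w) (True # pow01 (Suc k)))"
      unfolding x_string_def m_def by (subst emb_append) simp
    have y_split: "emb w (y_string k) = (\<Sum>l\<le>m. emb (take l w) (pow01 (Suc k)) * emb (drop l w) (True # pow01 k))"
      unfolding y_string_def m_def by (subst emb_append) simp
    have "real (emb w (x_string k)) - real (emb w (y_string k)) = (\<Sum>l\<le>m. D l)"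
      unfolding x_split y_split D_def of_nat_sum sum_subtractf ..
    also have "\<dots> = (\<Sum>l=a..<b. c l + of_bool (both_at w l) * X l) + (\<Sum>l\<in>{..m} - {a..<b}. D l)"
      unfolding split using bm by (simp add: D_eq)
    finally have "\<bar>real (emb w (x_string k)) - real (emb w (y_string k))\<bar> \<le> 20 / q\<^sup>2 * (5 * V) * E + 2 * (\<eta>\<^sup>2 * f)"
      using D_win D_out by linarith
    also have "\<dots> \<le> 20 / q\<^sup>2 * (5 * V) * E + 2 * (V * (\<eta>\<^sup>2 * f))"
      using V1 f0 mult_right_mono[of 1 V "\<eta>\<^sup>2 * f"] by simp
    also have "\<dots> = (100 / q\<^sup>2 * C2 + 2) * (V * \<eta>\<^sup>2) * f"
      by (simp add: E_def algebra_simps)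
    \<comment> \<open>Return from the reference string to \<open>x_string k\<close>: the window
      carries at least half of \<open>f\<close>, and there each weight is at most \<open>C0\<close>
      times the corresponding term of \<open>x_string k\<close>.\<close>
    also have "\<dots> \<le> (100 / q\<^sup>2 * C2 + 2) * (V * \<eta>\<^sup>2) * (2 * C0 * real (emb w (x_string k)))"
    proof (intro mult_left_mono)
      have K4: "real K \<ge> 2"
      proof -
        have "4 \<le> L\<^sup>2" using power_mono[OF L, of 2] by simp
        also have "\<dots> = real K * \<eta>\<^sup>2" by (simp only: L2)
        also have "\<dots> \<le> real K * 1" using \<eta> by (intro mult_left_mono) (auto simp: power_le_one)
        finally show ?thesis by simp
      qed
      have "2 * (\<Sum>l\<in>T. h l) \<le> real K * (\<Sum>l\<in>T. h l)"
        using K4 h0 by (intro mult_right_mono sum_nonneg) auto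
      then have T_half: "2 * (\<Sum>l\<in>T. h l) \<le> f" using tail by linarith
      have "(\<Sum>l\<in>{..m} - {a..<b}. h l) \<le> (\<Sum>l\<in>T. h l)"
        using fin out h0 by (intro sum_mono2) auto
      then have "f \<le> 2 * (\<Sum>l=a..<b. h l)"
        using T_half split[of h] unfolding f_def by linarith
      also have "(\<Sum>l=a..<b. h l) \<le> (\<Sum>l=a..<b. C0 * real (emb (take l w) (pow01 k) * emb (drop l w) (True # pow01 (Suc k))))"
      proof (rule sum_mono)
        fix l assume l: "l \<in> {a..<b}"
        then have lm: "l < m" using bm by simp
        have "real (P l choose l) \<le> C0 * real ((P l - 1) choose l)" using est[of l] l by auto
        also have "(P l - 1) choose l = emb (take l w) (pow01 k)"
          using lm by (simp add: emb_pow01 P_def K_def u_def m_def)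
        finally have 1: "real (P l choose l) \<le> C0 * real (emb (take l w) (pow01 k))" .
        have "h l = real (P l choose l) * real (emb (drop l w) (pow01 K))"
          using lm by (simp add: h_def cut_weight_def emb_pow01 P_def u_def m_def)
        also have "\<dots> \<le> (C0 * real (emb (take l w) (pow01 k))) * real (emb (drop l w) (True # pow01 K))"
          using 1 C0 emb_Cons_ge[of "drop l w" "pow01 K" True] by (intro mult_mono) auto
        finally show "h l \<le> C0 * real (emb (take l w) (pow01 k) * emb (drop l w) (True # pow01 (Suc k)))"
          by (simp add: K_def)
      qed
      also have "\<dots> = C0 * (\<Sum>l=a..<b. real (emb (take l w) (pow01 k) * emb (drop l w) (True # pow01 (Suc k))))"
        by (simp add: sum_distrib_left)
      also have "\<dots> \<le> C0 * (\<Sum>l\<le>m. real (emb (take l w) (pow01 k) * emb (drop l w) (True # pow01 (Suc k))))"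
        using C0 bm by (intro mult_left_mono sum_mono2) auto
      also have "\<dots> = C0 * real (emb w (x_string k))"
        by (simp only: x_split of_nat_sum)
      finally show "f \<le> 2 * C0 * real (emb w (x_string k))" by simp
    qed (use pos V1 q in auto)
    also have "\<dots> = C * V * \<eta>\<^sup>2 * real (emb w (x_string k))"
      by (simp add: C_def)
    finally show "\<bar>real (emb w (x_string k)) - real (emb w (y_string k))\<bar> \<le>
        C * (sqrt (sqrt (real (Suc k)) * L) * L) * (L / sqrt (real (Suc k)))\<^sup>2 * real (emb w (x_string k))"
      by (simp only: V_def W_def \<eta>_def K_def)
  qed
qed

section \<open>Hellinger affinity\<close>

text \<open>The Bhattacharyya coefficient, as a sum over a set meant to contain both
  supports.\<close>

definition affinity :: "'a set \<Rightarrow> 'a pmf \<Rightarrow> 'a pmf \<Rightarrow> real" where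
  "affinity S p r = (\<Sum>w\<in>S. sqrt (pmf p w * pmf r w))"

lemma pmf_replicate_Cons:
  "pmf (replicate_pmf (Suc n) p) (x # xs) = pmf p x * pmf (replicate_pmf n p) xs"
proof -
  have eq: "replicate_pmf (Suc n) p = map_pmf (\<lambda>(x, xs). x # xs) (pair_pmf p (replicate_pmf n p))"
    by (simp add: pair_pmf_def map_bind_pmf)
  have inj: "inj (\<lambda>(x, xs). x # xs :: 'a list)" by (auto simp: inj_def)
  have "pmf (replicate_pmf (Suc n) p) ((\<lambda>(x, xs). x # xs) (x, xs)) = pmf (pair_pmf p (replicate_pmf n p)) (x, xs)"
    unfolding eq by (rule pmf_map_inj'[OF inj])
  then show ?thesis by (simp add: pmf_pair del: replicate_pmf.simps)
qed

lemma affinity_replicate_pmf: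
  "affinity {us. length us = T \<and> set us \<subseteq> S} (replicate_pmf T p) (replicate_pmf T r) = affinity S p r ^ T"
proof (induction T)
  case 0
  have "{us. length us = 0 \<and> set us \<subseteq> S} = {[]}" by auto
  then show ?case by (simp add: affinity_def)
next
  case (Suc T)
  let ?S = "{us. length us = T \<and> set us \<subseteq> S}"
  have eq: "{us. length us = Suc T \<and> set us \<subseteq> S} = (\<lambda>(x, xs). x # xs) ` (S \<times> ?S)"
    by (auto simp: length_Suc_conv image_iff)
  have inj: "inj_on (\<lambda>(x, xs). x # xs) A" for A :: "('a \<times> 'a list) set" by (auto simp: inj_on_def)
  have "affinity {us. length us = Suc T \<and> set us \<subseteq> S} (replicate_pmf (Suc T) p) (replicate_pmf (Suc T) r) =
      (\<Sum>(x, xs)\<in>S \<times> ?S. sqrt (pmf p x * pmf r x) * sqrt (pmf (replicate_pmf T p) xs * pmf (replicate_pmf T r) xs))"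
    unfolding affinity_def eq
    by (subst sum.reindex[OF inj])
      (auto intro!: sum.cong simp: pmf_replicate_Cons real_sqrt_mult mult_ac simp del: replicate_pmf.simps)
  also have "\<dots> = affinity S p r * affinity ?S (replicate_pmf T p) (replicate_pmf T r)"
    unfolding affinity_def by (simp add: sum_product sum.cartesian_product)
  finally show ?case using Suc by simp
qed

lemma affinity_eq:
  assumes "finite S" "set_pmf p \<subseteq> S" "set_pmf r \<subseteq> S"
  shows "1 - affinity S p r = (\<Sum>w\<in>S. (sqrt (pmf p w) - sqrt (pmf r w))\<^sup>2) / 2"
proof -
  have "(\<Sum>w\<in>S. (sqrt (pmf p w) - sqrt (pmf r w))\<^sup>2) =
      (\<Sum>w\<in>S. pmf p w + pmf r w - 2 * sqrt (pmf p w * pmf r w))"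
    by (simp add: power2_diff real_sqrt_mult mult.assoc)
  also have "\<dots> = (\<Sum>w\<in>S. pmf p w) + (\<Sum>w\<in>S. pmf r w) - 2 * affinity S p r"
    by (simp add: affinity_def sum.distrib sum_subtractf sum_distrib_left)
  also have "(\<Sum>w\<in>S. pmf p w) = 1" using assms by (intro sum_pmf_eq_1) auto
  also have "(\<Sum>w\<in>S. pmf r w) = 1" using assms by (intro sum_pmf_eq_1) auto
  finally show ?thesis by simp
qed

text \<open>The extremal pair consists of two-point laws with error \<open>\<delta>\<close> each,
  whose affinity is the right-hand side. A weighted mean inequality that is sharp for this pair
  turns the affinity into a linear function of the two success probabilities.\<close>

lemma affinity_test_le:
  fixes \<delta> :: real
  assumes S: "finite S" "set_pmf p \<subseteq> S" "set_pmf r \<subseteq> S" and \<delta>: "0 < \<delta>" "\<delta> < 1/2"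
    and p: "measure_pmf.prob p A \<ge> 1 - \<delta>" and r: "measure_pmf.prob r (- A) \<ge> 1 - \<delta>"
  shows "affinity S p r \<le> 2 * sqrt (\<delta> * (1 - \<delta>))"
proof -
  \<comment> \<open>Equality in \<open>amgm\<close> holds at \<open>b / a = s^2\<close>, here the
    ratio \<open>\<delta> / (1 - \<delta>)\<close> of the extremal pair.\<close>
  define s where "s = sqrt (\<delta> / (1 - \<delta>))"
  have s: "0 < s" "s \<le> 1" using \<delta> by (auto simp: s_def)
  have amgm: "sqrt (a * b) \<le> (s * a + b / s) / 2" if "a \<ge> 0" "b \<ge> 0" for a b
    using arith_geo_mean_sqrt[of "s * a" "b / s"] that s by simp
  have prob: "measure_pmf.prob u B = (\<Sum>w\<in>S \<inter> B. pmf u w)" if "set_pmf u \<subseteq> S" for u B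
  proof -
    have "measure_pmf.prob u B = measure_pmf.prob u (S \<inter> B)"
      using that by (intro measure_pmf.finite_measure_eq_AE AE_pmfI) auto
    also have "\<dots> = (\<Sum>w\<in>S \<inter> B. pmf u w)" using S(1) by (intro measure_measure_pmf_finite) auto
    finally show ?thesis .
  qed
  have compl: "measure_pmf.prob u (- B) = 1 - measure_pmf.prob u B" for u :: "'a pmf" and B
    using measure_pmf.prob_compl[of B u] by (simp add: Compl_eq_Diff_UNIV)
  define x where "x = measure_pmf.prob p A"
  define y where "y = measure_pmf.prob r (- A)"
  have "affinity S p r = (\<Sum>w\<in>S \<inter> A. sqrt (pmf p w * pmf r w)) + (\<Sum>w\<in>S \<inter> - A. sqrt (pmf r w * pmf p w))"
    unfolding affinity_def sum.Int_Diff[OF S(1), of _ A] Diff_eq by (simp add: mult.commute)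
  also have "\<dots> \<le> (\<Sum>w\<in>S \<inter> A. (s * pmf p w + pmf r w / s) / 2) + (\<Sum>w\<in>S \<inter> - A. (s * pmf r w + pmf p w / s) / 2)"
    by (intro add_mono sum_mono amgm) auto
  also have "\<dots> = (s * x + (1 - y) / s) / 2 + (s * y + (1 - x) / s) / 2"
    using prob[OF S(2), of A] prob[OF S(2), of "- A"] prob[OF S(3), of A] prob[OF S(3), of "- A"]
      compl[of p A] compl[of r A]
    by (simp add: x_def y_def sum.distrib flip: sum_divide_distrib sum_distrib_left)
  also have "\<dots> = (s * x + (1 - x) / s) / 2 + (s * y + (1 - y) / s) / 2" by (simp add: add_divide_distrib)
  also have "\<dots> \<le> (s * (1 - \<delta>) + \<delta> / s) / 2 + (s * (1 - \<delta>) + \<delta> / s) / 2"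
  proof -
    \<comment> \<open>Because \<open>s \<le> 1/s\<close>, the bound decreases in the success
      probability, so its worst value is at \<open>1 - \<delta>\<close>.\<close>
    have "s * z + (1 - z) / s \<le> s * (1 - \<delta>) + \<delta> / s" if "z \<ge> 1 - \<delta>" for z
    proof -
      have "s * s \<le> 1 * 1" using s by (intro mult_mono) auto
      then have "s \<le> 1 / s" using s by (simp add: field_simps)
      then have "(z - (1 - \<delta>)) * s \<le> (z - (1 - \<delta>)) * (1 / s)" using that by (intro mult_left_mono) auto
      then show ?thesis by (simp add: algebra_simps diff_divide_distrib add_divide_distrib)
    qed
    then show ?thesis using p r unfolding x_def y_def
      by (intro add_mono[OF divide_right_mono divide_right_mono]) auto
  qed
  also have "\<dots> = 2 * sqrt (\<delta> * (1 - \<delta>))"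
  proof -
    have sqd: "sqrt \<delta> * sqrt \<delta> = \<delta>" "sqrt (1 - \<delta>) * sqrt (1 - \<delta>) = 1 - \<delta>" using \<delta> by auto
    have nz: "sqrt \<delta> > 0" "sqrt (1 - \<delta>) > 0" using \<delta> by auto
    have cancel: "x / y * (y * y) = x * y" "(x * x) / (x / y) = x * y" if "x > 0" "y > 0" for x y :: real
      using that by simp_all
    have "s * (1 - \<delta>) = sqrt \<delta> / sqrt (1 - \<delta>) * (sqrt (1 - \<delta>) * sqrt (1 - \<delta>))"
      by (simp only: sqd s_def real_sqrt_divide)
    then have 1: "s * (1 - \<delta>) = sqrt (\<delta> * (1 - \<delta>))" by (simp only: cancel[OF nz] real_sqrt_mult)
    have "\<delta> / s = (sqrt \<delta> * sqrt \<delta>) / (sqrt \<delta> / sqrt (1 - \<delta>))"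
      by (simp only: sqd s_def real_sqrt_divide)
    then have 2: "\<delta> / s = sqrt (\<delta> * (1 - \<delta>))" by (simp only: cancel[OF nz] real_sqrt_mult)
    show ?thesis unfolding 1 2 by simp
  qed
  finally show ?thesis .
qed

text \<open>Off \<open>B\<close> the roots differ by at most \<open>R sqrt p\<close>, so the squared
  distance is quadratic in \<open>R\<close>: a relative difference \<open>n^(-3/4)\<close> becomes
  \<open>n^(-3/2)\<close>. On \<open>B\<close> the squared distance is at most the sum of the two
  laws.\<close>

lemma hellinger_le:
  fixes R :: real
  assumes S: "finite S" "set_pmf p \<subseteq> S" "set_pmf r \<subseteq> S" and R: "R \<ge> 0"
    and good: "\<And>w. w \<in> S - B \<Longrightarrow> \<bar>pmf p w - pmf r w\<bar> \<le> R * pmf p w"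
  shows "1 - affinity S p r \<le> (measure_pmf.prob p B + measure_pmf.prob r B + R\<^sup>2) / 2"
proof -
  let ?d = "\<lambda>w. (sqrt (pmf p w) - sqrt (pmf r w))\<^sup>2"
  have bad_le: "?d w \<le> pmf p w + pmf r w" for w
    by (simp add: power2_diff)
  have good_le: "?d w \<le> R\<^sup>2 * pmf p w" if "w \<in> S - B" for w
  proof (cases "pmf p w = 0")
    case True
    then show ?thesis using good[OF that] by simp
  next
    case False
    then have pos: "pmf p w > 0" by (simp add: pmf_nonneg order_less_le)
    have "\<bar>sqrt (pmf p w) - sqrt (pmf r w)\<bar> * sqrt (pmf p w) \<le>
        \<bar>sqrt (pmf p w) - sqrt (pmf r w)\<bar> * (sqrt (pmf p w) + sqrt (pmf r w))"
      by (intro mult_left_mono) auto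
    also have "\<dots> = \<bar>(sqrt (pmf p w) - sqrt (pmf r w)) * (sqrt (pmf p w) + sqrt (pmf r w))\<bar>"
      by (simp add: abs_mult)
    also have "\<dots> = \<bar>pmf p w - pmf r w\<bar>" by (simp add: algebra_simps)
    also have "\<dots> \<le> R * pmf p w" by (rule good[OF that])
    finally have "(\<bar>sqrt (pmf p w) - sqrt (pmf r w)\<bar> * sqrt (pmf p w))\<^sup>2 \<le> (R * pmf p w)\<^sup>2"
      by (intro power_mono) auto
    then have "?d w * pmf p w \<le> (R\<^sup>2 * pmf p w) * pmf p w"
      by (simp only: power_mult_distrib power2_abs real_sqrt_pow2[OF pmf_nonneg])
        (simp add: power2_eq_square mult_ac)
    then show ?thesis using pos by (simp add: mult_le_cancel_right)
  qed
  have "(\<Sum>w\<in>S. ?d w) = (\<Sum>w\<in>S \<inter> B. ?d w) + (\<Sum>w\<in>S - B. ?d w)"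
    using S(1) by (subst sum.Int_Diff[of S _ B]) auto
  also have "\<dots> \<le> (\<Sum>w\<in>S \<inter> B. pmf p w + pmf r w) + (\<Sum>w\<in>S - B. R\<^sup>2 * pmf p w)"
    using bad_le good_le by (intro add_mono sum_mono) auto
  also have "\<dots> = (\<Sum>w\<in>S \<inter> B. pmf p w) + (\<Sum>w\<in>S \<inter> B. pmf r w) + R\<^sup>2 * (\<Sum>w\<in>S - B. pmf p w)"
    by (simp add: sum.distrib sum_distrib_left)
  also have "\<dots> \<le> measure_pmf.prob p B + measure_pmf.prob r B + R\<^sup>2 * 1"
  proof (intro add_mono mult_left_mono)
    have *: "(\<Sum>w\<in>A. pmf u w) = measure_pmf.prob u A" if "A \<subseteq> S" for A u
      using S(1) that by (intro measure_measure_pmf_finite[symmetric]) (auto intro: finite_subset)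
    show "(\<Sum>w\<in>S \<inter> B. pmf p w) \<le> measure_pmf.prob p B" "(\<Sum>w\<in>S \<inter> B. pmf r w) \<le> measure_pmf.prob r B"
      by (subst *, auto intro!: measure_pmf.finite_measure_mono)+
    show "(\<Sum>w\<in>S - B. pmf p w) \<le> 1" by (subst *) auto
  qed auto
  finally show ?thesis using affinity_eq[OF S] by simp
qed

text \<open>The test bound for the product laws limits the \<open>T\<close>-th power of the affinity
  from above, and Bernoulli's inequality makes this linear in \<open>T\<close>.\<close>

lemma distinguishable_affinity:
  fixes \<delta> :: real
  assumes d: "distinguishable q \<delta> n T x y" and xy: "x \<noteq> y" "length x = n" "length y = n"
    and \<delta>: "0 < \<delta>" "\<delta> < 1/2"
  shows "1 - 2 * sqrt (\<delta> * (1 - \<delta>)) \<le>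
    real T * (1 - affinity (strings_upto n) (trace_pmf q x) (trace_pmf q y))"
proof -
  obtain g where g: "\<And>z. z \<in> {x, y} \<Longrightarrow>
      measure_pmf.prob (replicate_pmf T (trace_pmf q z)) {us. g us = z} \<ge> 1 - \<delta>"
    using d unfolding distinguishable_def by blast
  define \<rho> where "\<rho> = affinity (strings_upto n) (trace_pmf q x) (trace_pmf q y)"
  let ?S = "{us. length us = T \<and> set us \<subseteq> strings_upto n}"
  have S: "finite ?S"
    using finite_lists_length_eq[OF finite_strings_upto[of n], of T] by (simp add: conj_commute)
  have sub: "set_pmf (replicate_pmf T (trace_pmf q z)) \<subseteq> ?S" if "length z = n" for z
    using set_trace_pmf[of q z] that by (auto simp: set_replicate_pmf)
  have "measure_pmf.prob (replicate_pmf T (trace_pmf q y)) {us. g us = y} \<le>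
      measure_pmf.prob (replicate_pmf T (trace_pmf q y)) (- {us. g us = x})"
    using xy by (intro measure_pmf.finite_measure_mono) auto
  then have "affinity ?S (replicate_pmf T (trace_pmf q x)) (replicate_pmf T (trace_pmf q y)) \<le> 2 * sqrt (\<delta> * (1 - \<delta>))"
    using g[of x] g[of y] S sub xy \<delta> by (intro affinity_test_le[where A = "{us. g us = x}"]) auto
  then have le: "\<rho> ^ T \<le> 2 * sqrt (\<delta> * (1 - \<delta>))"
    by (simp add: affinity_replicate_pmf \<rho>_def)
  have "\<rho> \<ge> 0" unfolding \<rho>_def affinity_def by (intro sum_nonneg) auto
  then have "1 + real T * (\<rho> - 1) \<le> (1 + (\<rho> - 1)) ^ T"
    by (intro Bernoulli_inequality) auto
  then show ?thesis using le unfolding \<rho>_def[symmetric] by (simp add: algebra_simps)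
qed

section \<open>Probability of atypical traces\<close>

lemma prob_trace_le:
  fixes q :: real
  assumes q: "0 < q" "q < 1" and le: "\<And>w. emb w x \<le> emb w z" and len: "length z = Suc (length x)"
  shows "q * measure_pmf.prob (trace_pmf q x) S \<le> measure_pmf.prob (trace_pmf q z) S"
proof -
  \<comment> \<open>To leave the same trace, the longer string needs one deletion more; this is the
    factor \<open>q\<close>.\<close>
  have pt: "q * pmf (trace_pmf q x) w \<le> pmf (trace_pmf q z) w" for w
  proof (cases "length w \<le> length x")
    case True
    have "q * pmf (trace_pmf q x) w = (1 - q) ^ length w * q ^ (length z - length w) * real (emb w x)"
      using True q by (simp add: pmf_trace_emb len Suc_diff_le)
    also have "\<dots> \<le> (1 - q) ^ length w * q ^ (length z - length w) * real (emb w z)"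
      using q le by (intro mult_left_mono) auto
    finally show ?thesis using q by (simp add: pmf_trace_emb)
  next
    case False
    then show ?thesis using q emb_eq_0[of x w] by (simp add: pmf_trace_emb)
  qed
  show ?thesis
    unfolding prob_trace_eq_sum[of x "length z", simplified len, simplified]
      prob_trace_eq_sum[of z "length z", simplified len, simplified]
    using pt by (simp add: sum_distrib_left len sum_mono)
qed

text \<open>One tail per condition: the binomial tail for the length of the trace, the same tail for
  the first half combined with \<open>prob_split_tail\<close> for the cut, at the price of a factor
  \<open>K\<close>, and comparison with the flip chain for the balance.\<close>

lemma prob_atypical_pow01:
  fixes q :: real
  assumes q: "0 < q" "q < 1" and L: "L \<ge> 0" and K: "K \<ge> 1"
  shows "measure_pmf.prob (trace_pmf q (pow01 K @ pow01 K)) {w. \<not> typical q K L w}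
    \<le> 1000 * real K ^ 3 * exp (- (L\<^sup>2))"
proof -
  let ?A = "pow01 K" and ?P = "measure_pmf.prob (trace_pmf q (pow01 K @ pow01 K))"
  define W where "W = sqrt (real K) * L"
  have W0: "W \<ge> 0" using L by (simp add: W_def)
  have W2: "W\<^sup>2 = real K * L\<^sup>2" by (simp add: W_def power_mult_distrib)
  have ne: "?A \<noteq> []" "?A @ ?A \<noteq> []" using K by (cases K; simp add: pow01_Suc)+
  let ?B = "{j :: nat. \<bar>real j - 2 * (1 - q) * real K\<bar> \<ge> W}"
  let ?E1 = "{w. \<bar>real (length w) - real (length (?A @ ?A)) * (1 - q)\<bar> \<ge> 2 * W}"
  let ?E2 = "{w. real (emb w (?A @ ?A)) \<le> real K *
    (\<Sum>j | j \<le> length w \<and> j \<in> ?B. real (emb (take j w) ?A * emb (drop j w) ?A))}"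
  let ?E3 = "{w. \<not> balanced (1 / (1 + q)) L w}"
  have sub: "{w. \<not> typical q K L w} \<subseteq> ?E1 \<union> ?E2 \<union> ?E3"
  proof
    fix w assume "w \<in> {w. \<not> typical q K L w}"
    moreover have "real (length (?A @ ?A)) * (1 - q) = 4 * (1 - q) * real K" by simp
    moreover have "(\<Sum>l\<le>length w. cut_weight K w l) = real (emb w (?A @ ?A))"
      by (simp add: emb_append cut_weight_def)
    ultimately show "w \<in> ?E1 \<union> ?E2 \<union> ?E3"
      unfolding typical_def cut_weight_def W_def Un_iff mem_Collect_eq by argo
  qed
  have e2: "exp (- 2 * L\<^sup>2) \<le> exp (- (L\<^sup>2))" by simp
  have "?P ?E1 \<le> 2 * exp (- 2 * (2 * W)\<^sup>2 / real (length (?A @ ?A)))"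
    using q W0 ne by (intro prob_length_trace_pmf) auto
  also have "- 2 * (2 * W)\<^sup>2 / real (length (?A @ ?A)) = - 2 * L\<^sup>2"
    using K by (simp add: W2 power_mult_distrib field_simps)
  finally have P1: "?P ?E1 \<le> 2 * exp (- (L\<^sup>2))" using e2 by linarith
  have "?P ?E2 \<le> real K * measure_pmf.prob (trace_pmf q ?A) {u. length u \<in> ?B}"
    using q by (intro prob_split_tail) auto
  also have "\<dots> \<le> real K * (2 * exp (- 2 * W\<^sup>2 / real (length ?A)))"
  proof (intro mult_left_mono)
    have "real (length ?A) * (1 - q) = 2 * (1 - q) * real K" by simp
    then show "measure_pmf.prob (trace_pmf q ?A) {u. length u \<in> ?B} \<le> 2 * exp (- 2 * W\<^sup>2 / real (length ?A))"
      using prob_length_trace_pmf[OF q ne(1) W0] by (simp only: mem_Collect_eq)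
  qed auto
  also have "- 2 * W\<^sup>2 / real (length ?A) = - (L\<^sup>2)"
    using K by (simp add: W2)
  finally have P2: "?P ?E2 \<le> 2 * real K * exp (- (L\<^sup>2))" by simp
  have AA: "?A @ ?A = pow01 (2 * K)" by (simp add: pow01_add[symmetric] mult_2)
  have "?P ?E3 \<le> 4 * real (2 * (2 * K) + 1) ^ 3 * exp (- 2 * L\<^sup>2)"
    unfolding AA by (rule prob_unbalanced[OF q L])
  also have "\<dots> \<le> 4 * (5 * real K) ^ 3 * exp (- (L\<^sup>2))"
    using K e2 by (intro mult_mono power_mono) auto
  finally have P3: "?P ?E3 \<le> 500 * real K ^ 3 * exp (- (L\<^sup>2))" by (simp add: power_mult_distrib)
  have "?P {w. \<not> typical q K L w} \<le> ?P (?E1 \<union> ?E2 \<union> ?E3)"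
    using sub by (intro measure_pmf.finite_measure_mono) auto
  also have "\<dots> \<le> ?P (?E1 \<union> ?E2) + ?P ?E3" by (rule measure_Un_le) auto
  also have "\<dots> \<le> ?P ?E1 + ?P ?E2 + ?P ?E3" using measure_Un_le[of ?E1 "measure_pmf (trace_pmf q (?A @ ?A))" ?E2] by simp
  also have "\<dots> \<le> (2 + 2 * real K + 500 * real K ^ 3) * exp (- (L\<^sup>2))"
    using P1 P2 P3 by (simp add: distrib_right)
  also have "\<dots> \<le> (1000 * real K ^ 3) * exp (- (L\<^sup>2))"
  proof (rule mult_right_mono)
    have "1 \<le> real K" using K by simp
    then have "1 \<le> real K ^ 3" "real K \<le> real K ^ 3"
      by (auto intro: self_le_power one_le_power)
    then show "2 + 2 * real K + 500 * real K ^ 3 \<le> 1000 * real K ^ 3" by linarith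
  qed simp
  finally show ?thesis .
qed

text \<open>Both strings are \<open>(01)\<^sup>2\<^sup>k\<^sup>+\<^sup>2\<close> with one 0 deleted, so up to a factor \<open>1/q\<close> the law of a
  trace of that string dominates both laws.\<close>

lemma x_string_embedded: "emb w (x_string k) \<le> emb w (pow01 (Suc k) @ pow01 (Suc k))"
  and y_string_embedded: "emb w (y_string k) \<le> emb w (pow01 (Suc k) @ pow01 (Suc k))"
proof -
  have "pow01 (Suc k) @ pow01 (Suc k) = pow01 (k + Suc (Suc k))"
    by (simp only: pow01_add[symmetric] add_Suc add_Suc_right)
  also have "\<dots> = pow01 k @ False # True # pow01 (Suc k)"
    by (simp only: pow01_add pow01_Suc)
  finally have z: "pow01 (Suc k) @ pow01 (Suc k) = pow01 k @ False # True # pow01 (Suc k)" .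
  show "emb w (x_string k) \<le> emb w (pow01 (Suc k) @ pow01 (Suc k))"
    unfolding z x_string_def by (simp, intro emb_append_mono emb_Cons_ge)
  have z': "pow01 (Suc k) @ pow01 (Suc k) = pow01 (Suc k) @ False # True # pow01 k"
    by (subst (2) pow01_Suc) (rule refl)
  have "y_string k = pow01 (Suc k) @ True # pow01 k" by (simp add: y_string_def)
  then show "emb w (y_string k) \<le> emb w (pow01 (Suc k) @ pow01 (Suc k))"
    unfolding z' by (simp only:, intro emb_append_mono emb_Cons_ge)
qed

lemma x_string_neq_y_string: "x_string k \<noteq> y_string k"
proof -
  have "y_string k = pow01 k @ False # True # (True # pow01 k)"
    using pow01_add[of k 1] by (simp add: y_string_def pow01_Suc)
  then show ?thesis by (simp add: x_string_def)
qed

lemma one_minus_affinity_le: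
  fixes q :: real
  assumes q: "0 < q" "q < 1"
  obtains C k0 where "C > 0"
    "\<And>k. k \<ge> k0 \<Longrightarrow> 1 - affinity (strings_upto (4 * k + 3)) (trace_pmf q (x_string k)) (trace_pmf q (y_string k))
      \<le> C * ln (real (4 * k + 3)) ^ 7 / real (4 * k + 3) powr (3/2)"
proof -
  obtain C0 \<eta>0 where C0: "C0 > 0" "\<eta>0 > 0" and ratio:
    "\<And>k L w. \<lbrakk>2 \<le> L; L / sqrt (real (Suc k)) < \<eta>0; typical q (Suc k) L w\<rbrakk> \<Longrightarrow>
      \<bar>real (emb w (x_string k)) - real (emb w (y_string k))\<bar> \<le>
        C0 * (sqrt (sqrt (real (Suc k)) * L) * L) * (L / sqrt (real (Suc k)))\<^sup>2 * real (emb w (x_string k))"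
    using typical_trace_ratio[OF q] by blast
  have "((\<lambda>k. ln (real (4 * k + 3)) / sqrt (real (Suc k))) \<longlongrightarrow> 0) at_top" by real_asymp
  then have ev1: "\<forall>\<^sub>F k in at_top. ln (real (4 * k + 3)) / sqrt (real (Suc k)) < \<eta>0"
    using C0 by (auto dest: order_tendstoD(2))
  have "filterlim (\<lambda>k. ln (real (4 * k + 3))) at_top at_top" by real_asymp
  then have ev2: "\<forall>\<^sub>F k in at_top. ln (real (4 * k + 3)) \<ge> 5"
    by (auto simp: filterlim_at_top)
  from eventually_conj[OF ev1 ev2] obtain k0 where
    k0: "\<And>k. k \<ge> k0 \<Longrightarrow> ln (real (4 * k + 3)) / sqrt (real (Suc k)) < \<eta>0 \<and> ln (real (4 * k + 3)) \<ge> 5"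
    unfolding eventually_at_top_linorder by blast
  define C where "C = 1000 / q + 4 * C0\<^sup>2"
  show ?thesis
  proof (rule that)
    show "C > 0" using q C0 by (simp add: C_def add_pos_pos)
    fix k assume k: "k \<ge> k0"
    define n where "n = 4 * k + 3"
    define K where "K = Suc k"
    \<comment> \<open>With logarithmic \<open>L\<close> the atypical probability
      \<open>exp(- L^2)\<close> decays faster than every power of \<open>n\<close>, while typical
      deviations grow only by logarithms.\<close>
    define L where "L = ln (real n)"
    define x where "x = x_string k"
    define y where "y = y_string k"
    have L: "L \<ge> 5" and small: "L / sqrt (real (Suc k)) < \<eta>0"
      using k0[OF k] by (auto simp: L_def n_def)
    have n: "real n \<ge> 1" "real K \<le> real n" "real n \<le> 4 * real K" by (simp_all add: n_def K_def)
    have len: "length x = n" "length y = n"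
      by (simp_all add: x_def y_def n_def length_x_string length_y_string)
    define R where "R = C0 * (sqrt (sqrt (real K) * L) * L) * (L / sqrt (real K))\<^sup>2"
    define B where "B = {w. \<not> typical q K L w}"
    have sup: "set_pmf (trace_pmf q x) \<subseteq> strings_upto n" "set_pmf (trace_pmf q y) \<subseteq> strings_upto n"
      using set_trace_pmf[of q x] set_trace_pmf[of q y] len by auto
    have R0: "R \<ge> 0" unfolding R_def using C0 L by (intro mult_nonneg_nonneg) auto
    have bound: "\<bar>pmf (trace_pmf q x) w - pmf (trace_pmf q y) w\<bar> \<le> R * pmf (trace_pmf q x) w"
      if "w \<in> strings_upto n - B" for w
    proof -
      define \<kappa> where "\<kappa> = (1 - q) ^ length w * q ^ (n - length w)"
      have \<kappa>: "\<kappa> \<ge> 0" using q by (simp add: \<kappa>_def)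
      have "\<bar>real (emb w x) - real (emb w y)\<bar> \<le> R * real (emb w x)"
        using ratio[of L k w] that L small unfolding B_def x_def y_def R_def K_def by simp
      then have "\<kappa> * \<bar>real (emb w x) - real (emb w y)\<bar> \<le> \<kappa> * (R * real (emb w x))"
        using \<kappa> by (rule mult_left_mono)
      moreover have "pmf (trace_pmf q x) w = \<kappa> * real (emb w x)" "pmf (trace_pmf q y) w = \<kappa> * real (emb w y)"
        using q len by (simp_all add: pmf_trace_emb \<kappa>_def)
      ultimately show ?thesis using \<kappa>
        by (simp add: abs_mult mult_ac flip: right_diff_distrib)
    qed
    have bad: "measure_pmf.prob (trace_pmf q z) B \<le> 1000 / q * (real K ^ 3 * exp (- (L\<^sup>2)))"
      if "z \<in> {x, y}" for z
    proof -
      have "q * measure_pmf.prob (trace_pmf q z) B \<le> measure_pmf.prob (trace_pmf q (pow01 K @ pow01 K)) B"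
        using that x_string_embedded y_string_embedded len
        by (intro prob_trace_le q) (auto simp: x_def y_def K_def n_def)
      also have "\<dots> \<le> 1000 * real K ^ 3 * exp (- (L\<^sup>2))"
        unfolding B_def using L by (intro prob_atypical_pow01 q) (auto simp: K_def)
      finally show ?thesis using q by (simp add: field_simps)
    qed
    define H where "H = L ^ 7 / real n powr (3/2)"
    have nH: "L ^ 7 * real n powr (- (3/2)) = H"
      by (simp only: H_def powr_minus divide_inverse)
    have L7: "L ^ 7 \<ge> 1" using L by (intro one_le_power) auto
    have bad_H: "real K ^ 3 * exp (- (L\<^sup>2)) \<le> H"
    proof -
      \<comment> \<open>The exponent 5 beats the factor \<open>K^3\<close> and leaves
        \<open>n^(-2)\<close>, below \<open>n^(-3/2)\<close>.\<close>
      have "5 * L \<le> L\<^sup>2" using L by (simp add: power2_eq_square mult_right_mono)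
      then have "exp (- (L\<^sup>2)) \<le> exp (- 5 * L)" by simp
      also have "\<dots> = real n powr (- 5)" using n by (simp add: powr_def L_def)
      finally have 1: "exp (- (L\<^sup>2)) \<le> real n powr (- 5)" .
      have "real K ^ 3 \<le> real n powr 3" using n by (simp add: power_mono)
      then have "real K ^ 3 * exp (- (L\<^sup>2)) \<le> real n powr 3 * real n powr (- 5)"
        using 1 by (intro mult_mono) auto
      also have "\<dots> = real n powr (3 + - 5)" by (rule powr_add[symmetric])
      also have "\<dots> = real n powr (- 2)" by simp
      also have "\<dots> \<le> real n powr (- (3/2))" using n by (intro powr_mono) auto
      also have "\<dots> \<le> L ^ 7 * real n powr (- (3/2))" using L7 mult_right_mono[of 1 "L ^ 7" "real n powr (- (3/2))"] by simp
      finally show ?thesis by (simp only: nH)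
    qed
    have R_H: "R\<^sup>2 \<le> 8 * C0\<^sup>2 * H"
    proof -
      have K1: "real K > 0" by (simp add: K_def)
      have roots: "(sqrt (sqrt (real K) * L))\<^sup>2 = sqrt (real K) * L" "(sqrt (real K))\<^sup>2 = real K"
        using L by simp_all
      \<comment> \<open>The seven logarithms: one from the length of the window, two from the
        discrepancy on it, four from \<open>(L / sqrt K)^4\<close>.\<close>
      have "R\<^sup>2 = C0\<^sup>2 * ((sqrt (real K) * L) * L\<^sup>2) * ((L\<^sup>2)\<^sup>2 / (real K)\<^sup>2)"
        by (simp only: R_def power_mult_distrib power_divide roots)
      also have "\<dots> = C0\<^sup>2 * (L * L\<^sup>2 * (L\<^sup>2)\<^sup>2) * (sqrt (real K) / (real K)\<^sup>2)"
        by (simp add: mult_ac)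
      also have "L * L\<^sup>2 * (L\<^sup>2)\<^sup>2 = L ^ 7" by algebra
      also have "sqrt (real K) / (real K)\<^sup>2 = real K powr (- (3/2))"
      proof -
        have "sqrt (real K) / (real K)\<^sup>2 = real K powr (1/2) / real K powr 2"
          using K1 by (simp add: powr_half_sqrt)
        also have "\<dots> = real K powr (1/2 - 2)" by (rule powr_diff[symmetric])
        finally show ?thesis by simp
      qed
      finally have R2: "R\<^sup>2 = C0\<^sup>2 * L ^ 7 * real K powr (- (3/2))" .
      have "real K powr (- (3/2)) \<le> 8 * real n powr (- (3/2))"
      proof -
        have "real K powr (- (3/2)) \<le> (real n / 4) powr (- (3/2))"
          using n K1 by (intro powr_mono2') auto
        also have "\<dots> = real n powr (- (3/2)) / 4 powr (- (3/2))" by (rule powr_divide)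
        also have "(4::real) powr (- (3/2)) = 1 / 8"
        proof -
          have "(4::real) powr (3/2) = 4 powr (1 + 1/2)" by simp
          also have "\<dots> = 4 powr 1 * 4 powr (1/2)" by (rule powr_add)
          also have "\<dots> = 8" by (simp add: powr_half_sqrt)
          finally show ?thesis by (simp add: powr_minus)
        qed
        finally show ?thesis by simp
      qed
      then have "C0\<^sup>2 * L ^ 7 * real K powr (- (3/2)) \<le> C0\<^sup>2 * L ^ 7 * (8 * real n powr (- (3/2)))"
        using L by (intro mult_left_mono) auto
      also have "\<dots> = 8 * C0\<^sup>2 * (L ^ 7 * real n powr (- (3/2)))" by (simp only: mult_ac)
      finally show ?thesis by (simp only: R2 nH)
    qed
    have "1 - affinity (strings_upto n) (trace_pmf q x) (trace_pmf q y) \<le>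
        (measure_pmf.prob (trace_pmf q x) B + measure_pmf.prob (trace_pmf q y) B + R\<^sup>2) / 2"
      using bound by (intro hellinger_le sup R0) auto
    also have "\<dots> \<le> (1000 / q * H + 1000 / q * H + 8 * C0\<^sup>2 * H) / 2"
    proof -
      have "1000 / q * (real K ^ 3 * exp (- (L\<^sup>2))) \<le> 1000 / q * H"
        using q by (intro mult_left_mono bad_H) auto
      then show ?thesis using bad[of x] bad[of y] R_H
        by (intro divide_right_mono add_mono) auto
    qed
    also have "\<dots> = C * H" by (simp add: C_def distrib_right)
    finally show "1 - affinity (strings_upto (4 * k + 3)) (trace_pmf q (x_string k)) (trace_pmf q (y_string k))
      \<le> C * ln (real (4 * k + 3)) ^ 7 / real (4 * k + 3) powr (3/2)"
      by (simp add: H_def L_def n_def x_def y_def)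
  qed
qed

theorem theorem1:
  fixes q \<delta> :: real
  assumes "0 < q" and "q < 1" and "0 < \<delta>" and "\<delta> < 1/2"
  shows "\<exists>c>0. \<forall>k\<ge>1. \<forall>n. n = 4 * k + 3 \<longrightarrow>
    (\<forall>T. distinguishable q \<delta> n T (x_string k) (y_string k) \<longrightarrow>
         real T \<ge> c * real n powr (3/2) / ln (real n) ^ 7)"
proof -
  obtain C k0 where C: "C > 0" and aff:
    "\<And>k. k \<ge> k0 \<Longrightarrow> 1 - affinity (strings_upto (4 * k + 3)) (trace_pmf q (x_string k)) (trace_pmf q (y_string k))
      \<le> C * ln (real (4 * k + 3)) ^ 7 / real (4 * k + 3) powr (3/2)"
    using one_minus_affinity_le[OF assms(1,2)] by blast
  define \<epsilon> where "\<epsilon> = 1 - 2 * sqrt (\<delta> * (1 - \<delta>))"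
  have \<epsilon>: "\<epsilon> > 0"
  \<comment> \<open>The geometric mean of \<open>\<delta>\<close> and \<open>1 - \<delta>\<close> is
    strictly below their mean 1/2, as they differ.\<close>
  proof -
    have "0 < (1 - 2 * \<delta>)\<^sup>2" using assms by (intro zero_less_power) auto
    then have "\<delta> * (1 - \<delta>) < (1/2)\<^sup>2" by (simp add: power2_eq_square algebra_simps)
    then have "sqrt (\<delta> * (1 - \<delta>)) < 1/2" using real_sqrt_less_iff[of "\<delta> * (1 - \<delta>)" "(1/2)\<^sup>2"] by simp
    then show ?thesis by (simp add: \<epsilon>_def)
  qed
  define N where "N = real (4 * k0 + 3)"
  have N: "N \<ge> 1" by (simp add: N_def)
  \<comment> \<open>The second entry serves the finitely many \<open>k\<close> below
    \<open>k0\<close>, where \<open>\<epsilon> \<le> T\<close> suffices.\<close>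
  define c where "c = min (\<epsilon> / C) (\<epsilon> / N powr (3/2))"
  have c: "c > 0" using \<epsilon> C N by (simp add: c_def)
  show ?thesis
  proof (intro exI[of _ c] conjI c allI impI)
    fix k n T :: nat
    assume k: "1 \<le> k" and n: "n = 4 * k + 3" and d: "distinguishable q \<delta> n T (x_string k) (y_string k)"
    define A where "A = affinity (strings_upto n) (trace_pmf q (x_string k)) (trace_pmf q (y_string k))"
    have "\<epsilon> \<le> real T * (1 - A)"
      unfolding \<epsilon>_def A_def
      using distinguishable_affinity[OF d x_string_neq_y_string] assms(3,4)
      by (simp add: n length_x_string length_y_string)
    have A0: "A \<ge> 0" unfolding A_def affinity_def by (intro sum_nonneg) auto
    have "exp (1::real) \<le> real n" using exp_le n k by linarith
    then have "ln (exp 1) \<le> ln (real n)" by (subst ln_le_cancel_iff) (auto simp: n)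
    then have "1 \<le> ln (real n)" by simp
    then have ln: "ln (real n) ^ 7 \<ge> 1" "ln (real n) > 0" by (auto intro: one_le_power)
    have n0: "real n powr (3/2) > 0" by (simp add: n)
    show "real T \<ge> c * real n powr (3/2) / ln (real n) ^ 7"
    proof (cases "k \<ge> k0")
      case True
      have "\<epsilon> \<le> real T * (C * ln (real n) ^ 7 / real n powr (3/2))"
        using \<open>\<epsilon> \<le> real T * (1 - A)\<close> aff[OF True] unfolding A_def n[symmetric]
        by (meson mult_left_mono of_nat_0_le_iff order_trans)
      moreover have "\<epsilon> / C * p / l \<le> t" if "\<epsilon> \<le> t * (C * l / p)" "l \<ge> 1" "p > 0" for p l t
        using that C by (simp add: field_simps)
      ultimately have "\<epsilon> / C * real n powr (3/2) / ln (real n) ^ 7 \<le> real T"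
        using ln n0 by blast
      moreover have "c * real n powr (3/2) / ln (real n) ^ 7 \<le> \<epsilon> / C * real n powr (3/2) / ln (real n) ^ 7"
        using ln by (intro divide_right_mono mult_right_mono) (auto simp: c_def)
      ultimately show ?thesis by linarith
    next
      case False
      have "c * real n powr (3/2) / ln (real n) ^ 7 \<le> c * real n powr (3/2) / 1"
        using ln c by (intro divide_left_mono) auto
      also have "\<dots> \<le> c * N powr (3/2)"
        using c False unfolding div_by_1 by (intro mult_left_mono powr_mono2) (auto simp: N_def n)
      also have "\<dots> \<le> \<epsilon> / N powr (3/2) * N powr (3/2)"
        by (intro mult_right_mono) (auto simp: c_def)
      also have "\<dots> = \<epsilon>" using N by simp
      also have "\<dots> \<le> real T * 1"
        using \<open>\<epsilon> \<le> real T * (1 - A)\<close> A0 mult_left_mono[of "1 - A" 1 "real T"] by linarith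
      finally show ?thesis by simp
    qed
  qed
qed

end
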